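(* Consider the Newtonian $N$-body problem in a Euclidean space $E$ with $\dim E\ge2$ and masses $m_1,\dots,m_N>0$, and let $h>0$. If $u\in\mathcal{B}_h$, then for each $x\in E^N$ there is a curve $\gamma_x:[0,+\infty)\to E^N$ with $\gamma_x(0)=x$ and such that for all $t>0$ $$u(x)-u(\gamma_x(t))=\mathcal{A}_{L+h}(\gamma_x|_{[0,t]}).$$ In particular, every function $u\in\mathcal{B}_h$ satisfies $T_tu=u-ht$ for all $t>0$.
   Context: $E$ is a finite-dimensional Euclidean space, $N\ge 2$, $m_1,\dots,m_N>0$. For $x=(r_1,\dots,r_N),\,y=(s_1,\dots,s_N)\in E^N$ the mass inner product is $\langle x,y\rangle=\sum_i m_i\langle r_i,s_i\rangle_E$, with norm $\|\cdot\|$. $U(x)=\sum_{i<j}m_im_j\|r_i-r_j\|_E^{-1}\in(0,+\infty]$ and $L(x,v)=\frac12\|v\|^2+U(x)$. Curves are absolutely continuous (on compact subintervals). $\mathcal{C}(x,y)$ is the set of absolutely continuous curves $\gamma:[a,b]\to E^N$ ($a<b$ arbitrary) with $\gamma(a)=x$, $\gamma(b)=y$, and $\mathcal{C}(x,y,\tau)$ the subset of those with $b-a=\tau$. $\mathcal{A}_{L}(\gamma)=\int_a^b L(\gamma,\dot\gamma)\,dt$, $\mathcal{A}_{L+h}(\gamma)=\int_a^b (L(\gamma,\dot\gamma)+h)\,dt$. $\phi(x,y,\tau)=\inf\{\mathcal{A}_L(\gamma):\gamma\in\mathcal{C}(x,y,\tau)\}$ and $\phi_h(x,y)=\inf\{\mathcal{A}_{L+h}(\gamma):\gamma\in\mathcal{C}(x,y)\}$.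 $\mathcal{B}_h$ is the set of $u\in C^0(E^N)$ for which there is a sequence $p_n\in E^N$ with $\|p_n\|\to+\infty$ and $u(x)=\lim_{n\to\infty}\big(\phi_h(x,p_n)-\phi_h(0,p_n)\big)$ for all $x\in E^N$. The (backward) Lax-Oleinik semigroup is $T_tu(x)=\inf\{u(y)+\phi(y,x,t): y\in E^N\}$ for $t>0$. *)

theory Defs
  imports "HOL-Analysis.Analysis"
begin

text \<open>
  The Euclidean space \<open>E\<close> is a type \<open>'a::euclidean_space\<close>, and configurations of bodies indexed by
  the finite linear order \<open>'n\<close> are elements of \<open>'a ^ 'n\<close>. The norm of the type \<open>'a ^ 'n\<close> is the one
  with unit masses; it is equivalent to \<open>mass_norm m\<close> when all masses are positive, and below it
  only serves for topological notions, absolute continuity and derivatives.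
\<close>

text \<open>The notation \<open>'a ^ 'n\<close> fixes the sort of \<open>'n\<close> to \<open>finite\<close>, hence the synonym.\<close>

type_synonym ('a, 'n) config = "('a, 'n) vec"

definition mass_inner ::
    "('n::finite \<Rightarrow> real) \<Rightarrow> ('a::euclidean_space, 'n) config \<Rightarrow> ('a, 'n) config \<Rightarrow> real" where
  "mass_inner m x y = (\<Sum>i\<in>UNIV. m i * (x $ i \<bullet> y $ i))"

definition mass_norm :: "('n::finite \<Rightarrow> real) \<Rightarrow> ('a::euclidean_space, 'n) config \<Rightarrow> real" where
  "mass_norm m x = sqrt (mass_inner m x x)"

text \<open>In \<open>ennreal\<close>, \<open>inverse 0 = \<infinity>\<close>, so for positive masses the potential is infinite
  exactly at collisions.\<close>

definition newton_potential ::
    "('n::{finite,linorder} \<Rightarrow> real) \<Rightarrow> ('a::euclidean_space, 'n) config \<Rightarrow> ennreal" where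
  "newton_potential m x =
     (\<Sum>(i, j)\<in>{(i, j). i < j}. ennreal (m i * m j) * inverse (ennreal (norm (x $ i - x $ j))))"

definition lagrangian ::
    "('n::{finite,linorder} \<Rightarrow> real) \<Rightarrow> ('a::euclidean_space, 'n) config \<Rightarrow>
     ('a, 'n) config \<Rightarrow> ennreal" where
  "lagrangian m x v = ennreal (1/2 * (mass_norm m v)\<^sup>2) + newton_potential m x"

definition abs_continuous_on :: "real \<Rightarrow> real \<Rightarrow> (real \<Rightarrow> 'b::real_normed_vector) \<Rightarrow> bool" where
  "abs_continuous_on a b \<gamma> \<longleftrightarrow>
     (\<forall>\<epsilon>>0. \<exists>\<delta>>0. \<forall>P.
        finite P \<and> (\<forall>(c, d)\<in>P. a \<le> c \<and> c < d \<and> d \<le> b) \<and>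
        disjoint_family_on (\<lambda>(c, d). {c<..<d}) P \<and> (\<Sum>(c, d)\<in>P. d - c) < \<delta>
        \<longrightarrow> (\<Sum>(c, d)\<in>P. norm (\<gamma> d - \<gamma> c)) < \<epsilon>)"

text \<open>
  An absolutely continuous curve is differentiable almost everywhere, so the value of
  \<^const>\<open>vector_derivative\<close> at the remaining points is irrelevant. Lebesgue rather than Borel
  measure is used because that arbitrary value need not be Borel measurable. The action is an
  \<open>ereal\<close> so that it can be compared with differences of real numbers.
\<close>

definition action ::
    "(('a::euclidean_space, 'n::finite) config \<Rightarrow> ('a, 'n) config \<Rightarrow> ennreal) \<Rightarrow>
     real \<Rightarrow> real \<Rightarrow> (real \<Rightarrow> ('a, 'n) config) \<Rightarrow> ereal" where
  "action F a b \<gamma> = enn2ereal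
     (\<integral>\<^sup>+t\<in>{a..b}. F (\<gamma> t) (vector_derivative \<gamma> (at t within {a..b})) \<partial>lebesgue)"

abbreviation action_L ::
    "('n::{finite,linorder} \<Rightarrow> real) \<Rightarrow> real \<Rightarrow> real \<Rightarrow>
     (real \<Rightarrow> ('a::euclidean_space, 'n) config) \<Rightarrow> ereal" where
  "action_L m \<equiv> action (lagrangian m)"

text \<open>Only for \<open>h \<ge> 0\<close>: \<^const>\<open>ennreal\<close> maps negative numbers to \<open>0\<close>.\<close>

abbreviation action_Lh ::
    "('n::{finite,linorder} \<Rightarrow> real) \<Rightarrow> real \<Rightarrow>
     real \<Rightarrow> real \<Rightarrow> (real \<Rightarrow> ('a::euclidean_space, 'n) config) \<Rightarrow> ereal" where
  "action_Lh m h \<equiv> action (\<lambda>x v. lagrangian m x v + ennreal h)"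

text \<open>
  A curve is a triple \<open>(a, b, \<gamma>)\<close>, where only the restriction of \<open>\<gamma>\<close> to \<open>{a..b}\<close> matters.
\<close>

definition curves :: "'b::real_normed_vector \<Rightarrow> 'b \<Rightarrow> (real \<times> real \<times> (real \<Rightarrow> 'b)) set" where
  "curves x y = {(a, b, \<gamma>). a < b \<and> abs_continuous_on a b \<gamma> \<and> \<gamma> a = x \<and> \<gamma> b = y}"

definition curves_time ::
    "'b::real_normed_vector \<Rightarrow> 'b \<Rightarrow> real \<Rightarrow> (real \<times> real \<times> (real \<Rightarrow> 'b)) set" where
  "curves_time x y \<tau> = {(a, b, \<gamma>) \<in> curves x y. b - a = \<tau>}"

definition fixed_time_potential ::
    "('n::{finite,linorder} \<Rightarrow> real) \<Rightarrow> ('a::euclidean_space, 'n) config \<Rightarrow>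
     ('a, 'n) config \<Rightarrow> real \<Rightarrow> ereal" where
  "fixed_time_potential m x y \<tau> = (INF (a, b, \<gamma>)\<in>curves_time x y \<tau>. action_L m a b \<gamma>)"

definition action_potential ::
    "('n::{finite,linorder} \<Rightarrow> real) \<Rightarrow> real \<Rightarrow> ('a::euclidean_space, 'n) config \<Rightarrow>
     ('a, 'n) config \<Rightarrow> ereal" where
  "action_potential m h x y = (INF (a, b, \<gamma>)\<in>curves x y. action_Lh m h a b \<gamma>)"

definition horofunctions ::
    "('n::{finite,linorder} \<Rightarrow> real) \<Rightarrow> real \<Rightarrow>
     (('a::euclidean_space, 'n) config \<Rightarrow> real) set" where
  "horofunctions m h = {u. continuous_on UNIV u \<and>
     (\<exists>p :: nat \<Rightarrow> ('a, 'n) config. filterlim (\<lambda>n. mass_norm m (p n)) at_top sequentially \<and>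
        (\<forall>x. (\<lambda>n. action_potential m h x (p n) - action_potential m h 0 (p n))
               \<longlonglongrightarrow> ereal (u x)))}"

definition lax_oleinik ::
    "('n::{finite,linorder} \<Rightarrow> real) \<Rightarrow> real \<Rightarrow>
     (('a::euclidean_space, 'n) config \<Rightarrow> real) \<Rightarrow> ('a, 'n) config \<Rightarrow> ereal" where
  "lax_oleinik m t u x = (INF y. ereal (u y) + fixed_time_potential m y x t)"

end

theory Submission
  imports Defs "HOL-Complex_Analysis.Great_Picard"
begin

text \<open>
  Let \<open>\<phi>\<close> be the action potential for the energy \<open>h\<close>. Two properties of a horofunction \<open>u\<close> give the
  result. First, \<open>u\<close> is dominated: \<open>u x - u y \<le> \<phi> x y\<close>, which is the triangle inequality for \<open>\<phi>\<close> in
  the limit (\<open>action_potential_triangle\<close>). Second, every \<open>x\<close> is the origin of a ray along which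
  domination is an equality. Such a ray is a limit of curves from \<open>x\<close> to \<open>p n\<close> that minimize up to an
  error \<open>\<epsilon> n \<rightarrow> 0\<close>: a nearly minimizing curve satisfies
  \<open>A(c|[0,t]) \<le> \<phi> x (p n) - \<phi> (c t) (p n) + \<epsilon> n\<close>, and both sides pass to the limit
  (\<open>calibrated_ray_exists\<close>). The identity for the Lax-Oleinik semigroup follows: domination, together
  with the symmetry of \<open>\<phi>\<close>, gives one inequality, and the reversed ray attains the infimum.

  The passage to the limit rests on three facts.

  The first is a modulus of continuity for \<open>\<phi>\<close> that is uniform near collisions,
  \<open>\<phi> x y \<le> C * (sqrt r + r * sqrt r)\<close> for \<open>norm (x - y) \<le> r\<close> (\<open>action_potential_modulus\<close>). It is obtained
  from explicit curves along which the bodies move apart, with the time law \<open>t powr (2/3)\<close> of parabolic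
  motion. Played off against the bound of displacement by action, it shows that near minimizers of duration
  at most \<open>T\<close> have bounded displacement and action (\<open>near_minimizer_bounded\<close>). So the durations tend to
  infinity, and on each \<open>[0, T]\<close> the curves are equicontinuous.

  The second is lower semicontinuity of the action under pointwise convergence
  (\<open>action_lower_semicontinuous\<close>). Difference quotients converge where velocities may not, and by
  convexity their energy does not exceed that of the velocities.

  The third is the fundamental theorem of calculus for absolutely continuous curves
  (\<open>abs_continuous_on_iff_primitive\<close>, \<open>primitive_on_AE_derivative\<close>), without which the action, defined through the
  pointwise derivative, says nothing about displacements. By the Jordan decomposition it is enough to treat
  nondecreasing functions; the Stieltjes measure of such a function has a density by the Radon-Nikodym theorem,
  and Lebesgue's differentiation theorem identifies this density with the derivative.
\<close>

section \<open>Packings of an interval and absolute continuity\<close>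

text \<open>
  A packing is a finite family of non-overlapping subintervals of \<open>[a, b]\<close>, the kind of family over
  which \<^const>\<open>abs_continuous_on\<close> quantifies. Non-overlap is expressed by comparing endpoints rather
  than by disjointness of open intervals, so that linear arithmetic applies.
\<close>

definition packing :: "real \<Rightarrow> real \<Rightarrow> (real \<times> real) set \<Rightarrow> bool" where
  "packing a b P \<longleftrightarrow> finite P \<and> (\<forall>(c, d)\<in>P. a \<le> c \<and> c < d \<and> d \<le> b) \<and>
     (\<forall>(c, d)\<in>P. \<forall>(c', d')\<in>P. (c, d) \<noteq> (c', d') \<longrightarrow> d \<le> c' \<or> d' \<le> c)"

abbreviation total_length :: "(real \<times> real) set \<Rightarrow> real" where
  "total_length P \<equiv> (\<Sum>(c, d)\<in>P. d - c)"

abbreviation total_increment :: "(real \<Rightarrow> 'b::real_normed_vector) \<Rightarrow> (real \<times> real) set \<Rightarrow> real" where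
  "total_increment f P \<equiv> (\<Sum>(c, d)\<in>P. norm (f d - f c))"

lemma packingI:
  assumes "finite P" "\<And>c d. (c, d) \<in> P \<Longrightarrow> a \<le> c \<and> c < d \<and> d \<le> b"
    "\<And>c d c' d'. (c, d) \<in> P \<Longrightarrow> (c', d') \<in> P \<Longrightarrow> (c, d) \<noteq> (c', d') \<Longrightarrow> d \<le> c' \<or> d' \<le> c"
  shows "packing a b P"
  unfolding packing_def using assms by blast

lemma packingD:
  assumes "packing a b P"
  shows "finite P" "(c, d) \<in> P \<Longrightarrow> a \<le> c \<and> c < d \<and> d \<le> b"
    "(c, d) \<in> P \<Longrightarrow> (c', d') \<in> P \<Longrightarrow> (c, d) \<noteq> (c', d') \<Longrightarrow> d \<le> c' \<or> d' \<le> c"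
  using assms unfolding packing_def by blast+

lemma packing_mono: "packing a b P \<Longrightarrow> a' \<le> a \<Longrightarrow> b \<le> b' \<Longrightarrow> packing a' b' P"
  unfolding packing_def by fastforce

lemma packing_single: "a \<le> c \<Longrightarrow> c < d \<Longrightarrow> d \<le> b \<Longrightarrow> packing a b {(c, d)}"
  unfolding packing_def by auto

lemma abs_continuous_on_iff:
  "abs_continuous_on a b f \<longleftrightarrow>
     (\<forall>\<epsilon>>0. \<exists>\<delta>>0. \<forall>P. packing a b P \<and> total_length P < \<delta> \<longrightarrow> total_increment f P < \<epsilon>)"
proof -
  have iv: "({c<..<d} \<inter> {c'<..<d'} = {}) = (d \<le> c' \<or> d' \<le> c)" if "c < d" "c' < d'" for c d c' d' :: real
  proof -
    have "{c<..<d} \<inter> {c'<..<d'} = {max c c'<..<min d d'}" by auto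
    then show ?thesis using that by auto
  qed
  have *: "finite P \<and> (\<forall>(c, d)\<in>P. a \<le> c \<and> c < d \<and> d \<le> b) \<and>
        disjoint_family_on (\<lambda>(c, d). {c<..<d}) P \<longleftrightarrow> packing a b P" for P :: "(real \<times> real) set"
  proof -
    have "disjoint_family_on (\<lambda>(c, d). {c<..<d}) P \<longleftrightarrow>
        (\<forall>z\<in>P. \<forall>z'\<in>P. z \<noteq> z' \<longrightarrow> snd z \<le> fst z' \<or> snd z' \<le> fst z)"
      if P: "\<forall>z\<in>P. a \<le> fst z \<and> fst z < snd z \<and> snd z \<le> b"
      unfolding disjoint_family_on_def case_prod_beta
    proof (intro ball_cong refl)
      fix z z' assume "z \<in> P" "z' \<in> P"
      then have "fst z < snd z" "fst z' < snd z'" using P by blast+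
      from iv[OF this] show "(z \<noteq> z' \<longrightarrow> {fst z<..<snd z} \<inter> {fst z'<..<snd z'} = {}) =
        (z \<noteq> z' \<longrightarrow> snd z \<le> fst z' \<or> snd z' \<le> fst z)" by (simp only:)
    qed
    then show ?thesis unfolding packing_def case_prod_beta prod.collapse by blast
  qed
  show ?thesis unfolding abs_continuous_on_def by (simp only: *[symmetric] conj_assoc)
qed

lemma abs_continuous_onD:
  assumes "abs_continuous_on a b f" "\<epsilon> > 0"
  obtains \<delta> where "\<delta> > 0" "\<And>P. packing a b P \<Longrightarrow> total_length P < \<delta> \<Longrightarrow> total_increment f P < \<epsilon>"
  using assms unfolding abs_continuous_on_iff by blast

lemma abs_continuous_on_subinterval:
  assumes "abs_continuous_on a b f" "a \<le> c" "d \<le> b"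
  shows "abs_continuous_on c d f"
  unfolding abs_continuous_on_iff
proof (intro allI impI)
  fix \<epsilon> :: real assume "\<epsilon> > 0"
  from abs_continuous_onD[OF assms(1) this] obtain \<delta> where \<delta>: "\<delta> > 0"
    "\<And>P. packing a b P \<Longrightarrow> total_length P < \<delta> \<Longrightarrow> total_increment f P < \<epsilon>" by blast
  then show "\<exists>\<delta>>0. \<forall>P. packing c d P \<and> total_length P < \<delta> \<longrightarrow> total_increment f P < \<epsilon>"
    using packing_mono[OF _ assms(2,3)] by blast
qed

lemma abs_continuous_on_cong:
  assumes "abs_continuous_on a b f" "\<And>t. a \<le> t \<Longrightarrow> t \<le> b \<Longrightarrow> f t = g t"
  shows "abs_continuous_on a b g"
proof -
  have "total_increment f P = total_increment g P" if "packing a b P" for P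
    by (rule sum.cong[OF refl]) (use packingD(2)[OF that] assms(2) in fastforce)
  then show ?thesis using assms(1) unfolding abs_continuous_on_iff by metis
qed

lemma abs_continuous_on_dominated:
  assumes "abs_continuous_on a b f"
    and "\<And>c d. a \<le> c \<Longrightarrow> c < d \<Longrightarrow> d \<le> b \<Longrightarrow> norm (g d - g c) \<le> norm (f d - f c)"
  shows "abs_continuous_on a b g"
proof -
  have "total_increment g P \<le> total_increment f P" if "packing a b P" for P
    by (rule sum_mono) (use packingD(2)[OF that] assms(2) in auto)
  then show ?thesis using assms(1) unfolding abs_continuous_on_iff by (meson le_less_trans)
qed

lemma abs_continuous_on_diff:
  assumes "abs_continuous_on a b f" "abs_continuous_on a b g"
  shows "abs_continuous_on a b (\<lambda>t. f t - g t)"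
  unfolding abs_continuous_on_iff
proof (intro allI impI)
  fix \<epsilon> :: real assume e: "\<epsilon> > 0"
  then have e2: "\<epsilon> / 2 > 0" by simp
  from abs_continuous_onD[OF assms(1) e2] obtain \<delta> where \<delta>: "\<delta> > 0"
    "\<And>P. packing a b P \<Longrightarrow> total_length P < \<delta> \<Longrightarrow> total_increment f P < \<epsilon> / 2" by blast
  from abs_continuous_onD[OF assms(2) e2] obtain \<delta>' where \<delta>': "\<delta>' > 0"
    "\<And>P. packing a b P \<Longrightarrow> total_length P < \<delta>' \<Longrightarrow> total_increment g P < \<epsilon> / 2" by blast
  have "total_increment (\<lambda>t. f t - g t) P < \<epsilon>" if "packing a b P" "total_length P < min \<delta> \<delta>'" for P
  proof -
    have "total_increment (\<lambda>t. f t - g t) P \<le> (\<Sum>z\<in>P. (case z of (c, d) \<Rightarrow> norm (f d - f c)) + (case z of (c, d) \<Rightarrow> norm (g d - g c)))"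
    proof (rule sum_mono)
      fix z :: "real \<times> real"
      obtain c d where z: "z = (c, d)" by fastforce
      have "norm (f d - g d - (f c - g c)) = norm ((f d - f c) - (g d - g c))" by (simp add: algebra_simps)
      also have "\<dots> \<le> norm (f d - f c) + norm (g d - g c)" by (rule norm_triangle_ineq4)
      finally show "(case z of (c, d) \<Rightarrow> norm (f d - g d - (f c - g c)))
          \<le> (case z of (c, d) \<Rightarrow> norm (f d - f c)) + (case z of (c, d) \<Rightarrow> norm (g d - g c))"
        by (simp add: z)
    qed
    also have "\<dots> = total_increment f P + total_increment g P" by (rule sum.distrib)
    also have "\<dots> < \<epsilon>" using \<delta>(2)[OF that(1)] \<delta>'(2)[OF that(1)] that(2) by simp
    finally show ?thesis .
  qed
  then show "\<exists>\<delta>>0. \<forall>P. packing a b P \<and> total_length P < \<delta> \<longrightarrow> total_increment (\<lambda>t. f t - g t) P < \<epsilon>"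
    using \<delta>(1) \<delta>'(1) by (intro exI[of _ "min \<delta> \<delta>'"]) auto
qed

lemma abs_continuous_on_imp_continuous_on:
  assumes "abs_continuous_on a b f"
  shows "continuous_on {a..b} f"
  unfolding continuous_on_iff
proof (intro ballI allI impI)
  fix x \<epsilon> :: real assume x: "x \<in> {a..b}" and e: "\<epsilon> > 0"
  from abs_continuous_onD[OF assms e] obtain \<delta> where \<delta>: "\<delta> > 0"
    "\<And>P. packing a b P \<Longrightarrow> total_length P < \<delta> \<Longrightarrow> total_increment f P < \<epsilon>" by blast
  have "dist (f x') (f x) < \<epsilon>" if x': "x' \<in> {a..b}" "dist x' x < \<delta>" for x'
  proof -
    consider "x < x'" | "x' < x" | "x' = x" by linarith
    then show ?thesis
    proof cases
      case 1
      then show ?thesis using \<delta>(2)[OF packing_single[of a x x' b]] x x' by (auto simp: dist_norm)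
    next
      case 2
      then show ?thesis using \<delta>(2)[OF packing_single[of a x' x b]] x x' by (auto simp: dist_norm norm_minus_commute)
    qed (use e in simp)
  qed
  then show "\<exists>d>0. \<forall>x'\<in>{a..b}. dist x' x < d \<longrightarrow> dist (f x') (f x) < \<epsilon>" using \<delta>(1) by blast
qed

text \<open>
  Induction on the family, removing its rightmost interval: the others lie to the left of it.
\<close>

lemma packing_telescope:
  fixes \<Phi> :: "real \<Rightarrow> real"
  assumes "packing a b P" "a \<le> b" and mono: "\<And>s t. a \<le> s \<Longrightarrow> s \<le> t \<Longrightarrow> t \<le> b \<Longrightarrow> \<Phi> s \<le> \<Phi> t"
  shows "(\<Sum>(c, d)\<in>P. \<Phi> d - \<Phi> c) \<le> \<Phi> b - \<Phi> a"
proof -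
  have fin: "finite P" using packingD(1)[OF assms(1)] .
  have "packing a b' P \<longrightarrow> a \<le> b' \<longrightarrow> b' \<le> b \<longrightarrow> (\<Sum>(c, d)\<in>P. \<Phi> d - \<Phi> c) \<le> \<Phi> b' - \<Phi> a" for b'
    using fin
  proof (induction arbitrary: b' rule: finite_ranking_induct[where f = snd])
    case empty
    then show ?case using mono by simp
  next
    case (insert z P)
    obtain c d where z: "z = (c, d)" by fastforce
    show ?case
    proof (cases "z \<in> P")
      case True
      then show ?thesis using insert.IH by (simp add: insert_absorb)
    next
      case zP: False
      show ?thesis
      proof (intro impI)
        assume p: "packing a b' (insert z P)" and b': "a \<le> b'" "b' \<le> b"
        have cd: "a \<le> c" "c < d" "d \<le> b'" using packingD(2)[OF p] z by auto
        have "packing a c P"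
        proof (rule packingI)
          show "finite P" by (rule insert)
          fix c1 d1 assume h: "(c1, d1) \<in> P"
          have "a \<le> c1" "c1 < d1" using packingD(2)[OF p, of c1 d1] h by auto
          moreover have "d1 \<le> d" using insert(2)[OF h] z by simp
          moreover have "(c1, d1) \<noteq> (c, d)" using h z zP by auto
          then have "d1 \<le> c \<or> d \<le> c1" using packingD(3)[OF p, of c1 d1 c d] h z by auto
          ultimately show "a \<le> c1 \<and> c1 < d1 \<and> d1 \<le> c" by auto
        next
          fix c1 d1 c' d' assume "(c1, d1) \<in> P" "(c', d') \<in> P" "(c1, d1) \<noteq> (c', d')"
          then show "d1 \<le> c' \<or> d' \<le> c1" using packingD(3)[OF p] by blast
        qed
        then have "(\<Sum>(c, d)\<in>P. \<Phi> d - \<Phi> c) \<le> \<Phi> c - \<Phi> a"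
          using insert.IH[of c] cd b' by auto
        moreover have "\<Phi> d \<le> \<Phi> b'" using mono[of d b'] cd b' by auto
        ultimately show "(\<Sum>(c, d)\<in>insert z P. \<Phi> d - \<Phi> c) \<le> \<Phi> b' - \<Phi> a"
          using insert(1) zP z by simp
      qed
    qed
  qed
  then show ?thesis using assms by auto
qed

text \<open>
  Monotone maps push packings forward, once the intervals that collapse to points are dropped.
  It is applied to \<open>\<lambda>t. min t c\<close> and \<open>\<lambda>t. max t c\<close>, which cut a packing at \<open>c\<close>, and to the
  retraction of the line onto \<open>[a, b]\<close>.
\<close>

lemma packing_image:
  assumes P: "packing a b P" and \<theta>: "\<And>s t. s \<le> t \<Longrightarrow> \<theta> s \<le> (\<theta> t :: real)"
    and r: "\<And>t. a \<le> t \<Longrightarrow> t \<le> b \<Longrightarrow> a' \<le> \<theta> t \<and> \<theta> t \<le> b'"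
  defines "Q \<equiv> (\<lambda>(c, d). (\<theta> c, \<theta> d)) ` {z \<in> P. \<theta> (fst z) < \<theta> (snd z)}"
  shows "packing a' b' Q"
    and "(\<And>c. g c c = 0) \<Longrightarrow> (\<Sum>(c, d)\<in>Q. g c d) = (\<Sum>(c, d)\<in>P. (g (\<theta> c) (\<theta> d) :: real))"
proof -
  let ?P = "{z \<in> P. \<theta> (fst z) < \<theta> (snd z)}"
  have sep: "d \<le> c' \<or> d' \<le> c" if "(c, d) \<in> P" "(c', d') \<in> P" "(c, d) \<noteq> (c', d')" for c d c' d'
    using packingD(3)[OF P that] .
  show "packing a' b' Q"
  proof (rule packingI)
    show "finite Q" using packingD(1)[OF P] by (simp add: Q_def)
    fix c d assume "(c, d) \<in> Q"
    then obtain c0 d0 where 0: "(c0, d0) \<in> P" "c = \<theta> c0" "d = \<theta> d0" "c < d"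
      unfolding Q_def by auto
    then show "a' \<le> c \<and> c < d \<and> d \<le> b'"
      using packingD(2)[OF P 0(1)] r[of c0] r[of d0] by auto
  next
    fix c d c' d' assume *: "(c, d) \<in> Q" "(c', d') \<in> Q" "(c, d) \<noteq> (c', d')"
    obtain c0 d0 where 0: "(c0, d0) \<in> P" "c = \<theta> c0" "d = \<theta> d0" using *(1) unfolding Q_def by auto
    obtain c1 d1 where 1: "(c1, d1) \<in> P" "c' = \<theta> c1" "d' = \<theta> d1" using *(2) unfolding Q_def by auto
    have "(c0, d0) \<noteq> (c1, d1)" using 0 1 *(3) by auto
    from sep[OF 0(1) 1(1) this] show "d \<le> c' \<or> d' \<le> c" using 0 1 \<theta> by auto
  qed
  assume g: "\<And>c. g c c = 0"
  have inj: "inj_on (\<lambda>(c, d). (\<theta> c, \<theta> d)) ?P"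
  proof (rule inj_onI)
    fix z z' assume z: "z \<in> ?P" "z' \<in> ?P" "(\<lambda>(c, d). (\<theta> c, \<theta> d)) z = (\<lambda>(c, d). (\<theta> c, \<theta> d)) z'"
    obtain c0 d0 c1 d1 where e: "z = (c0, d0)" "z' = (c1, d1)" by fastforce
    show "z = z'"
    proof (rule ccontr)
      assume "z \<noteq> z'"
      then have "d0 \<le> c1 \<or> d1 \<le> c0" using sep[of c0 d0 c1 d1] z e by auto
      then show False using \<theta>[of d0 c1] \<theta>[of d1 c0] z e by auto
    qed
  qed
  have "(\<Sum>(c, d)\<in>Q. g c d) = (\<Sum>z\<in>?P. g (\<theta> (fst z)) (\<theta> (snd z)))"
    unfolding Q_def by (subst sum.reindex[OF inj]) (auto intro!: sum.cong simp: case_prod_beta)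
  also have "\<dots> = (\<Sum>z\<in>P. g (\<theta> (fst z)) (\<theta> (snd z)))"
  proof (rule sum.mono_neutral_left)
    show "finite P" using packingD(1)[OF P] .
    show "\<forall>z\<in>P - ?P. g (\<theta> (fst z)) (\<theta> (snd z)) = 0"
    proof
      fix z assume z: "z \<in> P - ?P"
      obtain c d where e: "z = (c, d)" by fastforce
      have "c < d" using packingD(2)[OF P, of c d] z e by auto
      then have "\<theta> c = \<theta> d" using z e \<theta>[of c d] by auto
      then show "g (\<theta> (fst z)) (\<theta> (snd z)) = 0" using g e by simp
    qed
  qed auto
  finally show "(\<Sum>(c, d)\<in>Q. g c d) = (\<Sum>(c, d)\<in>P. g (\<theta> c) (\<theta> d))" by (simp add: case_prod_beta)
qed

lemma packing_split:
  assumes P: "packing a b P" and c: "a \<le> c" "c \<le> b"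
  obtains Q R where "packing a c Q" "packing c b R"
    "total_increment f P \<le> total_increment f Q + total_increment f R"
proof -
  let ?Q = "(\<lambda>(p, q). (min p c, min q c)) ` {z \<in> P. min (fst z) c < min (snd z) c}"
  let ?R = "(\<lambda>(p, q). (max p c, max q c)) ` {z \<in> P. max (fst z) c < max (snd z) c}"
  let ?g = "\<lambda>p q. norm (f q - f p)"
  note Q = packing_image[OF P, of "\<lambda>t. min t c" a c]
  note R = packing_image[OF P, of "\<lambda>t. max t c" c b]
  have Q1: "packing a c ?Q" and Q2: "total_increment f ?Q = (\<Sum>(p, q)\<in>P. ?g (min p c) (min q c))"
    using Q(1) Q(2)[of ?g] c by auto
  have R1: "packing c b ?R" and R2: "total_increment f ?R = (\<Sum>(p, q)\<in>P. ?g (max p c) (max q c))"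
    using R(1) R(2)[of ?g] c by auto
  have "total_increment f P \<le> total_increment f ?Q + total_increment f ?R"
    unfolding Q2 R2 sum.distrib[symmetric]
  proof (rule sum_mono, clarify)
    fix p q assume "(p, q) \<in> P"
    then have "p < q" using packingD(2)[OF P] by auto
    then consider "q \<le> c" | "c \<le> p" | "p < c" "c < q" by linarith
    then show "?g p q \<le> ?g (min p c) (min q c) + ?g (max p c) (max q c)"
    proof cases
      case 3
      have "?g p q \<le> norm (f c - f p) + norm (f q - f c)"
        using norm_triangle_ineq[of "f c - f p" "f q - f c"] by simp
      then show ?thesis using 3 by (simp add: min_def max_def)
    qed (use \<open>p < q\<close> in \<open>simp_all add: min_def max_def\<close>)
  qed
  with that[OF Q1 R1] show thesis by blast
qed

text \<open>
  Refining every interval of a packing yields a packing. This turns nearly optimal packings for the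
  variations over the members of \<open>P\<close> into a single one.
\<close>

lemma packing_union:
  assumes P: "packing a b P" and Q: "\<And>c d. (c, d) \<in> P \<Longrightarrow> packing c d (Q (c, d))"
  shows "packing a b (\<Union>z\<in>P. Q z)"
    and "sum g (\<Union>z\<in>P. Q z) = (\<Sum>z\<in>P. sum g (Q z))"
proof -
  have *: "c \<le> p \<and> p < q \<and> q \<le> d" if "(c, d) \<in> P" "(p, q) \<in> Q (c, d)" for c d p q
    using packingD(2)[OF Q[OF that(1)] that(2)] .
  show "packing a b (\<Union>z\<in>P. Q z)"
  proof (rule packingI)
    show "finite (\<Union>z\<in>P. Q z)" using packingD(1)[OF P] packingD(1)[OF Q] by auto
    fix p q assume "(p, q) \<in> (\<Union>z\<in>P. Q z)"
    then obtain c d where 1: "(c, d) \<in> P" "(p, q) \<in> Q (c, d)" by auto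
    show "a \<le> p \<and> p < q \<and> q \<le> b" using *[OF 1] packingD(2)[OF P 1(1)] by auto
  next
    fix p q p' q' assume h: "(p, q) \<in> (\<Union>z\<in>P. Q z)" "(p', q') \<in> (\<Union>z\<in>P. Q z)" "(p, q) \<noteq> (p', q')"
    from h(1) obtain c d where 1: "(c, d) \<in> P" "(p, q) \<in> Q (c, d)" by auto
    from h(2) obtain c' d' where 2: "(c', d') \<in> P" "(p', q') \<in> Q (c', d')" by auto
    show "q \<le> p' \<or> q' \<le> p"
    proof (cases "(c, d) = (c', d')")
      case True
      then show ?thesis using packingD(3)[OF Q[OF 1(1)] 1(2), of p' q'] 2 h(3) by auto
    next
      case False
      then show ?thesis using packingD(3)[OF P 1(1) 2(1)] *[OF 1] *[OF 2] by auto
    qed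
  qed
  have "Q z \<inter> Q z' = {}" if h: "z \<in> P" "z' \<in> P" "z \<noteq> z'" for z z'
  proof -
    obtain c d c' d' where e: "z = (c, d)" "z' = (c', d')" by fastforce
    have "d \<le> c' \<or> d' \<le> c" using packingD(3)[OF P, of c d c' d'] h e by auto
    then show ?thesis using *[of c d] *[of c' d'] h e by fastforce
  qed
  then show "sum g (\<Union>z\<in>P. Q z) = (\<Sum>z\<in>P. sum g (Q z))"
    using packingD(1)[OF P] packingD(1)[OF Q] by (intro sum.UNION_disjoint) auto
qed

section \<open>Variation of an absolutely continuous function\<close>

lemma packing_total_length_le:
  assumes "packing a b P" "a \<le> b"
  shows "total_length P \<le> b - a"
  using packing_telescope[OF assms, of "\<lambda>t. t"] by simp

lemma packing_empty: "packing a b {}"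
  unfolding packing_def by simp

definition variation :: "(real \<Rightarrow> 'b::real_normed_vector) \<Rightarrow> real \<Rightarrow> real \<Rightarrow> real" where
  "variation f a t = Sup {total_increment f P | P. packing a t P}"

text \<open>
  Over an interval of length below the \<open>\<delta>\<close> that belongs to \<open>\<epsilon> = 1\<close> all increment sums are less than
  \<open>1\<close>; finitely many such intervals cover \<open>[a, t]\<close>.
\<close>

lemma abs_continuous_on_bounded_variation:
  assumes f: "abs_continuous_on a b f" and "a \<le> t" "t \<le> b"
  shows "bdd_above {total_increment f P | P. packing a t P}"
proof -
  from abs_continuous_onD[OF f zero_less_one] obtain \<delta> where \<delta>: "\<delta> > 0"
    "\<And>P. packing a b P \<Longrightarrow> total_length P < \<delta> \<Longrightarrow> total_increment f P < 1" by blast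
  have main: "total_increment f P \<le> real k" if "a \<le> t" "t \<le> b" "t \<le> a + real k * (\<delta> / 2)" "packing a t P" for k t P
    using that
  proof (induction k arbitrary: t P)
    case 0
    have "P = {}"
    proof (rule ccontr)
      assume "P \<noteq> {}"
      then obtain c d where "(c, d) \<in> P" by fastforce
      then show False using packingD(2)[OF 0(4)] 0(1-3) by fastforce
    qed
    then show ?case by simp
  next
    case (Suc k)
    define c where "c = max a (t - \<delta> / 2)"
    have c: "a \<le> c" "c \<le> t" "t - c \<le> \<delta> / 2" "c \<le> a + real k * (\<delta> / 2)"
    proof -
      have "real (Suc k) * (\<delta> / 2) = real k * (\<delta> / 2) + \<delta> / 2" "0 \<le> real k * (\<delta> / 2)"
        using \<delta>(1) by (simp_all add: algebra_simps)
      then show "a \<le> c" "c \<le> t" "t - c \<le> \<delta> / 2" "c \<le> a + real k * (\<delta> / 2)"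
        using Suc.prems \<delta>(1) unfolding c_def by linarith+
    qed
    from packing_split[OF Suc.prems(4) c(1,2)] obtain Q R where QR: "packing a c Q" "packing c t R"
      "total_increment f P \<le> total_increment f Q + total_increment f R" by blast
    have "total_increment f Q \<le> real k"
      using Suc.IH[of c Q] c QR(1) Suc.prems by linarith
    moreover have "total_increment f R < 1"
    proof (rule \<delta>(2))
      show "packing a b R" using packing_mono[OF QR(2)] c Suc.prems by auto
      show "total_length R < \<delta>" using packing_total_length_le[OF QR(2) c(2)] c \<delta>(1) by linarith
    qed
    ultimately show ?case using QR(3) by simp
  qed
  obtain k :: nat where k: "real k > (t - a) / (\<delta> / 2)" using reals_Archimedean2 by blast
  then have "t \<le> a + real k * (\<delta> / 2)" using \<delta>(1) by (simp add: field_simps)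
  then show ?thesis using main[OF assms(2,3)] unfolding bdd_above_def by blast
qed

context
  fixes f :: "real \<Rightarrow> 'b::real_normed_vector" and a b :: real
  assumes f: "abs_continuous_on a b f"
begin

lemma variation_upper:
  assumes "a \<le> t" "t \<le> b" "packing a t P"
  shows "total_increment f P \<le> variation f a t"
  unfolding variation_def
  using abs_continuous_on_bounded_variation[OF f assms(1,2)] assms(3) by (intro cSup_upper) auto

text \<open>
  Appending \<open>(c, d)\<close> to a packing of \<open>[a, c]\<close> gives a packing of \<open>[a, d]\<close>. Consequently both the
  variation and its difference with a real-valued \<open>f\<close> are nondecreasing.
\<close>

lemma increment_le_variation_diff:
  assumes "a \<le> c" "c \<le> d" "d \<le> b"
  shows "norm (f d - f c) \<le> variation f a d - variation f a c"
proof (cases "c = d")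
  case True
  then show ?thesis by simp
next
  case False
  then have "c < d" using assms by simp
  have "variation f a c \<le> variation f a d - norm (f d - f c)"
    unfolding variation_def[of f a c]
  proof (rule cSup_least)
    show "{total_increment f P |P. packing a c P} \<noteq> {}" using packing_empty by blast
    fix x assume "x \<in> {total_increment f P |P. packing a c P}"
    then obtain P where x: "x = total_increment f P" and P: "packing a c P" by auto
    have notin: "(c, d) \<notin> P" using packingD(2)[OF P] \<open>c < d\<close> by force
    have "packing a d (insert (c, d) P)"
    proof (rule packingI)
      show "finite (insert (c, d) P)" using packingD(1)[OF P] by simp
      fix p q assume "(p, q) \<in> insert (c, d) P"
      then show "a \<le> p \<and> p < q \<and> q \<le> d" using packingD(2)[OF P, of p q] \<open>c < d\<close> assms by auto
    next
      fix p q p' q' assume "(p, q) \<in> insert (c, d) P" "(p', q') \<in> insert (c, d) P" "(p, q) \<noteq> (p', q')"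
      then show "q \<le> p' \<or> q' \<le> p"
        using packingD(2)[OF P, of p q] packingD(2)[OF P, of p' q'] packingD(3)[OF P, of p q p' q'] by auto
    qed
    from variation_upper[OF _ assms(3) this] have "total_increment f (insert (c, d) P) \<le> variation f a d"
      using assms by simp
    then show "x \<le> variation f a d - norm (f d - f c)"
      using packingD(1)[OF P] notin by (simp add: x)
  qed
  then show ?thesis by simp
qed

text \<open>
  Conversely, a packing of \<open>[a, d]\<close> can be cut at \<open>c\<close>.
\<close>

lemma variation_diff_le:
  assumes "a \<le> c" "c \<le> d" "d \<le> b" and R: "\<And>R. packing c d R \<Longrightarrow> total_increment f R \<le> e"
  shows "variation f a d - variation f a c \<le> e"
proof -
  have "variation f a d \<le> variation f a c + e"
    unfolding variation_def[of f a d]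
  proof (rule cSup_least)
    show "{total_increment f P |P. packing a d P} \<noteq> {}" using packing_empty by blast
    fix x assume "x \<in> {total_increment f P |P. packing a d P}"
    then obtain P where x: "x = total_increment f P" and P: "packing a d P" by auto
    from packing_split[OF P assms(1,2)] obtain Q R where QR: "packing a c Q" "packing c d R"
      "total_increment f P \<le> total_increment f Q + total_increment f R" by blast
    then show "x \<le> variation f a c + e"
      using R[OF QR(2)] variation_upper[OF assms(1) _ QR(1)] assms x by linarith
  qed
  then show ?thesis by simp
qed

lemma variation_mono:
  assumes "a \<le> c" "c \<le> d" "d \<le> b"
  shows "variation f a c \<le> variation f a d"
  using increment_le_variation_diff[OF assms] norm_ge_zero[of "f d - f c"] by linarith

lemma abs_continuous_on_variation: "abs_continuous_on a b (variation f a)"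
  unfolding abs_continuous_on_iff
proof (intro allI impI)
  fix \<epsilon> :: real assume e: "\<epsilon> > 0"
  then have "\<epsilon> / 2 > 0" by simp
  from abs_continuous_onD[OF f this] obtain \<delta> where \<delta>: "\<delta> > 0"
    "\<And>P. packing a b P \<Longrightarrow> total_length P < \<delta> \<Longrightarrow> total_increment f P < \<epsilon> / 2" by blast
  have "total_increment (variation f a) P < \<epsilon>" if P: "packing a b P" "total_length P < \<delta>" for P
  proof -
    \<comment> \<open>The error \<open>\<eta>\<close> in the choice of nearly optimal packings is made once for each member of \<open>P\<close>.\<close>
    define \<eta> where "\<eta> = \<epsilon> / (2 * (real (card P) + 1))"
    have \<eta>: "\<eta> > 0" using e by (simp add: \<eta>_def)
    have "\<exists>R. \<forall>c d. z = (c, d) \<longrightarrow> packing c d R \<and> variation f a d - variation f a c < total_increment f R + \<eta>"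
      if z: "z \<in> P" for z
    proof -
      obtain c d where e: "z = (c, d)" by fastforce
      have cd: "a \<le> c" "c \<le> d" "d \<le> b" using packingD(2)[OF P(1), of c d] z e by auto
      show ?thesis
      proof (rule ccontr)
        assume "\<not> ?thesis"
        then have "\<And>R. packing c d R \<Longrightarrow> total_increment f R \<le> variation f a d - variation f a c - \<eta>"
          using e by force
        from variation_diff_le[OF cd this] show False using \<eta> by simp
      qed
    qed
    then obtain Q where Q: "\<And>c d. (c, d) \<in> P \<Longrightarrow> packing c d (Q (c, d))"
      "\<And>c d. (c, d) \<in> P \<Longrightarrow> variation f a d - variation f a c < total_increment f (Q (c, d)) + \<eta>"
      by metis
    note U = packing_union[OF P(1) Q(1)]
    have "total_length (\<Union>z\<in>P. Q z) = (\<Sum>z\<in>P. total_length (Q z))" by (rule U(2))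
    also have "\<dots> \<le> total_length P"
    proof (rule sum_mono, clarify)
      fix c d assume "(c, d) \<in> P"
      then show "total_length (Q (c, d)) \<le> d - c"
        using packing_total_length_le[OF Q(1)] packingD(2)[OF P(1)] by force
    qed
    finally have "total_increment f (\<Union>z\<in>P. Q z) < \<epsilon> / 2" using \<delta>(2)[OF U(1)] P(2) by linarith
    then have half: "(\<Sum>z\<in>P. total_increment f (Q z)) < \<epsilon> / 2" by (simp add: U(2))
    have "total_increment (variation f a) P \<le> (\<Sum>z\<in>P. total_increment f (Q z) + \<eta>)"
    proof (rule sum_mono, clarify)
      fix c d assume cd: "(c, d) \<in> P"
      have "variation f a c \<le> variation f a d"
        using packingD(2)[OF P(1) cd] by (intro variation_mono) auto
      then show "norm (variation f a d - variation f a c) \<le> total_increment f (Q (c, d)) + \<eta>"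
        using Q(2)[OF cd] by simp
    qed
    also have "\<dots> = (\<Sum>z\<in>P. total_increment f (Q z)) + real (card P) * \<eta>" by (simp add: sum.distrib)
    also have "real (card P) * \<eta> \<le> \<epsilon> / 2"
    proof -
      have "real (card P) * \<eta> = \<epsilon> / 2 * (real (card P) / (real (card P) + 1))" by (simp add: \<eta>_def)
      also have "\<dots> \<le> \<epsilon> / 2 * 1" using e by (intro mult_left_mono) auto
      finally show ?thesis by simp
    qed
    finally show ?thesis using half by simp
  qed
  then show "\<exists>\<delta>>0. \<forall>P. packing a b P \<and> total_length P < \<delta> \<longrightarrow> total_increment (variation f a) P < \<epsilon>"
    using \<delta>(1) by blast
qed

end

section \<open>Absolutely continuous functions as primitives\<close>

text \<open>
  The Stieltjes measure of a nondecreasing absolutely continuous function has no singular part: a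
  Lebesgue null set has an open neighbourhood of measure below \<open>\<delta>\<close>, which is exhausted by finite
  unions of compact intervals, and such a union can be subdivided into a packing.
\<close>

lemma interval_measure_abs_continuous:
  fixes W :: "real \<Rightarrow> real"
  assumes W: "abs_continuous_on a b W" and ab: "a \<le> b"
    and mono: "\<And>s t. a \<le> s \<Longrightarrow> s \<le> t \<Longrightarrow> t \<le> b \<Longrightarrow> W s \<le> W t"
  defines "F \<equiv> \<lambda>t. W (max a (min b t))"
  shows "absolutely_continuous lborel (interval_measure F)"
    and "\<And>c d. c \<le> d \<Longrightarrow> emeasure (interval_measure F) {c..d} = ennreal (F d - F c)"
proof -
  let ?cl = "\<lambda>t. max a (min b t)"
  let ?\<mu> = "interval_measure F"
  have cl: "a \<le> ?cl t" "?cl t \<le> b" for t using ab by auto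
  have clm: "?cl s \<le> ?cl t" if "s \<le> t" for s t using that by auto
  have Fmono: "F s \<le> F t" if "s \<le> t" for s t
    unfolding F_def by (rule mono) (use cl clm that in auto)
  have Fcont: "continuous_on UNIV F"
    unfolding F_def
    by (rule continuous_on_compose2[OF abs_continuous_on_imp_continuous_on[OF W]])
       (use ab in \<open>auto intro!: continuous_intros\<close>)
  show Icc: "emeasure ?\<mu> {c..d} = ennreal (F d - F c)" if "c \<le> d" for c d
    using emeasure_interval_measure_Icc[OF that Fmono Fcont] by simp
  show "absolutely_continuous lborel ?\<mu>"
    unfolding absolutely_continuous_def
  proof
    fix N assume N: "N \<in> null_sets (lborel :: real measure)"
    then have Nl: "N \<in> null_sets lebesgue" by (simp add: null_sets_completionI)
    have small: "emeasure ?\<mu> N \<le> ennreal e" if e: "e > 0" for e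
    proof -
      from abs_continuous_onD[OF W e] obtain \<delta> where \<delta>: "\<delta> > 0"
        "\<And>P. packing a b P \<Longrightarrow> total_length P < \<delta> \<Longrightarrow> total_increment W P < e" by blast
      obtain T where T: "open T" "N \<subseteq> T" "T - N \<in> lmeasurable" "emeasure lebesgue (T - N) < ennreal \<delta>"
        using sets_lebesgue_outer_open[of N \<delta>] Nl \<delta>(1) by (metis null_setsD2)
      have Tm: "emeasure lebesgue T < ennreal \<delta>"
        using emeasure_Diff_null_set[OF Nl, of T] T by auto
      obtain D where D: "countable D" "D \<subseteq> Pow T" "\<And>X. X \<in> D \<Longrightarrow> \<exists>l u. X = cbox l u" "\<Union>D = T"
        using open_countable_Union_open_cbox[OF T(1)] by metis
      \<comment> \<open>Finite unions of intervals are subdivided; degenerate pieces carry no mass and are dropped.\<close>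
      have fin: "emeasure ?\<mu> (\<Union>G) \<le> ennreal e" if G: "finite G" "G \<subseteq> D" for G
      proof -
        obtain p where p: "p division_of \<Union>G"
          using elementary_unions_intervals[OF G(1)] D(3) G(2) by blast
        have pk: "finite p" "\<Union>p = \<Union>G" using division_ofD[OF p] by auto
        have k: "k = {Inf k..Sup k} \<and> Inf k \<le> Sup k" if kp: "k \<in> p" for k
        proof -
          obtain l u where "k = cbox l u" "k \<noteq> {}" using division_ofD[OF p] kp by blast
          then show ?thesis by (auto simp: cbox_interval)
        qed
        define p' where "p' = {k \<in> p. Inf k < Sup k}"
        define P where "P = (\<lambda>k. (Inf k, Sup k)) ` p'"
        have inj: "inj_on (\<lambda>k. (Inf k, Sup k)) p'"
        proof (rule inj_onI)
          fix k1 k2 assume h: "k1 \<in> p'" "k2 \<in> p'" "(Inf k1, Sup k1) = (Inf k2, Sup k2)"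
          have "k1 = {Inf k1..Sup k1}" using k h(1) unfolding p'_def by blast
          also have "\<dots> = {Inf k2..Sup k2}" using h(3) by simp
          also have "\<dots> = k2" using k h(2) unfolding p'_def by blast
          finally show "k1 = k2" .
        qed
        define l u where "l = Min (fst ` P)" and "u = Max (snd ` P)"
        have finP: "finite P" using pk unfolding P_def p'_def by auto
        have pack: "packing l u P"
        proof (rule packingI)
          show "finite P" by fact
          fix c d assume cd: "(c, d) \<in> P"
          then have "c < d" unfolding P_def p'_def by auto
          moreover have "l \<le> c" unfolding l_def using finP cd by (metis Min_le finite_imageI fst_conv image_eqI)
          moreover have "d \<le> u" unfolding u_def using finP cd by (metis Max_ge finite_imageI snd_conv image_eqI)
          ultimately show "l \<le> c \<and> c < d \<and> d \<le> u" by simp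
        next
          fix c d c' d' assume h: "(c, d) \<in> P" "(c', d') \<in> P" "(c, d) \<noteq> (c', d')"
          obtain k1 where k1: "k1 \<in> p" "c = Inf k1" "d = Sup k1" "c < d" using h(1) unfolding P_def p'_def by auto
          obtain k2 where k2: "k2 \<in> p" "c' = Inf k2" "d' = Sup k2" "c' < d'" using h(2) unfolding P_def p'_def by auto
          have "k1 \<noteq> k2" using h k1 k2 by auto
          then have "interior k1 \<inter> interior k2 = {}" using division_ofD(5)[OF p k1(1) k2(1)] by simp
          moreover have "k1 = {c..d}" "k2 = {c'..d'}" using k[OF k1(1)] k[OF k2(1)] k1 k2 by auto
          ultimately have "{c<..<d} \<inter> {c'<..<d'} = {}" by simp
          moreover have "{c<..<d} \<inter> {c'<..<d'} = {max c c'<..<min d d'}" by auto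
          ultimately show "d \<le> c' \<or> d' \<le> c" using k1(4) k2(4) by auto
        qed
        \<comment> \<open>Retracting to \<open>[a, b]\<close> shortens the intervals and leaves the increments of \<open>F\<close> unchanged.\<close>
        define Q where "Q = (\<lambda>(c, d). (?cl c, ?cl d)) ` {z \<in> P. ?cl (fst z) < ?cl (snd z)}"
        have Q1: "packing a b Q" unfolding Q_def by (rule packing_image[OF pack]) (use cl clm in auto)
        have Q2: "(\<Sum>(c, d)\<in>Q. g c d) = (\<Sum>(c, d)\<in>P. g (?cl c) (?cl d))" if "\<And>c. g c c = 0" for g :: "real \<Rightarrow> real \<Rightarrow> real"
          unfolding Q_def by (rule packing_image(2)[OF pack, of ?cl a b g]) (use cl clm that in auto)
        have content: "emeasure lebesgue k = ennreal (Sup k - Inf k)" if "k \<in> p" for k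
        proof -
          have "emeasure lebesgue k = emeasure lebesgue {Inf k..Sup k}" by (rule arg_cong[OF conjunct1[OF k[OF that]]])
          also have "\<dots> = ennreal (Sup k - Inf k)" using conjunct2[OF k[OF that]] by simp
          finally show ?thesis .
        qed
        have kle: "Inf k \<le> Sup k" if "k \<in> p" for k using k[OF that] by (rule conjunct2)
        have kb: "k \<in> sets borel" if "k \<in> p" for k
          by (subst conjunct1[OF k[OF that]]) simp
        have k\<mu>: "emeasure ?\<mu> k = ennreal (F (Sup k) - F (Inf k))" if "k \<in> p" for k
          using arg_cong[OF conjunct1[OF k[OF that]], of "emeasure ?\<mu>"] Icc[OF kle[OF that]] by simp
        have "total_length Q = (\<Sum>(c, d)\<in>P. ?cl d - ?cl c)" by (rule Q2) simp
        also have "\<dots> \<le> total_length P"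
        proof (rule sum_mono, clarify)
          fix c d assume "(c, d) \<in> P"
          then have "c < d" using packingD(2)[OF pack] by auto
          then show "?cl d - ?cl c \<le> d - c" by auto
        qed
        also have "\<dots> = (\<Sum>k\<in>p'. Sup k - Inf k)" unfolding P_def by (subst sum.reindex[OF inj]) simp
        also have "\<dots> = (\<Sum>k\<in>p'. measure lebesgue k)"
          using content kle by (intro sum.cong) (auto simp: p'_def measure_def)
        also have "\<dots> \<le> (\<Sum>k\<in>p. measure lebesgue k)" using pk by (intro sum_mono2) (auto simp: p'_def)
        also have "\<dots> = measure lebesgue (\<Union>G)" using content_division[OF p] .
        also have "\<dots> < \<delta>"
        proof -
          have "emeasure lebesgue (\<Union>G) \<le> emeasure lebesgue T"
            using G D(4) T(1) by (intro emeasure_mono) auto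
          then have "emeasure lebesgue (\<Union>G) < ennreal \<delta>" using Tm by order
          then show ?thesis using \<delta>(1) unfolding measure_def
            by (cases "emeasure lebesgue (\<Union>G)" rule: ennreal_cases) (auto simp: ennreal_less_iff)
        qed
        finally have "total_increment W Q < e" using \<delta>(2)[OF Q1] by blast
        moreover have "total_increment W Q = (\<Sum>(c, d)\<in>P. norm (F d - F c))"
          unfolding F_def by (rule Q2) simp
        ultimately have less: "(\<Sum>(c, d)\<in>P. norm (F d - F c)) < e" by simp
        have "emeasure ?\<mu> (\<Union>G) = emeasure ?\<mu> (\<Union>k\<in>p. k)" using pk by simp
        also have "\<dots> \<le> (\<Sum>k\<in>p. emeasure ?\<mu> k)"
          by (rule emeasure_subadditive_finite[OF pk(1)]) (use kb in auto)
        also have "\<dots> = (\<Sum>k\<in>p. ennreal (F (Sup k) - F (Inf k)))"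
          using k\<mu> by (intro sum.cong) auto
        also have "\<dots> = (\<Sum>k\<in>p'. ennreal (F (Sup k) - F (Inf k)))"
        proof (rule sum.mono_neutral_right[OF pk(1)])
          show "\<forall>k\<in>p - p'. ennreal (F (Sup k) - F (Inf k)) = 0"
          proof
            fix k assume "k \<in> p - p'"
            then have "Inf k = Sup k" using kle[of k] unfolding p'_def by auto
            then show "ennreal (F (Sup k) - F (Inf k)) = 0" by simp
          qed
        qed (auto simp: p'_def)
        also have "\<dots> = (\<Sum>k\<in>p'. ennreal (norm (F (Sup k) - F (Inf k))))"
          using Fmono by (intro sum.cong) (auto simp: p'_def)
        also have "\<dots> = ennreal (\<Sum>k\<in>p'. norm (F (Sup k) - F (Inf k)))" by simp
        also have "(\<Sum>k\<in>p'. norm (F (Sup k) - F (Inf k))) = (\<Sum>(c, d)\<in>P. norm (F d - F c))"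
          unfolding P_def by (subst sum.reindex[OF inj]) simp
        finally show ?thesis using less by (meson ennreal_leI less_imp_le order_trans)
      qed
      have "emeasure ?\<mu> T \<le> ennreal e"
      proof (cases "D = {}")
        case True
        then show ?thesis using D(4) by auto
      next
        case False
        define K where "K n = \<Union>(from_nat_into D ` {..<n})" for n :: nat
        have fD: "from_nat_into D i \<in> D" for i using False by (rule from_nat_into)
        have "(\<Union>n. K n) = T"
        proof -
          have "(\<Union>n. K n) = (\<Union>i. from_nat_into D i)" unfolding K_def by (auto intro: lessI)
          also have "\<dots> = \<Union>D" using range_from_nat_into[OF False D(1)] by simp
          finally show ?thesis using D(4) by simp
        qed
        moreover have "(SUP n. emeasure ?\<mu> (K n)) = emeasure ?\<mu> (\<Union>n. K n)"
        proof (rule SUP_emeasure_incseq)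
          show "range K \<subseteq> sets ?\<mu>"
          proof -
            have "from_nat_into D i \<in> sets borel" for i
            proof -
              obtain l u where "from_nat_into D i = cbox l u" using D(3)[OF fD] by blast
              then show ?thesis by (simp only:) (rule borel_closed[OF closed_cbox])
            qed
            then show ?thesis unfolding K_def by (auto intro!: sets.finite_UN)
          qed
          show "incseq K" unfolding incseq_def K_def by fastforce
        qed
        moreover have "emeasure ?\<mu> (K n) \<le> ennreal e" for n
          unfolding K_def by (rule fin) (use fD in auto)
        ultimately show ?thesis using SUP_least[of UNIV "\<lambda>n. emeasure ?\<mu> (K n)" "ennreal e"] by simp
      qed
      moreover have "emeasure ?\<mu> N \<le> emeasure ?\<mu> T" using T by (intro emeasure_mono) auto
      ultimately show ?thesis by order
    qed
    have "emeasure ?\<mu> N \<le> 0" by (rule ennreal_le_epsilon) (use small in simp)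
    then have "emeasure ?\<mu> N = 0" by simp
    then show "N \<in> null_sets ?\<mu>" using N by (auto simp: null_sets_def)
  qed
qed

lemma abs_continuous_on_mono_density:
  fixes W :: "real \<Rightarrow> real"
  assumes W: "abs_continuous_on a b W" and ab: "a \<le> b"
    and mono: "\<And>s t. a \<le> s \<Longrightarrow> s \<le> t \<Longrightarrow> t \<le> b \<Longrightarrow> W s \<le> W t"
  obtains g :: "real \<Rightarrow> real" where "integrable lborel g"
    "\<And>c d. a \<le> c \<Longrightarrow> c \<le> d \<Longrightarrow> d \<le> b \<Longrightarrow> W d - W c = (LINT t:{c..d}|lborel. g t)"
proof -
  define F where "F = (\<lambda>t. W (max a (min b t)))"
  let ?\<mu> = "interval_measure F"
  have ac: "absolutely_continuous lborel ?\<mu>"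
    and Icc: "\<And>c d. c \<le> d \<Longrightarrow> emeasure ?\<mu> {c..d} = ennreal (F d - F c)"
    using interval_measure_abs_continuous[OF W ab mono] unfolding F_def by blast+
  obtain f where f[measurable]: "f \<in> borel_measurable lborel" and dens: "density lborel f = ?\<mu>"
    using sigma_finite_measure.Radon_Nikodym[OF sigma_finite_lborel ac] by auto
  define g where "g t = indicator {a..b} t * enn2real (f t)" for t
  have gm[measurable]: "g \<in> borel_measurable lborel" unfolding g_def by measurable
  have I: "(\<integral>\<^sup>+t. f t * indicator {c..d} t \<partial>lborel) = ennreal (W d - W c)" if "a \<le> c" "c \<le> d" "d \<le> b" for c d
  proof -
    have "(\<integral>\<^sup>+t. f t * indicator {c..d} t \<partial>lborel) = emeasure ?\<mu> {c..d}"
      unfolding dens[symmetric] by (subst emeasure_density) auto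
    then show ?thesis using Icc[OF that(2)] that by (simp add: F_def)
  qed
  have "(\<integral>\<^sup>+t. f t * indicator {a..b} t \<partial>lborel) \<noteq> \<infinity>" using I[of a b] ab by simp
  then have fin: "AE t in lborel. f t * indicator {a..b} t \<noteq> \<infinity>"
    by (intro nn_integral_PInf_AE) auto
  have gI: "(\<integral>\<^sup>+t. ennreal (indicator {c..d} t * g t) \<partial>lborel) = ennreal (W d - W c)" if "a \<le> c" "c \<le> d" "d \<le> b" for c d
    unfolding I[OF that, symmetric]
  proof (rule nn_integral_cong_AE)
    show "AE t in lborel. ennreal (indicator {c..d} t * g t) = f t * indicator {c..d} t"
      using fin by eventually_elim
        (use that in \<open>auto simp: g_def indicator_def less_top split: if_splits\<close>)
  qed
  have g0: "g t \<ge> 0" for t by (simp add: g_def)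
  have gab: "indicator {a..b} t * g t = g t" for t by (simp add: g_def indicator_def)
  have int: "integrable lborel g"
  proof (rule integrableI_nonneg)
    show "(\<integral>\<^sup>+t. ennreal (g t) \<partial>lborel) < \<infinity>"
      using gI[of a b] ab by (simp add: gab)
  qed (use g0 in auto)
  show thesis
  proof (rule that[OF int])
    fix c d assume cd: "a \<le> c" "c \<le> d" "d \<le> b"
    have "(LINT t:{c..d}|lborel. g t) = enn2real (\<integral>\<^sup>+t. ennreal (indicator {c..d} t * g t) \<partial>lborel)"
      unfolding set_lebesgue_integral_def real_scaleR_def
      by (rule integral_eq_nn_integral) (use g0 in auto)
    also have "\<dots> = W d - W c" unfolding gI[OF cd] using mono[OF cd] by simp
    finally show "W d - W c = (LINT t:{c..d}|lborel. g t)" by simp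
  qed
qed

lemma set_integrable_lborel_Icc:
  fixes g :: "real \<Rightarrow> 'b::euclidean_space"
  assumes "integrable lborel g"
  shows "set_integrable lborel {c..d} g"
  unfolding set_integrable_def using assms by (intro integrable_mult_indicator) auto

text \<open>
  Jordan decomposition: \<open>f = V - (V - f)\<close> with \<open>V\<close> the variation, and both terms are nondecreasing and
  absolutely continuous.
\<close>

lemma abs_continuous_on_density_real:
  fixes f :: "real \<Rightarrow> real"
  assumes f: "abs_continuous_on a b f" and ab: "a \<le> b"
  obtains g :: "real \<Rightarrow> real" where "integrable lborel g"
    "\<And>c d. a \<le> c \<Longrightarrow> c \<le> d \<Longrightarrow> d \<le> b \<Longrightarrow> f d - f c = (LINT t:{c..d}|lborel. g t)"
proof -
  let ?V = "variation f a"
  have V: "abs_continuous_on a b ?V" by (rule abs_continuous_on_variation[OF f])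
  obtain g1 :: "real \<Rightarrow> real" where g1: "integrable lborel g1"
    "\<And>c d. a \<le> c \<Longrightarrow> c \<le> d \<Longrightarrow> d \<le> b \<Longrightarrow> ?V d - ?V c = (LINT t:{c..d}|lborel. g1 t)"
    by (rule abs_continuous_on_mono_density[OF V ab variation_mono[OF f]]) auto
  have mono2: "?V s - f s \<le> ?V t - f t" if "a \<le> s" "s \<le> t" "t \<le> b" for s t
    using increment_le_variation_diff[OF f that] by simp
  obtain g2 :: "real \<Rightarrow> real" where g2: "integrable lborel g2"
    "\<And>c d. a \<le> c \<Longrightarrow> c \<le> d \<Longrightarrow> d \<le> b \<Longrightarrow> (?V d - f d) - (?V c - f c) = (LINT t:{c..d}|lborel. g2 t)"
    by (rule abs_continuous_on_mono_density[OF abs_continuous_on_diff[OF V f] ab mono2]) auto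
  show thesis
  proof (rule that)
    show "integrable lborel (\<lambda>t. g1 t - g2 t)" using g1 g2 by simp
    fix c d assume cd: "a \<le> c" "c \<le> d" "d \<le> b"
    have "(LINT t:{c..d}|lborel. g1 t - g2 t) = (LINT t:{c..d}|lborel. g1 t) - (LINT t:{c..d}|lborel. g2 t)"
      by (rule set_integral_diff(2)) (rule set_integrable_lborel_Icc[OF g1(1)] set_integrable_lborel_Icc[OF g2(1)])+
    then show "f d - f c = (LINT t:{c..d}|lborel. g1 t - g2 t)"
      using g1(2)[OF cd] g2(2)[OF cd] by simp
  qed
qed

lemma abs_continuous_on_density:
  fixes f :: "real \<Rightarrow> 'b::euclidean_space"
  assumes f: "abs_continuous_on a b f" and ab: "a \<le> b"
  obtains g :: "real \<Rightarrow> 'b" where "integrable lborel g"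
    "\<And>c d. a \<le> c \<Longrightarrow> c \<le> d \<Longrightarrow> d \<le> b \<Longrightarrow> f d - f c = (LINT t:{c..d}|lborel. g t)"
proof -
  have "\<exists>g :: real \<Rightarrow> real. integrable lborel g \<and>
      (\<forall>c d. a \<le> c \<and> c \<le> d \<and> d \<le> b \<longrightarrow> f d \<bullet> i - f c \<bullet> i = (LINT t:{c..d}|lborel. g t))"
    if i: "i \<in> Basis" for i
  proof -
    have "abs_continuous_on a b (\<lambda>t. f t \<bullet> i)"
      by (rule abs_continuous_on_dominated[OF f])
         (use i in \<open>simp add: inner_diff_left[symmetric] Basis_le_norm\<close>)
    from abs_continuous_on_density_real[OF this ab] show ?thesis by (metis (no_types, lifting))
  qed
  then obtain G :: "'b \<Rightarrow> real \<Rightarrow> real" where G: "\<And>i. i \<in> Basis \<Longrightarrow> integrable lborel (G i)"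
    "\<And>i c d. i \<in> Basis \<Longrightarrow> a \<le> c \<Longrightarrow> c \<le> d \<Longrightarrow> d \<le> b \<Longrightarrow> f d \<bullet> i - f c \<bullet> i = (LINT t:{c..d}|lborel. G i t)"
    by metis
  define g where "g t = (\<Sum>i\<in>Basis. G i t *\<^sub>R i)" for t
  have int: "integrable lborel g" unfolding g_def
    using G(1) by (intro Bochner_Integration.integrable_sum integrable_scaleR_left) auto
  show thesis
  proof (rule that[OF int])
    fix c d assume cd: "a \<le> c" "c \<le> d" "d \<le> b"
    show "f d - f c = (LINT t:{c..d}|lborel. g t)"
    proof (rule euclidean_eqI)
      fix i :: 'b assume i: "i \<in> Basis"
      have "(LINT t:{c..d}|lborel. g t) \<bullet> i = (LINT t|lborel. (indicator {c..d} t *\<^sub>R g t) \<bullet> i)"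
        unfolding set_lebesgue_integral_def
        using set_integrable_lborel_Icc[OF int, of c d] unfolding set_integrable_def
        by (simp only: integral_inner_left)
      also have "\<dots> = (LINT t:{c..d}|lborel. G i t)"
        unfolding set_lebesgue_integral_def
        by (rule arg_cong[where f = "integral\<^sup>L lborel"])
           (use i in \<open>auto simp: g_def inner_sum_left inner_Basis if_distrib sum.delta' cong: if_cong\<close>)
      finally show "(f d - f c) \<bullet> i = (LINT t:{c..d}|lborel. g t) \<bullet> i"
        using G(2)[OF i cd] by (simp add: inner_diff_left)
    qed
  qed
qed

text \<open>
  Lebesgue's differentiation theorem on the line. The fact \<open>integrable_ccontinuous_explicit\<close>
  treats averages over intervals to the right of a point; averages to the left are obtained by
  applying it to the reflected density.
\<close>

lemma AE_has_vector_derivative_integral: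
  fixes g :: "real \<Rightarrow> 'b::euclidean_space"
  assumes g: "integrable lborel g"
    and f: "\<And>c d. a \<le> c \<Longrightarrow> c \<le> d \<Longrightarrow> d \<le> b \<Longrightarrow> f d - f c = (LINT t:{c..d}|lborel. g t)"
  shows "AE t in lborel. a < t \<and> t < b \<longrightarrow> (f has_vector_derivative g t) (at t)"
proof -
  have right: "\<exists>N. negligible N \<and> (\<forall>x e. x \<notin> N \<longrightarrow> 0 < e \<longrightarrow>
      (\<exists>d>0. \<forall>h. 0 < h \<and> h < d \<longrightarrow> norm ((LINT t:{x..x+h}|lborel. k t) /\<^sub>R h - k x) < e))"
    if k: "integrable lborel k" for k :: "real \<Rightarrow> 'b"
  proof -
    have "k integrable_on cbox c d" for c d
      using set_borel_integral_eq_integral(1)[OF set_integrable_lborel_Icc[OF k]] by (simp add: cbox_interval)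
    from integrable_ccontinuous_explicit[OF this] obtain N where N: "negligible N"
      "\<And>x e. \<lbrakk>x \<notin> N; 0 < e\<rbrakk> \<Longrightarrow> \<exists>d>0. \<forall>h. 0 < h \<and> h < d \<longrightarrow>
         norm (integral (cbox x (x + h *\<^sub>R One)) k /\<^sub>R h ^ DIM(real) - k x) < e" by blast
    have "integral (cbox x (x + h *\<^sub>R One)) k /\<^sub>R h ^ DIM(real) = (LINT t:{x..x+h}|lborel. k t) /\<^sub>R h" for x h
      using set_borel_integral_eq_integral(2)[OF set_integrable_lborel_Icc[OF k, of x "x + h"]]
      by (simp add: cbox_interval)
    then show ?thesis using N by metis
  qed
  obtain N1 where N1: "negligible N1" "\<And>x e. x \<notin> N1 \<Longrightarrow> 0 < e \<Longrightarrow>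
      \<exists>d>0. \<forall>h. 0 < h \<and> h < d \<longrightarrow> norm ((LINT t:{x..x+h}|lborel. g t) /\<^sub>R h - g x) < e"
    using right[OF g] by blast
  have g': "integrable lborel (\<lambda>t. g (- t))"
    using lborel_integrable_real_affine[OF g, of "-1" 0] by simp
  obtain N2 where N2: "negligible N2" "\<And>x e. x \<notin> N2 \<Longrightarrow> 0 < e \<Longrightarrow>
      \<exists>d>0. \<forall>h. 0 < h \<and> h < d \<longrightarrow> norm ((LINT t:{x..x+h}|lborel. g (- t)) /\<^sub>R h - g (- x)) < e"
    using right[OF g'] by blast
  have refl: "(LINT t:{-x..-x+h}|lborel. g (- t)) = (LINT t:{x-h..x}|lborel. g t)" for x h
    unfolding set_lebesgue_integral_def
    by (subst lborel_integral_real_affine[of "-1" _ 0])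
       (auto intro!: Bochner_Integration.integral_cong simp: indicator_def)
  have neg: "negligible (uminus ` N2)"
    by (rule negligible_differentiable_image_negligible[OF _ N2(1)]) (auto intro!: derivative_intros simp: differentiable_on_def)
  have "AE t in lebesgue. t \<notin> N1 \<union> uminus ` N2"
    by (rule AE_not_in) (use N1(1) neg in \<open>simp add: negligible_iff_null_sets[symmetric] negligible_Un\<close>)
  then have "AE t in lborel. t \<notin> N1 \<union> uminus ` N2" by (simp only: AE_completion_iff)
  then show ?thesis
  proof eventually_elim
    case (elim t)
    then have t: "t \<notin> N1" "- t \<notin> N2" by force+
    show ?case
    proof
      assume ab: "a < t \<and> t < b"
      show "(f has_vector_derivative g t) (at t)"
        unfolding has_vector_derivative_def has_derivative_at_alt
      proof (intro conjI allI impI)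
        show "bounded_linear (\<lambda>x. x *\<^sub>R g t)" by (rule bounded_linear_scaleR_left)
        fix e :: real assume e: "0 < e"
        obtain d1 where d1: "d1 > 0" "\<And>h. 0 < h \<Longrightarrow> h < d1 \<Longrightarrow> norm ((LINT s:{t..t+h}|lborel. g s) /\<^sub>R h - g t) < e"
          using N1(2)[OF t(1) e] by blast
        obtain d2 where d2: "d2 > 0" "\<And>h. 0 < h \<Longrightarrow> h < d2 \<Longrightarrow> norm ((LINT s:{t-h..t}|lborel. g s) /\<^sub>R h - g t) < e"
          using N2(2)[OF t(2) e] unfolding refl minus_minus by blast
        have scale: "norm (v - h *\<^sub>R w) \<le> e * h" if "norm (v /\<^sub>R h - w) < e" "h > 0" for v w :: 'b and h
        proof -
          have "v - h *\<^sub>R w = h *\<^sub>R (v /\<^sub>R h - w)" using that by (simp add: scaleR_diff_right)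
          then have "norm (v - h *\<^sub>R w) = h * norm (v /\<^sub>R h - w)" using that by simp
          then show ?thesis using that by (simp add: mult.commute)
        qed
        define d where "d = Min {d1, d2, b - t, t - a}"
        have d: "d > 0" "d \<le> d1" "d \<le> d2" "d \<le> b - t" "d \<le> t - a" using d1 d2 ab by (auto simp: d_def)
        have "norm (f y - f t - (y - t) *\<^sub>R g t) \<le> e * norm (y - t)" if y: "norm (y - t) < d" for y
        proof -
          consider "y = t" | "t < y" | "y < t" by linarith
          then show ?thesis
          proof cases
            case 2
            have "f y - f t = (LINT s:{t..t+(y-t)}|lborel. g s)" using f[of t y] 2 ab y d by auto
            then show ?thesis using scale[OF d1(2)[of "y - t"]] 2 y d by auto
          next
            case 3
            have "f t - f y = (LINT s:{t-(t-y)..t}|lborel. g s)" using f[of y t] 3 ab y d by auto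
            then have "norm (f t - f y - (t - y) *\<^sub>R g t) \<le> e * (t - y)"
              using scale[OF d2(2)[of "t - y"]] 3 y d by auto
            moreover have "f y - f t - (y - t) *\<^sub>R g t = - (f t - f y - (t - y) *\<^sub>R g t)"
              by (simp add: algebra_simps)
            ultimately show ?thesis using 3 by (simp only: norm_minus_cancel) simp
          qed simp
        qed
        with d(1) show "\<exists>d>0. \<forall>y. norm (y - t) < d \<longrightarrow> norm (f y - f t - (y - t) *\<^sub>R g t) \<le> e * norm (y - t)"
          by blast
      qed
    qed
  qed
qed

text \<open>
  An absolutely continuous curve together with a globally integrable velocity. Carrying the velocity
  along makes the a.e. derivative, which is only determined up to null sets, an explicit object.
\<close>

definition primitive_on :: "real \<Rightarrow> real \<Rightarrow> (real \<Rightarrow> 'b::euclidean_space) \<Rightarrow> (real \<Rightarrow> 'b) \<Rightarrow> bool" where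
  "primitive_on a b f g \<longleftrightarrow> integrable lborel g \<and>
     (\<forall>c d. a \<le> c \<and> c \<le> d \<and> d \<le> b \<longrightarrow> f d - f c = (LINT t:{c..d}|lborel. g t))"

lemma primitive_onD:
  assumes "primitive_on a b f g"
  shows "integrable lborel g"
    "a \<le> c \<Longrightarrow> c \<le> d \<Longrightarrow> d \<le> b \<Longrightarrow> f d - f c = (LINT t:{c..d}|lborel. g t)"
  using assms unfolding primitive_on_def by blast+

lemma primitive_on_subinterval:
  "primitive_on a b f g \<Longrightarrow> a \<le> c \<Longrightarrow> d \<le> b \<Longrightarrow> primitive_on c d f g"
  unfolding primitive_on_def by auto

lemma primitive_on_cong:
  assumes "primitive_on a b f g" "\<And>t. a \<le> t \<Longrightarrow> t \<le> b \<Longrightarrow> f' t = f t"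
  shows "primitive_on a b f' g"
  using assms unfolding primitive_on_def by auto

lemma set_integral_lborel_combine:
  fixes g :: "real \<Rightarrow> 'b::euclidean_space"
  assumes g: "integrable lborel g" and "a \<le> c" "c \<le> b"
  shows "(LINT t:{a..b}|lborel. g t) = (LINT t:{a..c}|lborel. g t) + (LINT t:{c..b}|lborel. g t)"
proof -
  note eq = set_borel_integral_eq_integral[OF set_integrable_lborel_Icc[OF g]]
  show ?thesis unfolding eq(2)
    using Henstock_Kurzweil_Integration.integral_combine[OF assms(2,3) eq(1)] by simp
qed

text \<open>
  Split the density at a height \<open>n\<close>. The part where \<open>norm (g t) > n\<close> has total mass less than
  \<open>\<epsilon> / 2\<close> for large \<open>n\<close>; the rest contributes at most \<open>n\<close> times the length of a packing.
\<close>

lemma primitive_on_imp_abs_continuous_on: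
  fixes g :: "real \<Rightarrow> 'b::euclidean_space"
  assumes fg: "primitive_on a b f g" and ab: "a \<le> b"
  shows "abs_continuous_on a b f"
  unfolding abs_continuous_on_iff
proof (intro allI impI)
  fix \<epsilon> :: real assume e: "\<epsilon> > 0"
  note g = primitive_onD(1)[OF fg]
  have [measurable]: "g \<in> borel_measurable lborel" using g by simp
  define k where "k n t = indicator {t. norm (g t) > real n} t * norm (g t)" for n :: nat and t
  have k_le: "0 \<le> k n t" "k n t \<le> norm (g t)" for n t by (auto simp: k_def indicator_def)
  have km[measurable]: "k n \<in> borel_measurable lborel" for n unfolding k_def by measurable
  have kint: "integrable lborel (k n)" for n
    by (rule Bochner_Integration.integrable_bound[OF integrable_norm[OF g]]) (use k_le in auto)
  have "(\<lambda>n. LINT t|lborel. k n t) \<longlonglongrightarrow> (LINT t|(lborel :: real measure). 0)"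
  proof (rule integral_dominated_convergence[where w = "\<lambda>t. norm (g t)"])
    show "AE t in lborel. (\<lambda>n. k n t) \<longlonglongrightarrow> 0"
    proof (rule AE_I2)
      fix t
      obtain n0 where "norm (g t) \<le> real n0" using real_arch_simple by blast
      then have "\<forall>n\<ge>n0. k n t = 0" by (auto simp: k_def indicator_def)
      then show "(\<lambda>n. k n t) \<longlonglongrightarrow> 0" by (intro tendsto_eventually eventually_sequentiallyI) auto
    qed
  qed (use g k_le in auto)
  then have "eventually (\<lambda>n. (LINT t|lborel. k n t) < \<epsilon> / 2) sequentially"
    using e by (intro order_tendstoD(2)) auto
  then obtain n where n: "(LINT t|lborel. k n t) < \<epsilon> / 2" by (auto simp: eventually_sequentially)
  define \<delta> where "\<delta> = \<epsilon> / (2 * (real n + 1))"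
  have \<delta>: "\<delta> > 0" "real n * \<delta> \<le> \<epsilon> / 2" using e by (simp_all add: \<delta>_def field_simps)
  define \<Phi> where "\<Phi> t = (LINT s:{a..t}|lborel. k n s)" for t
  have \<Phi>: "\<Phi> d - \<Phi> c = (LINT s:{c..d}|lborel. k n s)" if "a \<le> c" "c \<le> d" for c d
    unfolding \<Phi>_def using set_integral_lborel_combine[OF kint that] by simp
  have cint: "set_integrable lborel {c..d} (\<lambda>t. real n)" for c d :: real
    unfolding set_integrable_def by (intro integrableI_bounded_set_indicator[where B = "real n"]) (auto simp: emeasure_lborel_Icc_eq)
  have kpos: "0 \<le> (LINT s:{c..d}|lborel. k n s)" for c d
    unfolding set_lebesgue_integral_def by (rule integral_nonneg_AE) (auto simp: k_le)
  have "total_increment f P < \<epsilon>" if P: "packing a b P" "total_length P < \<delta>" for P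
  proof -
    have "total_increment f P \<le> (\<Sum>z\<in>P. (case z of (c, d) \<Rightarrow> \<Phi> d - \<Phi> c) + real n * (case z of (c, d) \<Rightarrow> d - c))"
    proof (rule sum_mono, clarify)
      fix c d assume "(c, d) \<in> P"
      then have cd: "a \<le> c" "c \<le> d" "d \<le> b" using packingD(2)[OF P(1)] by force+
      have "norm (f d - f c) \<le> (LINT t:{c..d}|lborel. norm (g t))"
        unfolding primitive_onD(2)[OF fg cd] set_lebesgue_integral_def
        by (rule order_trans[OF integral_norm_bound]) simp
      also have "\<dots> \<le> (LINT t:{c..d}|lborel. k n t + real n)"
      proof (rule set_integral_mono)
        show "set_integrable lborel {c..d} (\<lambda>t. norm (g t))"
          by (rule set_integrable_lborel_Icc) (use g in simp)
        show "set_integrable lborel {c..d} (\<lambda>t. k n t + real n)"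
          by (rule set_integral_add(1)[OF set_integrable_lborel_Icc[OF kint] cint])
      qed (simp add: k_def indicator_def)
      also have "\<dots> = (LINT t:{c..d}|lborel. k n t) + (LINT t:{c..d}|lborel. real n)"
        by (rule set_integral_add(2)[OF set_integrable_lborel_Icc[OF kint] cint])
      also have "(LINT t:{c..d}|lborel. real n) = real n * (d - c)"
        using cd by (simp add: set_lebesgue_integral_def)
      finally show "norm (f d - f c) \<le> (\<Phi> d - \<Phi> c) + real n * (d - c)" using \<Phi>[OF cd(1,2)] by simp
    qed
    also have "\<dots> = (\<Sum>(c, d)\<in>P. \<Phi> d - \<Phi> c) + real n * total_length P"
      by (simp add: sum.distrib sum_distrib_left)
    also have "(\<Sum>(c, d)\<in>P. \<Phi> d - \<Phi> c) \<le> \<Phi> b - \<Phi> a"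
      by (rule packing_telescope[OF P(1) ab]) (use \<Phi> kpos in \<open>metis diff_ge_0_iff_ge\<close>)
    also have "\<Phi> b - \<Phi> a \<le> (LINT t|lborel. k n t)"
      unfolding \<Phi>[OF order_refl ab] set_lebesgue_integral_def
      by (rule integral_mono) (use kint set_integrable_lborel_Icc[OF kint] k_le in \<open>auto simp: set_integrable_def indicator_def\<close>)
    also have "real n * total_length P \<le> real n * \<delta>" using P(2) by (intro mult_left_mono) auto
    finally show ?thesis using n \<delta>(2) by linarith
  qed
  then show "\<exists>\<delta>>0. \<forall>P. packing a b P \<and> total_length P < \<delta> \<longrightarrow> total_increment f P < \<epsilon>"
    using \<delta>(1) by blast
qed

theorem abs_continuous_on_iff_primitive:
  fixes f :: "real \<Rightarrow> 'b::euclidean_space"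
  assumes "a \<le> b"
  shows "abs_continuous_on a b f \<longleftrightarrow> (\<exists>g. primitive_on a b f g)"
proof
  assume "abs_continuous_on a b f"
  from abs_continuous_on_density[OF this assms] show "\<exists>g. primitive_on a b f g"
    unfolding primitive_on_def by metis
qed (use primitive_on_imp_abs_continuous_on assms in blast)

lemma primitive_on_AE_derivative:
  assumes "primitive_on a b f g"
  shows "AE t in lborel. a < t \<and> t < b \<longrightarrow> (f has_vector_derivative g t) (at t)"
  by (rule AE_has_vector_derivative_integral) (use primitive_onD[OF assms] in blast)+

lemma primitive_on_continuous_on:
  assumes "primitive_on a b f g"
  shows "continuous_on {a..b} f"
proof (cases "a \<le> b")
  case True
  then show ?thesis
    using abs_continuous_on_imp_continuous_on[OF primitive_on_imp_abs_continuous_on[OF assms]] by blast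
qed simp

section \<open>Action along curves\<close>

text \<open>
  The facts about \<^const>\<open>action\<close> below are stated for any jointly Borel Lagrangian, so that they serve
  both \<open>L\<close> and \<open>L + h\<close>.
\<close>

definition measurable_lagrangian :: "('b::euclidean_space \<Rightarrow> 'b \<Rightarrow> ennreal) \<Rightarrow> bool" where
  "measurable_lagrangian F \<longleftrightarrow> (\<lambda>(x, v). F x v) \<in> borel_measurable (borel \<Otimes>\<^sub>M borel)"

text \<open>
  A velocity is the derivative at almost every interior time, and completing a measure does not change
  nonnegative integrals. From here on the action is a Borel integral in terms of any velocity.
\<close>

lemma action_eq_lborel:
  assumes \<gamma>: "primitive_on a b \<gamma> g"
  shows "action F a b \<gamma> = enn2ereal (\<integral>\<^sup>+t\<in>{a..b}. F (\<gamma> t) (g t) \<partial>lborel)"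
proof -
  have "(\<integral>\<^sup>+t\<in>{a..b}. F (\<gamma> t) (vector_derivative \<gamma> (at t within {a..b})) \<partial>lborel)
      = (\<integral>\<^sup>+t\<in>{a..b}. F (\<gamma> t) (g t) \<partial>lborel)"
  proof (rule nn_integral_cong_AE)
    show "AE t in lborel. F (\<gamma> t) (vector_derivative \<gamma> (at t within {a..b})) * indicator {a..b} t
        = F (\<gamma> t) (g t) * indicator {a..b} t"
      using primitive_on_AE_derivative[OF \<gamma>] AE_lborel_singleton[of a] AE_lborel_singleton[of b]
    proof eventually_elim
      case (elim t)
      show ?case
      proof (cases "a < t \<and> t < b")
        case True
        then have "vector_derivative \<gamma> (at t within {a..b}) = g t"
          using elim(1) by (intro vector_derivative_within_cbox[of a b, unfolded cbox_interval])
            (auto intro: has_vector_derivative_at_within)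
        then show ?thesis by simp
      next
        case False
        then have "t \<notin> {a..b}" using elim by auto
        then show ?thesis by simp
      qed
    qed
  qed
  then show ?thesis unfolding action_def nn_integral_completion by simp
qed

lemma borel_measurable_lagrangian_curve:
  assumes F: "measurable_lagrangian F" and \<gamma>: "primitive_on a b \<gamma> g"
  shows "(\<lambda>t. F (\<gamma> t) (g t) * indicator {a..b} t) \<in> borel_measurable lborel"
proof (cases "a \<le> b")
  case True
  have "continuous_on UNIV (\<lambda>t. \<gamma> (max a (min b t)))"
    by (rule continuous_on_compose2[OF primitive_on_continuous_on[OF \<gamma>]])
       (use True in \<open>auto intro!: continuous_intros\<close>)
  then have 1: "(\<lambda>t. \<gamma> (max a (min b t))) \<in> borel_measurable borel"
    by (rule borel_measurable_continuous_onI)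
  have 2: "g \<in> borel_measurable borel" using primitive_onD(1)[OF \<gamma>] by (simp add: borel_measurable_integrable)
  have "(\<lambda>t. (\<lambda>(x, v). F x v) (\<gamma> (max a (min b t)), g t)) \<in> borel_measurable borel"
    by (rule measurable_compose[OF measurable_Pair[OF 1 2] F[unfolded measurable_lagrangian_def]])
  then have "(\<lambda>t. F (\<gamma> (max a (min b t))) (g t) * indicator {a..b} t) \<in> borel_measurable borel"
    by (intro borel_measurable_times_ennreal) auto
  moreover have "(\<lambda>t. F (\<gamma> (max a (min b t))) (g t) * indicator {a..b} t) = (\<lambda>t. F (\<gamma> t) (g t) * indicator {a..b} t)"
    by (auto simp: indicator_def fun_eq_iff max_def min_def)
  ultimately show ?thesis by simp
qed simp

lemma nn_integral_Icc_combine: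
  assumes f: "(\<lambda>t. f t * indicator {a..c} t) \<in> borel_measurable lborel" and "a \<le> b" "b \<le> (c::real)"
  shows "(\<integral>\<^sup>+t\<in>{a..c}. f t \<partial>lborel) = (\<integral>\<^sup>+t\<in>{a..b}. f t \<partial>lborel) + (\<integral>\<^sup>+t\<in>{b..c}. f t \<partial>lborel)"
proof -
  have m: "(\<lambda>t. f t * indicator {p..q} t) \<in> borel_measurable lborel" if "a \<le> p" "q \<le> c" for p q
  proof -
    have "(\<lambda>t. (f t * indicator {a..c} t) * indicator {p..q} t) \<in> borel_measurable lborel"
      by (intro borel_measurable_times_ennreal f) auto
    also have "(\<lambda>t. (f t * indicator {a..c} t) * indicator {p..q} t) = (\<lambda>t. f t * indicator {p..q} t)"
      using that by (auto simp: indicator_def fun_eq_iff)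
    finally show ?thesis .
  qed
  have "(\<integral>\<^sup>+t\<in>{a..c}. f t \<partial>lborel) = (\<integral>\<^sup>+t. f t * indicator {a..b} t + f t * indicator {b..c} t \<partial>lborel)"
  proof (rule nn_integral_cong_AE)
    show "AE t in lborel. f t * indicator {a..c} t = f t * indicator {a..b} t + f t * indicator {b..c} t"
      using AE_lborel_singleton[of b] by eventually_elim (use assms in \<open>auto simp: indicator_def\<close>)
  qed
  also have "\<dots> = (\<integral>\<^sup>+t\<in>{a..b}. f t \<partial>lborel) + (\<integral>\<^sup>+t\<in>{b..c}. f t \<partial>lborel)"
    by (rule nn_integral_add) (use m assms in auto)
  finally show ?thesis .
qed

lemma action_combine:
  assumes F: "measurable_lagrangian F" and \<gamma>: "abs_continuous_on a c \<gamma>" and "a \<le> b" "b \<le> c"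
  shows "action F a c \<gamma> = action F a b \<gamma> + action F b c \<gamma>"
proof -
  obtain g where g: "primitive_on a c \<gamma> g"
    using \<gamma> abs_continuous_on_iff_primitive[of a c \<gamma>] assms by auto
  have "primitive_on a b \<gamma> g" "primitive_on b c \<gamma> g"
    using primitive_on_subinterval[OF g] assms by auto
  from this[THEN action_eq_lborel] show ?thesis
    using nn_integral_Icc_combine[OF borel_measurable_lagrangian_curve[OF F g] assms(3,4)]
    by (simp add: action_eq_lborel[OF g] plus_ennreal.rep_eq)
qed

lemma action_nonneg: "0 \<le> action F a b \<gamma>"
  unfolding action_def by simp

lemma action_cong:
  assumes "abs_continuous_on a b \<gamma>" "\<And>t. a \<le> t \<Longrightarrow> t \<le> b \<Longrightarrow> \<gamma>' t = \<gamma> t" "a \<le> b"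
  shows "action F a b \<gamma>' = action F a b \<gamma>"
proof -
  obtain g where g: "primitive_on a b \<gamma> g"
    using assms abs_continuous_on_iff_primitive[of a b \<gamma>] by auto
  have "primitive_on a b \<gamma>' g" by (rule primitive_on_cong[OF g assms(2)])
  from action_eq_lborel[OF this] action_eq_lborel[OF g] show ?thesis
    by (auto intro!: arg_cong[where f = enn2ereal] nn_integral_cong simp: assms(2) indicator_def)
qed

lemma primitive_on_affine:
  fixes \<gamma> :: "real \<Rightarrow> 'b::euclidean_space"
  assumes \<gamma>: "primitive_on a b \<gamma> g" and \<sigma>: "\<sigma> = 1 \<or> \<sigma> = - 1"
    and iv: "\<And>t. a' \<le> t \<and> t \<le> b' \<longleftrightarrow> a \<le> s + \<sigma> * t \<and> s + \<sigma> * t \<le> b"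
  shows "primitive_on a' b' (\<lambda>t. \<gamma> (s + \<sigma> * t)) (\<lambda>t. \<sigma> *\<^sub>R g (s + \<sigma> * t))"
  unfolding primitive_on_def
proof (intro conjI allI impI)
  note g = primitive_onD(1)[OF \<gamma>]
  have \<sigma>0: "\<sigma> \<noteq> 0" "\<bar>\<sigma>\<bar> = 1" using \<sigma> by auto
  show "integrable lborel (\<lambda>t. \<sigma> *\<^sub>R g (s + \<sigma> * t))"
    by (intro integrable_scaleR_right lborel_integrable_real_affine[OF g \<sigma>0(1)])
  fix c d assume cd: "a' \<le> c \<and> c \<le> d \<and> d \<le> b'"
  then have c: "a \<le> s + \<sigma> * c" "s + \<sigma> * c \<le> b" and d: "a \<le> s + \<sigma> * d" "s + \<sigma> * d \<le> b"
    using iv[of c] iv[of d] by auto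
  define p q where "p = min (s + \<sigma> * c) (s + \<sigma> * d)" and "q = max (s + \<sigma> * c) (s + \<sigma> * d)"
  have pq: "a \<le> p" "p \<le> q" "q \<le> b" using c d by (auto simp: p_def q_def)
  have "(LINT t:{c..d}|lborel. \<sigma> *\<^sub>R g (s + \<sigma> * t)) = \<sigma> *\<^sub>R (LINT t:{c..d}|lborel. g (s + \<sigma> * t))"
    by simp
  also have "(LINT t:{c..d}|lborel. g (s + \<sigma> * t)) = (LINT t:{p..q}|lborel. g t)"
    unfolding set_lebesgue_integral_def
    by (subst lborel_integral_real_affine[OF \<sigma>0(1), of _ s])
       (use \<sigma> cd in \<open>auto intro!: Bochner_Integration.integral_cong simp: indicator_def p_def q_def\<close>)
  also have "\<dots> = \<gamma> q - \<gamma> p" using primitive_onD(2)[OF \<gamma> pq] by simp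
  finally show "\<gamma> (s + \<sigma> * d) - \<gamma> (s + \<sigma> * c) = (LINT t:{c..d}|lborel. \<sigma> *\<^sub>R g (s + \<sigma> * t))"
    using \<sigma> cd by (auto simp: p_def q_def)
qed

text \<open>
  The action of an even Lagrangian is unchanged by translations and reflections of time. Translations
  bring all curves to the starting time \<open>0\<close> and make concatenation possible; the reflection makes the
  action potential symmetric.
\<close>

lemma action_affine:
  fixes \<gamma> :: "real \<Rightarrow> ('a::euclidean_space, 'n::finite) config"
  assumes F: "measurable_lagrangian F" and even: "\<And>x v. F x (- v) = F x v"
    and \<gamma>: "abs_continuous_on a b \<gamma>" and ab: "a \<le> b" "a' \<le> b'" and \<sigma>: "\<sigma> = 1 \<or> \<sigma> = - 1"
    and iv: "\<And>t. a' \<le> t \<and> t \<le> b' \<longleftrightarrow> a \<le> s + \<sigma> * t \<and> s + \<sigma> * t \<le> b"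
  shows "abs_continuous_on a' b' (\<lambda>t. \<gamma> (s + \<sigma> * t))"
    and "action F a' b' (\<lambda>t. \<gamma> (s + \<sigma> * t)) = action F a b \<gamma>"
proof -
  obtain g where g: "primitive_on a b \<gamma> g"
    using assms abs_continuous_on_iff_primitive[of a b \<gamma>] by auto
  note pr = primitive_on_affine[OF g \<sigma> iv]
  show "abs_continuous_on a' b' (\<lambda>t. \<gamma> (s + \<sigma> * t))"
    using primitive_on_imp_abs_continuous_on[OF pr ab(2)] .
  have \<sigma>0: "\<sigma> \<noteq> 0" "\<bar>\<sigma>\<bar> = 1" using \<sigma> by auto
  have "(\<integral>\<^sup>+t\<in>{a..b}. F (\<gamma> t) (g t) \<partial>lborel)
      = (\<integral>\<^sup>+t. F (\<gamma> (s + \<sigma> * t)) (g (s + \<sigma> * t)) * indicator {a..b} (s + \<sigma> * t) \<partial>lborel)"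
    using nn_integral_real_affine[OF _ \<sigma>0(1), of "\<lambda>t. F (\<gamma> t) (g t) * indicator {a..b} t" s]
      borel_measurable_lagrangian_curve[OF F g] \<sigma>0(2) by simp
  also have "\<dots> = (\<integral>\<^sup>+t\<in>{a'..b'}. F (\<gamma> (s + \<sigma> * t)) (\<sigma> *\<^sub>R g (s + \<sigma> * t)) \<partial>lborel)"
  proof (rule nn_integral_cong)
    fix t
    have "F (\<gamma> (s + \<sigma> * t)) (\<sigma> *\<^sub>R g (s + \<sigma> * t)) = F (\<gamma> (s + \<sigma> * t)) (g (s + \<sigma> * t))"
      using \<sigma> even by auto
    moreover have "indicator {a..b} (s + \<sigma> * t) = (indicator {a'..b'} t :: ennreal)"
      using iv[of t] by (auto simp: indicator_def)
    ultimately show "F (\<gamma> (s + \<sigma> * t)) (g (s + \<sigma> * t)) * indicator {a..b} (s + \<sigma> * t)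
        = F (\<gamma> (s + \<sigma> * t)) (\<sigma> *\<^sub>R g (s + \<sigma> * t)) * indicator {a'..b'} t" by simp
  qed
  finally show "action F a' b' (\<lambda>t. \<gamma> (s + \<sigma> * t)) = action F a b \<gamma>"
    by (simp add: action_eq_lborel[OF g] action_eq_lborel[OF pr])
qed

lemma abs_continuous_on_combine:
  fixes \<gamma> :: "real \<Rightarrow> 'b::euclidean_space"
  assumes "abs_continuous_on a b \<gamma>" "abs_continuous_on b c \<gamma>" and ab: "a \<le> b" "b \<le> c"
  shows "abs_continuous_on a c \<gamma>"
proof -
  obtain g1 where g1: "primitive_on a b \<gamma> g1" using assms abs_continuous_on_iff_primitive[of a b \<gamma>] by auto
  obtain g2 where g2: "primitive_on b c \<gamma> g2" using assms abs_continuous_on_iff_primitive[of b c \<gamma>] by auto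
  define g where "g t = indicator {a..b} t *\<^sub>R g1 t + indicator {b<..c} t *\<^sub>R g2 t" for t
  have int: "integrable lborel g" unfolding g_def
    by (intro Bochner_Integration.integrable_add integrable_mult_indicator primitive_onD(1)[OF g1] primitive_onD(1)[OF g2]) auto
  have L: "(LINT t:{p..q}|lborel. g t) = \<gamma> q - \<gamma> p" if "a \<le> p" "p \<le> q" "q \<le> b" for p q
  proof -
    have "(LINT t:{p..q}|lborel. g t) = (LINT t:{p..q}|lborel. g1 t)"
      by (rule set_lebesgue_integral_cong) (use that in \<open>auto simp: g_def\<close>)
    then show ?thesis using primitive_onD(2)[OF g1 that] by simp
  qed
  have R: "(LINT t:{p..q}|lborel. g t) = \<gamma> q - \<gamma> p" if "b \<le> p" "p \<le> q" "q \<le> c" for p q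
  proof -
    have "(LINT t:{p..q}|lborel. g t) = (LINT t:{p..q}|lborel. g2 t)"
    proof (rule set_lebesgue_integral_cong_AE)
      show "AE t\<in>{p..q} in lborel. g t = g2 t"
        using AE_lborel_singleton[of b] by eventually_elim (use that in \<open>auto simp: g_def\<close>)
    qed (use int primitive_onD(1)[OF g2] in \<open>auto intro: borel_measurable_integrable\<close>)
    then show ?thesis using primitive_onD(2)[OF g2 that] by simp
  qed
  have "primitive_on a c \<gamma> g"
    unfolding primitive_on_def
  proof (intro conjI allI impI int)
    fix p q assume pq: "a \<le> p \<and> p \<le> q \<and> q \<le> c"
    consider "q \<le> b" | "b \<le> p" | "p \<le> b" "b \<le> q" by linarith
    then show "\<gamma> q - \<gamma> p = (LINT t:{p..q}|lborel. g t)"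
    proof cases
      case 3
      then show ?thesis
        using set_integral_lborel_combine[OF int 3] L[of p b] R[of b q] pq by simp
    qed (use L[of p q] R[of p q] pq in auto)
  qed
  then show ?thesis using primitive_on_imp_abs_continuous_on ab by (meson order_trans)
qed

section \<open>Kinetic energy and the Newtonian Lagrangian\<close>

abbreviation lagrangian_plus ::
    "('n::{finite,linorder} \<Rightarrow> real) \<Rightarrow> real \<Rightarrow> ('a::euclidean_space, 'n) config \<Rightarrow> ('a, 'n) config \<Rightarrow> ennreal" where
  "lagrangian_plus m h \<equiv> \<lambda>x v. lagrangian m x v + ennreal h"

text \<open>
  The convex part of the Lagrangian, separated because semicontinuity treats it by convexity and the
  potential by Fatou's lemma.
\<close>

definition kinetic :: "('n::finite \<Rightarrow> real) \<Rightarrow> ('a::euclidean_space, 'n) config \<Rightarrow> real" where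
  "kinetic m v = 1/2 * (mass_norm m v)\<^sup>2"

lemma mass_inner_eq_inner: "mass_inner m x y = (\<chi> i. m i *\<^sub>R (x $ i)) \<bullet> y"
  by (simp add: mass_inner_def inner_vec_def)

text \<open>
  Continuity holds at collisions as well, since inversion is continuous on \<^typ>\<open>ennreal\<close>.
\<close>

lemma newton_potential_tendsto:
  fixes X :: "nat \<Rightarrow> ('a::euclidean_space, 'n::{finite,linorder}) config"
  assumes "X \<longlonglongrightarrow> x"
  shows "(\<lambda>n. newton_potential m (X n)) \<longlonglongrightarrow> newton_potential m x"
  unfolding newton_potential_def
proof (rule tendsto_sum, clarify)
  fix i j :: 'n
  have inv: "continuous_on UNIV (inverse :: ennreal \<Rightarrow> ennreal)"
    using continuous_on_inverse_ennreal[OF continuous_on_id] by simp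
  have "(\<lambda>n. ennreal (norm (X n $ i - X n $ j))) \<longlonglongrightarrow> ennreal (norm (x $ i - x $ j))"
    by (intro tendsto_ennrealI tendsto_norm tendsto_diff tendsto_vec_nth assms)
  then have "(\<lambda>n. inverse (ennreal (norm (X n $ i - X n $ j)))) \<longlonglongrightarrow> inverse (ennreal (norm (x $ i - x $ j)))"
    by (rule continuous_on_tendsto_compose[OF inv]) simp_all
  then show "(\<lambda>n. ennreal (m i * m j) * inverse (ennreal (norm (X n $ i - X n $ j))))
      \<longlonglongrightarrow> ennreal (m i * m j) * inverse (ennreal (norm (x $ i - x $ j)))"
    by (intro ennreal_tendsto_cmult) simp_all
qed

lemma continuous_on_mass_norm: "continuous_on A (mass_norm m)"
  unfolding mass_norm_def mass_inner_def by (intro continuous_intros)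

lemma newton_potential_borel_measurable:
  "newton_potential m \<in> borel_measurable borel"
proof -
  have "(\<lambda>x. norm (x $ i - x $ j)) \<in> borel_measurable borel" for i j :: 'b
    by (intro borel_measurable_continuous_onI continuous_intros)
  then have "(\<lambda>x. ennreal (m i * m j) * inverse (ennreal (norm (x $ i - x $ j)))) \<in> borel_measurable borel" for i j
    by measurable
  then show ?thesis unfolding newton_potential_def
    by (intro borel_measurable_sum) (auto simp: case_prod_beta)
qed

lemma measurable_lagrangian_plus: "measurable_lagrangian (lagrangian_plus m h)"
proof -
  have mn: "mass_norm m \<in> borel_measurable borel"
    by (rule borel_measurable_continuous_onI[OF continuous_on_mass_norm])
  have 1: "(\<lambda>z. newton_potential m (fst z)) \<in> borel_measurable (borel \<Otimes>\<^sub>M borel)"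
    by (rule measurable_compose[OF measurable_fst newton_potential_borel_measurable])
  have 2: "(\<lambda>z. mass_norm m (snd z)) \<in> borel_measurable (borel \<Otimes>\<^sub>M borel)"
    by (rule measurable_compose[OF measurable_snd mn])
  show ?thesis unfolding measurable_lagrangian_def lagrangian_def case_prod_beta
    using 1 2 by measurable
qed

lemma lagrangian_plus_zero: "lagrangian_plus m 0 = lagrangian m"
  by (simp add: fun_eq_iff)

lemma mass_norm_minus: "mass_norm m (- v) = mass_norm m v"
  by (simp add: mass_norm_def mass_inner_def)

lemma lagrangian_plus_even: "lagrangian_plus m h x (- v) = lagrangian_plus m h x v"
  by (simp add: lagrangian_def mass_norm_minus)

context
  fixes m :: "'n::{finite,linorder} \<Rightarrow> real"
  assumes m_pos: "\<And>i. m i > 0"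
begin

lemma mass_inner_nonneg: "0 \<le> mass_inner m x x"
  unfolding mass_inner_def by (intro sum_nonneg mult_nonneg_nonneg) (use m_pos in \<open>auto intro: less_imp_le\<close>)

lemma mass_norm_sq: "(mass_norm m v)\<^sup>2 = mass_inner m v v"
  using mass_inner_nonneg[of v] by (simp add: mass_norm_def)

lemma mass_norm_nonneg: "0 \<le> mass_norm m v"
  using mass_inner_nonneg[of v] by (simp add: mass_norm_def)

text \<open>
  The tangent plane at \<open>w\<close> lies below the graph of the kinetic energy; Jensen's inequality follows by
  integrating this.
\<close>

lemma kinetic_young: "mass_inner m w v \<le> kinetic m w + kinetic m v"
proof -
  have "0 \<le> mass_inner m (v - w) (v - w)" by (rule mass_inner_nonneg)
  also have "\<dots> = mass_inner m v v + mass_inner m w w - 2 * mass_inner m w v"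
    by (simp add: mass_inner_def inner_diff_left inner_diff_right inner_commute algebra_simps sum.distrib sum_subtractf sum_distrib_left)
  finally show ?thesis by (simp add: kinetic_def mass_norm_sq)
qed

lemma kinetic_nonneg: "0 \<le> kinetic m v"
  by (simp add: kinetic_def)

lemma kinetic_lower:
  obtains \<kappa> where "\<kappa> > 0" "\<And>v :: ('a::euclidean_space, 'n) config. \<kappa> * (norm v)\<^sup>2 \<le> kinetic m v"
proof
  show "Min (range m) / 2 > 0" using m_pos by (simp add: Min_gr_iff)
  fix v :: "('a, 'n) config"
  have "(norm v)\<^sup>2 = (\<Sum>i\<in>UNIV. v $ i \<bullet> v $ i)"
    by (simp add: power2_norm_eq_inner inner_vec_def)
  then have "Min (range m) * (norm v)\<^sup>2 = (\<Sum>i\<in>UNIV. Min (range m) * (v $ i \<bullet> v $ i))"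
    by (simp add: sum_distrib_left)
  also have "\<dots> \<le> mass_inner m v v" unfolding mass_inner_def
    by (intro sum_mono mult_right_mono) auto
  finally show "Min (range m) / 2 * (norm v)\<^sup>2 \<le> kinetic m v" by (simp add: kinetic_def mass_norm_sq)
qed

lemma mass_norm_upper:
  obtains B where "B > 0" "\<And>v :: ('a::euclidean_space, 'n) config. mass_norm m v \<le> B * norm v"
proof
  have M: "Max (range m) > 0" using m_pos by (simp add: Max_gr_iff)
  then show "sqrt (Max (range m)) > 0" by simp
  fix v :: "('a, 'n) config"
  have "(norm v)\<^sup>2 = (\<Sum>i\<in>UNIV. v $ i \<bullet> v $ i)"
    by (simp add: power2_norm_eq_inner inner_vec_def)
  then have "Max (range m) * (norm v)\<^sup>2 = (\<Sum>i\<in>UNIV. Max (range m) * (v $ i \<bullet> v $ i))"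
    by (simp add: sum_distrib_left)
  moreover have "mass_inner m v v \<le> \<dots>" unfolding mass_inner_def
    by (intro sum_mono mult_right_mono) auto
  ultimately have "mass_norm m v \<le> sqrt (Max (range m) * (norm v)\<^sup>2)" by (simp add: mass_norm_def)
  then show "mass_norm m v \<le> sqrt (Max (range m)) * norm v" by (simp add: real_sqrt_mult)
qed

text \<open>
  Integrate the tangent plane inequality at the mean velocity \<open>w\<close>, using that the velocity integrates to
  the displacement.
\<close>

lemma kinetic_jensen:
  fixes \<gamma> :: "real \<Rightarrow> ('a::euclidean_space, 'n) config"
  assumes \<gamma>: "primitive_on a b \<gamma> g" and cd: "a \<le> c" "c < d" "d \<le> b"
  shows "ennreal ((d - c) * kinetic m ((\<gamma> d - \<gamma> c) /\<^sub>R (d - c))) \<le> (\<integral>\<^sup>+t\<in>{c..d}. ennreal (kinetic m (g t)) \<partial>lborel)"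
    (is "_ \<le> ?I")
proof (cases "?I = top")
  case False
  note g = primitive_onD(1)[OF \<gamma>]
  have gm[measurable]: "g \<in> borel_measurable borel" using g by (simp add: borel_measurable_integrable)
  have mn[measurable]: "mass_norm m \<in> borel_measurable borel"
    by (rule borel_measurable_continuous_onI[OF continuous_on_mass_norm])
  define w where "w = (\<gamma> d - \<gamma> c) /\<^sub>R (d - c)"
  define k where "k t = indicator {c..d} t * kinetic m (g t)" for t
  have kI: "(\<integral>\<^sup>+t. ennreal (k t) \<partial>lborel) = ?I"
    by (intro nn_integral_cong) (auto simp: k_def indicator_def)
  have k0: "0 \<le> k t" for t by (simp add: k_def kinetic_nonneg)
  have km: "k \<in> borel_measurable lborel" unfolding k_def kinetic_def by measurable
  have kint: "integrable lborel k"
    by (rule integrableI_nonneg) (use km k0 False kI in \<open>auto simp: less_top\<close>)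
  have kval: "ennreal (integral\<^sup>L lborel k) = ?I"
    using nn_integral_eq_integral[OF kint] k0 kI by simp
  have lin: "(LINT t:{c..d}|lborel. mass_inner m w (g t)) = mass_inner m w (\<gamma> d - \<gamma> c)"
  proof -
    have "(LINT t:{c..d}|lborel. mass_inner m w (g t))
        = (LINT t|lborel. (\<chi> i. m i *\<^sub>R (w $ i)) \<bullet> (indicator {c..d} t *\<^sub>R g t))"
      unfolding set_lebesgue_integral_def mass_inner_eq_inner by (simp add: inner_commute)
    also have "\<dots> = (\<chi> i. m i *\<^sub>R (w $ i)) \<bullet> (LINT t:{c..d}|lborel. g t)"
      unfolding set_lebesgue_integral_def
      using set_integrable_lborel_Icc[OF g, of c d] unfolding set_integrable_def
      by (simp only: integral_inner_right)
    finally show ?thesis using primitive_onD(2)[OF \<gamma>] cd by (simp add: mass_inner_eq_inner)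
  qed
  have "mass_inner m w (\<gamma> d - \<gamma> c) \<le> (LINT t|lborel. indicator {c..d} t * kinetic m w + k t)"
    unfolding lin[symmetric] set_lebesgue_integral_def
  proof (rule integral_mono)
    have "integrable lborel (\<lambda>t. (\<chi> i. m i *\<^sub>R (w $ i)) \<bullet> (indicator {c..d} t *\<^sub>R g t))"
      by (intro integrable_inner_right) (use set_integrable_lborel_Icc[OF g, of c d] in \<open>simp add: set_integrable_def\<close>)
    then show "integrable lborel (\<lambda>t. indicator {c..d} t *\<^sub>R mass_inner m w (g t))"
      by (simp add: mass_inner_eq_inner)
    show "integrable lborel (\<lambda>t. indicator {c..d} t * kinetic m w + k t)"
      using kint cd by (intro Bochner_Integration.integrable_add integrable_mult_left integrable_real_indicator) auto
    show "indicator {c..d} t *\<^sub>R mass_inner m w (g t) \<le> indicator {c..d} t * kinetic m w + k t" for t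
      using kinetic_young[of w "g t"] by (simp add: k_def indicator_def)
  qed
  also have "\<dots> = (d - c) * kinetic m w + integral\<^sup>L lborel k"
    using kint cd by (subst Bochner_Integration.integral_add) (auto intro!: integrable_mult_left integrable_real_indicator)
  also have "mass_inner m w (\<gamma> d - \<gamma> c) = (d - c) * (2 * kinetic m w)"
  proof -
    have "\<gamma> d - \<gamma> c = (d - c) *\<^sub>R w" using cd by (simp add: w_def)
    then have "mass_inner m w (\<gamma> d - \<gamma> c) = (d - c) * mass_inner m w w"
      by (simp add: mass_inner_def sum_distrib_left mult.left_commute mult.assoc)
    then show ?thesis by (simp add: kinetic_def mass_norm_sq)
  qed
  finally have "(d - c) * kinetic m w \<le> integral\<^sup>L lborel k" by simp
  then have "ennreal ((d - c) * kinetic m w) \<le> ennreal (integral\<^sup>L lborel k)" by (rule ennreal_leI)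
  then show ?thesis unfolding kval w_def .
qed simp

text \<open>
  Since the potential is nonnegative, action controls displacement: this is the source of all
  compactness below.
\<close>

lemma displacement_le_action:
  obtains \<kappa> where "\<kappa> > 0"
    "\<And>(\<gamma> :: real \<Rightarrow> ('a::euclidean_space, 'n) config) a b h A. abs_continuous_on a b \<gamma> \<Longrightarrow> a < b \<Longrightarrow>
       action_Lh m h a b \<gamma> \<le> ereal A \<Longrightarrow> \<kappa> * (norm (\<gamma> b - \<gamma> a))\<^sup>2 \<le> (b - a) * A"
proof -
  obtain \<kappa> where \<kappa>: "\<kappa> > 0" "\<And>v :: ('a, 'n) config. \<kappa> * (norm v)\<^sup>2 \<le> kinetic m v" by (rule kinetic_lower) blast
  show thesis
  proof (rule that[OF \<kappa>(1)])
    fix \<gamma> :: "real \<Rightarrow> ('a, 'n) config" and a b h A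
    assume \<gamma>: "abs_continuous_on a b \<gamma>" and ab: "a < b" and A: "action_Lh m h a b \<gamma> \<le> ereal A"
    obtain g where g: "primitive_on a b \<gamma> g"
      using \<gamma> ab abs_continuous_on_iff_primitive[of a b \<gamma>] by auto
    have A0: "0 \<le> A"
      using order_trans[OF action_nonneg A] by simp
    have "ennreal ((b - a) * kinetic m ((\<gamma> b - \<gamma> a) /\<^sub>R (b - a))) \<le> (\<integral>\<^sup>+t\<in>{a..b}. ennreal (kinetic m (g t)) \<partial>lborel)"
      by (rule kinetic_jensen[OF g]) (use ab in auto)
    also have "\<dots> \<le> (\<integral>\<^sup>+t\<in>{a..b}. lagrangian_plus m h (\<gamma> t) (g t) \<partial>lborel)"
      by (intro nn_integral_mono mult_right_mono)
         (auto simp: lagrangian_def kinetic_def add.assoc intro: order_trans[OF _ add_increasing2])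
    also have "\<dots> \<le> ennreal A"
      using A unfolding action_eq_lborel[OF g] by (metis A0 enn2ereal_ennreal less_eq_ennreal.rep_eq)
    finally have "(b - a) * kinetic m ((\<gamma> b - \<gamma> a) /\<^sub>R (b - a)) \<le> A"
      using A0 by (simp add: ennreal_le_iff)
    moreover have "(b - a) * (\<kappa> * (norm ((\<gamma> b - \<gamma> a) /\<^sub>R (b - a)))\<^sup>2) \<le> (b - a) * kinetic m ((\<gamma> b - \<gamma> a) /\<^sub>R (b - a))"
      by (intro mult_left_mono \<kappa>(2)) (use ab in simp)
    moreover have "(b - a) * (\<kappa> * (norm (\<Delta> /\<^sub>R (b - a)))\<^sup>2) = \<kappa> * (norm \<Delta>)\<^sup>2 / (b - a)" for \<Delta> :: "('a, 'n) config"
    proof -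
      have "s * (\<kappa> * (norm (\<Delta> /\<^sub>R s))\<^sup>2) = \<kappa> * (norm \<Delta>)\<^sup>2 / s" if "s > 0" for s
        using that by (simp add: power2_eq_square field_simps)
      then show ?thesis using ab by simp
    qed
    ultimately have "\<kappa> * (norm (\<gamma> b - \<gamma> a))\<^sup>2 / (b - a) \<le> A" by simp
    then show "\<kappa> * (norm (\<gamma> b - \<gamma> a))\<^sup>2 \<le> (b - a) * A" using ab by (simp add: field_simps)
  qed
qed

end

section \<open>The action potential\<close>

lemma action_potential_le:
  assumes "abs_continuous_on a b \<gamma>" "a < b"
  shows "action_potential m h (\<gamma> a) (\<gamma> b) \<le> action_Lh m h a b \<gamma>"
  unfolding action_potential_def
  by (rule INF_lower2[of "(a, b, \<gamma>)"]) (use assms in \<open>auto simp: curves_def\<close>)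

lemma action_potential_nonneg: "0 \<le> action_potential m h x y"
  unfolding action_potential_def by (rule INF_greatest) (auto simp: action_nonneg)

text \<open>
  Such curves, whose action exceeds the infimum by as little as desired, take the place of minimizers.
\<close>

lemma action_potential_approx:
  fixes x :: "('a::euclidean_space, 'n::{finite,linorder}) config"
  assumes "action_potential m h x y < c"
  obtains b \<gamma> where "0 < b" "abs_continuous_on 0 b \<gamma>" "\<gamma> 0 = x" "\<gamma> b = y" "action_Lh m h 0 b \<gamma> < c"
proof -
  obtain a b \<gamma> where \<gamma>: "a < b" "abs_continuous_on a b \<gamma>" "\<gamma> a = x" "\<gamma> b = y" "action_Lh m h a b \<gamma> < c"
    using assms unfolding action_potential_def INF_less_iff curves_def by auto
  have aff: "abs_continuous_on 0 (b - a) (\<lambda>t. \<gamma> (a + 1 * t))"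
    "action_Lh m h 0 (b - a) (\<lambda>t. \<gamma> (a + 1 * t)) = action_Lh m h a b \<gamma>"
    by (rule action_affine[OF measurable_lagrangian_plus lagrangian_plus_even \<gamma>(2)]; use \<gamma>(1) in auto)+
  show thesis
    by (rule that[OF _ aff(1)]) (use aff(2) \<gamma> in auto)
qed

lemma action_potential_triangle:
  fixes x :: "('a::euclidean_space, 'n::{finite,linorder}) config"
  shows "action_potential m h x z \<le> action_potential m h x y + action_potential m h y z"
proof (cases "action_potential m h x y = \<infinity> \<or> action_potential m h y z = \<infinity>")
  case True
  then show ?thesis using action_potential_nonneg[of m h] by auto
next
  case False
  obtain p q where pq: "action_potential m h x y = ereal p" "action_potential m h y z = ereal q"
    using False action_potential_nonneg[of m h x y] action_potential_nonneg[of m h y z]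
    by (cases "action_potential m h x y"; cases "action_potential m h y z") auto
  have "action_potential m h x z \<le> ereal (p + q) + ereal e" if e: "e > 0" for e
  proof -
    have "action_potential m h x y < ereal (p + e / 2)" "action_potential m h y z < ereal (q + e / 2)"
      using pq e by auto
    then obtain b \<gamma> b' \<gamma>' where
      1: "0 < b" "abs_continuous_on 0 b \<gamma>" "\<gamma> 0 = x" "\<gamma> b = y" "action_Lh m h 0 b \<gamma> < ereal (p + e / 2)" and
      2: "0 < b'" "abs_continuous_on 0 b' \<gamma>'" "\<gamma>' 0 = y" "\<gamma>' b' = z" "action_Lh m h 0 b' \<gamma>' < ereal (q + e / 2)"
      by (elim action_potential_approx) blast
    define \<delta> where "\<delta> t = (if t \<le> b then \<gamma> t else \<gamma>' (- b + 1 * t))" for t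
    have aff: "abs_continuous_on b (b + b') (\<lambda>t. \<gamma>' (- b + 1 * t))"
      "action_Lh m h b (b + b') (\<lambda>t. \<gamma>' (- b + 1 * t)) = action_Lh m h 0 b' \<gamma>'"
      by (rule action_affine[OF measurable_lagrangian_plus lagrangian_plus_even 2(2)]; use 2(1) in auto)+
    have \<delta>1: "\<delta> t = \<gamma> t" if "t \<le> b" for t using that by (simp add: \<delta>_def)
    have \<delta>2: "\<delta> t = \<gamma>' (- b + 1 * t)" if "b \<le> t" for t using that 1 2 by (auto simp: \<delta>_def)
    have ac1: "abs_continuous_on 0 b \<delta>" by (rule abs_continuous_on_cong[OF 1(2)]) (simp add: \<delta>1)
    have ac2: "abs_continuous_on b (b + b') \<delta>" by (rule abs_continuous_on_cong[OF aff(1)]) (simp add: \<delta>2)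
    have ac: "abs_continuous_on 0 (b + b') \<delta>"
      by (rule abs_continuous_on_combine[OF ac1 ac2]) (use 1 2 in auto)
    have "action_potential m h x z \<le> action_Lh m h 0 (b + b') \<delta>"
      using action_potential_le[OF ac, of m h] 1 2 \<delta>1[of 0] \<delta>2[of "b + b'"] by auto
    also have "\<dots> = action_Lh m h 0 b \<delta> + action_Lh m h b (b + b') \<delta>"
      by (rule action_combine[OF measurable_lagrangian_plus ac]) (use 1 2 in auto)
    also have "action_Lh m h 0 b \<delta> = action_Lh m h 0 b \<gamma>"
      by (rule action_cong[OF 1(2)]) (use \<delta>1 1 in auto)
    also have "action_Lh m h b (b + b') \<delta> = action_Lh m h 0 b' \<gamma>'"
      unfolding aff(2)[symmetric] by (rule action_cong[OF aff(1)]) (use \<delta>2 2 in auto)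
    also have "action_Lh m h 0 b \<gamma> + action_Lh m h 0 b' \<gamma>' \<le> ereal (p + e / 2) + ereal (q + e / 2)"
      by (intro add_mono less_imp_le 1 2)
    also have "ereal (p + e / 2) + ereal (q + e / 2) = ereal (p + q) + ereal e" by (simp add: algebra_simps)
    finally show ?thesis .
  qed
  then show ?thesis unfolding pq using ereal_le_epsilon2 by (metis plus_ereal.simps(1))
qed

lemma action_potential_sym_le:
  fixes x :: "('a::euclidean_space, 'n::{finite,linorder}) config"
  shows "action_potential m h y x \<le> action_potential m h x y"
  unfolding action_potential_def[of m h x y]
proof (rule INF_greatest, clarify)
  fix a b \<gamma> assume "(a, b, \<gamma>) \<in> curves x y"
  then have \<gamma>: "a < b" "abs_continuous_on a b \<gamma>" "\<gamma> a = x" "\<gamma> b = y" by (auto simp: curves_def)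
  have aff: "abs_continuous_on a b (\<lambda>t. \<gamma> ((a + b) + - 1 * t))"
    "action_Lh m h a b (\<lambda>t. \<gamma> ((a + b) + - 1 * t)) = action_Lh m h a b \<gamma>"
    by (rule action_affine[OF measurable_lagrangian_plus lagrangian_plus_even \<gamma>(2)]; use \<gamma>(1) in auto)+
  show "action_potential m h y x \<le> action_Lh m h a b \<gamma>"
    using action_potential_le[OF aff(1) \<gamma>(1), of m h] aff(2) \<gamma> by simp
qed

lemma action_potential_sym:
  fixes x :: "('a::euclidean_space, 'n::{finite,linorder}) config"
  shows "action_potential m h x y = action_potential m h y x"
  by (intro antisym action_potential_sym_le)

section \<open>Modulus of continuity of the action potential\<close>

lemma nn_integral_powr_from_0:
  assumes "p > -1" "T \<ge> (0::real)"
  shows "(\<integral>\<^sup>+t\<in>{0..T}. ennreal (t powr p) \<partial>lborel) = ennreal (T powr (p + 1) / (p + 1))"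
proof -
  have "((\<lambda>t. if t \<in> {0..T} then t powr p else 0) has_integral (T powr (p + 1) / (p + 1))) UNIV"
    using has_integral_powr_from_0[OF assms] by (simp only: has_integral_restrict_UNIV)
  then have "(\<integral>\<^sup>+t. ennreal (if t \<in> {0..T} then t powr p else 0) \<partial>lborel) = ennreal (T powr (p + 1) / (p + 1))"
    by (intro nn_integral_has_integral_lborel) auto
  moreover have "ennreal (if t \<in> {0..T} then t powr p else 0) = ennreal (t powr p) * indicator {0..T} t" for t
    by (simp add: indicator_def)
  ultimately show ?thesis by simp
qed

text \<open>
  The parametrization by \<open>t powr (2/3)\<close> is the one of parabolic ejection from a total collision. Its
  squared speed and the reciprocal of the distance travelled are both multiples of \<open>t powr (-2/3)\<close>,
  which is integrable at \<open>0\<close>.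
\<close>

lemma primitive_on_powr_two_thirds:
  fixes x v :: "'b::euclidean_space"
  assumes "T \<ge> 0"
  shows "primitive_on 0 T (\<lambda>t. x + (t powr (2/3)) *\<^sub>R v) (\<lambda>t. (indicator {0..T} t * (2/3 * t powr (- 1/3))) *\<^sub>R v)"
    (is "primitive_on 0 T ?\<gamma> ?g")
proof -
  let ?w = "\<lambda>t. indicator {0..T} t * (2/3 * t powr (- 1/3)) :: real"
  have "(\<integral>\<^sup>+t. ennreal (?w t) \<partial>lborel) = (\<integral>\<^sup>+t. ennreal (2/3) * (ennreal (t powr (-1/3)) * indicator {0..T} t) \<partial>lborel)"
    by (intro nn_integral_cong) (auto simp: indicator_def ennreal_mult[symmetric])
  also have "\<dots> = ennreal (2/3) * (\<integral>\<^sup>+t\<in>{0..T}. ennreal (t powr (-1/3)) \<partial>lborel)"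
    by (rule nn_integral_cmult) simp
  also have "\<dots> < \<infinity>" using nn_integral_powr_from_0[of "-1/3" T] assms by (simp add: ennreal_mult_less_top)
  finally have "integrable lborel ?w" by (intro integrableI_nonneg) auto
  then have int: "integrable lborel ?g" by (rule integrable_scaleR_left)
  have L: "(LINT t:{0..d}|lborel. ?g t) = (d powr (2/3)) *\<^sub>R v" if d: "0 \<le> d" "d \<le> T" for d
  proof -
    have "((\<lambda>t. 2/3 * t powr (-1/3)) has_integral (2/3 * (d powr (2/3) / (2/3)))) {0..d}"
      using has_integral_mult_right[OF has_integral_powr_from_0[of "-1/3" d], of "2/3"] d by simp
    then have "((\<lambda>t. (2/3 * t powr (-1/3)) *\<^sub>R v) has_integral ((d powr (2/3)) *\<^sub>R v)) {0..d}"
      using has_integral_scaleR_left[of "\<lambda>t. 2/3 * t powr (-1/3)" "d powr (2/3)" "{0..d}" v] by simp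
    then have "(?g has_integral ((d powr (2/3)) *\<^sub>R v)) {0..d}"
      by (rule has_integral_eq[rotated]) (use d in simp)
    then show ?thesis
      using set_borel_integral_eq_integral(2)[OF set_integrable_lborel_Icc[OF int, of 0 d]] by (simp add: integral_unique)
  qed
  show ?thesis unfolding primitive_on_def
  proof (intro conjI allI impI int)
    fix c d assume cd: "0 \<le> c \<and> c \<le> d \<and> d \<le> T"
    then show "?\<gamma> d - ?\<gamma> c = (LINT t:{c..d}|lborel. ?g t)"
      using set_integral_lborel_combine[OF int, of 0 c d] L[of c] L[of d] by (simp add: eq_diff_eq diff_eq_eq add.commute)
  qed
qed

lemma mass_norm_scaleR: "mass_norm m (c *\<^sub>R v) = \<bar>c\<bar> * mass_norm m v"
proof -
  have "mass_inner m (c *\<^sub>R v) (c *\<^sub>R v) = c\<^sup>2 * mass_inner m v v"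
    by (simp add: mass_inner_def power2_eq_square sum_distrib_left mult_ac)
  then show ?thesis by (simp add: mass_norm_def real_sqrt_mult)
qed

text \<open>
  The value of the potential at a configuration all of whose mutual distances equal \<open>1\<close>.
\<close>

definition mass_sum :: "('n::{finite,linorder} \<Rightarrow> real) \<Rightarrow> real" where
  "mass_sum m = (\<Sum>(i, j)\<in>{(i, j). i < j}. m i * m j)"

context
  fixes m :: "'n::{finite,linorder} \<Rightarrow> real"
  assumes m_pos: "\<And>i. m i > 0"
begin

lemma mass_sum_nonneg: "0 \<le> mass_sum m"
  unfolding mass_sum_def by (intro sum_nonneg) (use m_pos in \<open>auto intro: less_imp_le\<close>)

lemma newton_potential_le:
  fixes x :: "('a::euclidean_space, 'n) config"
  assumes r: "r > 0" and sep: "\<And>i j. i < j \<Longrightarrow> r \<le> norm (x $ i - x $ j)"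
  shows "newton_potential m x \<le> ennreal (mass_sum m / r)"
proof -
  have "newton_potential m x \<le> (\<Sum>(i, j)\<in>{(i, j). i < j}. ennreal (m i * m j / r))"
    unfolding newton_potential_def
  proof (rule sum_mono, clarify)
    fix i j :: 'n assume "i < j"
    from sep[OF this] r have n: "norm (x $ i - x $ j) > 0" "inverse (norm (x $ i - x $ j)) \<le> inverse r"
      by (auto intro: le_imp_inverse_le)
    have mm: "0 \<le> m i * m j" using m_pos by (simp add: less_imp_le)
    have "ennreal (m i * m j) * inverse (ennreal (norm (x $ i - x $ j)))
        = ennreal (m i * m j * inverse (norm (x $ i - x $ j)))"
      using n mm by (subst inverse_ennreal) (auto simp: ennreal_mult)
    also have "\<dots> \<le> ennreal (m i * m j / r)"
      using n mm by (intro ennreal_leI) (simp add: divide_inverse mult_left_mono)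
    finally show "ennreal (m i * m j) * inverse (ennreal (norm (x $ i - x $ j))) \<le> ennreal (m i * m j / r)" .
  qed
  also have "\<dots> = ennreal (\<Sum>(i, j)\<in>{(i, j). i < j}. m i * m j / r)"
    using m_pos r by (subst sum_ennreal[symmetric]) (auto simp: case_prod_beta intro: less_imp_le)
  also have "(\<Sum>(i, j)\<in>{(i, j). i < j}. m i * m j / r) = mass_sum m / r"
    unfolding mass_sum_def by (simp add: sum_divide_distrib case_prod_beta)
  finally show ?thesis .
qed

text \<open>
  If the bodies separate at least linearly along \<open>s \<mapsto> x + s v\<close>, this ray can be run through from any
  starting point, collision or not, at a cost that does not depend on \<open>x\<close>. The time needed to reach the parameter \<open>\<rho>\<close> is \<open>\<rho> powr (3/2)\<close>.
\<close>

lemma action_potential_ray: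
  fixes x v :: "('a::euclidean_space, 'n) config"
  assumes sep: "\<And>i j s. i < j \<Longrightarrow> 0 < s \<Longrightarrow> s / 2 \<le> norm ((x + s *\<^sub>R v) $ i - (x + s *\<^sub>R v) $ j)"
    and B: "mass_norm m v \<le> B" and \<rho>: "\<rho> > 0" and h: "h \<ge> 0"
  shows "action_potential m h x (x + \<rho> *\<^sub>R v)
    \<le> ereal ((2/3 * B\<^sup>2 + 6 * mass_sum m + h) * (sqrt \<rho> + \<rho> * sqrt \<rho>))"
proof -
  \<comment> \<open>The time at which \<open>t powr (2/3)\<close> reaches \<open>\<rho>\<close>.\<close>
  define T where "T = \<rho> * sqrt \<rho>"
  have T: "T > 0" using \<rho> by (simp add: T_def)
  have T_powr: "T = \<rho> powr (3/2)" using \<rho> powr_add[of \<rho> 1 "1/2"] by (simp add: T_def powr_half_sqrt)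
  have T1: "T powr (2/3) = \<rho>" "T powr (1/3) = sqrt \<rho>"
    using \<rho> by (simp_all add: T_powr powr_powr powr_half_sqrt)
  define \<gamma> where "\<gamma> t = x + (t powr (2/3)) *\<^sub>R v" for t
  define g where "g t = (indicator {0..T} t * (2/3 * t powr (- 1/3))) *\<^sub>R v" for t
  have pr: "primitive_on 0 T \<gamma> g"
    unfolding \<gamma>_def g_def by (rule primitive_on_powr_two_thirds) (use T in simp)
  define K where "K = 2/9 * B\<^sup>2 + 2 * mass_sum m"
  have K: "K \<ge> 0" using mass_sum_nonneg by (simp add: K_def)
  have bound: "lagrangian_plus m h (\<gamma> t) (g t) \<le> ennreal K * ennreal (t powr (- 2/3)) + ennreal h"
    if t: "0 < t" "t \<le> T" for t
  proof -
    have "t powr (2/3) / 2 > 0" using t by simp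
    from newton_potential_le[OF this, of "\<gamma> t"] sep[of _ _ "t powr (2/3)"] t
    have 1: "newton_potential m (\<gamma> t) \<le> ennreal (mass_sum m / (t powr (2/3) / 2))" by (simp add: \<gamma>_def)
    have "mass_sum m / (t powr (2/3) / 2) = 2 * mass_sum m * t powr (- 2/3)"
      using t by (simp add: powr_minus_divide)
    note 1 = 1[unfolded this]
    have "mass_norm m (g t) = 2/3 * t powr (-1/3) * mass_norm m v"
      using t by (simp add: g_def mass_norm_scaleR)
    then have "1/2 * (mass_norm m (g t))\<^sup>2 = 2/9 * (t powr (-1/3) * t powr (-1/3)) * (mass_norm m v)\<^sup>2"
      by (simp only: power2_eq_square) (simp add: algebra_simps)
    also have "t powr (-1/3) * t powr (-1/3) = t powr (- 2/3)"
      by (simp add: powr_add[symmetric])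
    also have "2/9 * t powr (- 2/3) * (mass_norm m v)\<^sup>2 \<le> 2/9 * t powr (- 2/3) * B\<^sup>2"
      using B mass_norm_nonneg[OF m_pos] by (intro mult_left_mono power_mono) auto
    finally have 2: "1/2 * (mass_norm m (g t))\<^sup>2 \<le> 2/9 * B\<^sup>2 * t powr (- 2/3)" by (simp add: mult_ac)
    have "lagrangian m (\<gamma> t) (g t) \<le> ennreal (2/9 * B\<^sup>2 * t powr (- 2/3)) + ennreal (2 * mass_sum m * t powr (- 2/3))"
      unfolding lagrangian_def by (intro add_mono ennreal_leI 1 2)
    also have "\<dots> = ennreal K * ennreal (t powr (- 2/3))"
      using mass_sum_nonneg by (simp add: ennreal_mult[symmetric] K_def algebra_simps flip: ennreal_plus)
    finally show ?thesis by (intro add_right_mono)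
  qed
  have "(\<integral>\<^sup>+t\<in>{0..T}. lagrangian_plus m h (\<gamma> t) (g t) \<partial>lborel)
      \<le> (\<integral>\<^sup>+t. ennreal K * (ennreal (t powr (- 2/3)) * indicator {0..T} t) + ennreal h * indicator {0..T} t \<partial>lborel)"
  proof (rule nn_integral_mono_AE)
    show "AE t in lborel. lagrangian_plus m h (\<gamma> t) (g t) * indicator {0..T} t
        \<le> ennreal K * (ennreal (t powr (- 2/3)) * indicator {0..T} t) + ennreal h * indicator {0..T} t"
      using AE_lborel_singleton[of 0] by eventually_elim (use bound in \<open>auto simp: indicator_def\<close>)
  qed
  also have "\<dots> = ennreal K * (\<integral>\<^sup>+t\<in>{0..T}. ennreal (t powr (- 2/3)) \<partial>lborel) + ennreal h * ennreal T"
    using T by (subst nn_integral_add) (auto simp: nn_integral_cmult nn_integral_cmult_indicator)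
  also have "\<dots> = ennreal (K * (3 * sqrt \<rho>) + h * T)"
    using nn_integral_powr_from_0[of "- 2/3" T] T T1 K h \<rho>
    by (simp add: ennreal_mult[symmetric] mult.commute flip: ennreal_plus)
  finally have le: "(\<integral>\<^sup>+t\<in>{0..T}. lagrangian_plus m h (\<gamma> t) (g t) \<partial>lborel) \<le> ennreal (K * (3 * sqrt \<rho>) + h * T)" .
  have nn: "0 \<le> K * (3 * sqrt \<rho>) + h * T" using K T h \<rho> by simp
  have "action_potential m h x (x + \<rho> *\<^sub>R v) \<le> action_Lh m h 0 T \<gamma>"
    using action_potential_le[OF primitive_on_imp_abs_continuous_on[OF pr] T, of m h] T T1 by (simp add: \<gamma>_def)
  also have "\<dots> \<le> ereal (K * (3 * sqrt \<rho>) + h * T)"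
    using le unfolding action_eq_lborel[OF pr] less_eq_ennreal.rep_eq enn2ereal_ennreal[OF nn] .
  also have "K * (3 * sqrt \<rho>) + h * T \<le> (2/3 * B\<^sup>2 + 6 * mass_sum m + h) * (sqrt \<rho> + \<rho> * sqrt \<rho>)"
  proof -
    have "(2/3 * B\<^sup>2 + 6 * mass_sum m + h) * (sqrt \<rho> + \<rho> * sqrt \<rho>)
        = K * (3 * sqrt \<rho>) + h * T + (3 * K * T + h * sqrt \<rho>)"
      by (simp add: K_def T_def algebra_simps)
    then show ?thesis using K T h \<rho> by simp
  qed
  finally show ?thesis by simp
qed

end

text \<open>
  Weights that increase with \<open>k\<close>, ties being broken by the order of the index type. Adding a multiple
  of the weights to \<open>k\<close> then moves all values apart, and keeps doing so when the differences of the
  weights are perturbed by at most \<open>1/2\<close>.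
\<close>

lemma sorted_weights:
  fixes k :: "'n::{finite,linorder} \<Rightarrow> real"
  obtains l :: "'n \<Rightarrow> real" where "\<And>i. 0 \<le> l i \<and> l i \<le> CARD('n)"
    "\<And>i j s \<epsilon>. i \<noteq> j \<Longrightarrow> 0 \<le> s \<Longrightarrow> \<bar>\<epsilon>\<bar> \<le> 1/2 \<Longrightarrow> s / 2 \<le> \<bar>k i - k j + s * (l i - l j + \<epsilon>)\<bar>"
proof
  define before where "before i = {j. k j < k i \<or> k j = k i \<and> j < i}" for i
  define l where "l i = real (card (before i))" for i
  show "0 \<le> l i \<and> l i \<le> CARD('n)" for i by (simp add: l_def card_mono)
  have gap: "k j \<le> k i \<and> 1 \<le> l i - l j" if "j \<in> before i" for i j
  proof
    show "k j \<le> k i" using that by (auto simp: before_def)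
    have "before j \<subset> before i" using that by (fastforce simp: before_def)
    then have "card (before j) < card (before i)" by (intro psubset_card_mono) auto
    then show "1 \<le> l i - l j" by (simp add: l_def)
  qed
  fix i j :: 'n and s \<epsilon> :: real assume ij: "i \<noteq> j" and s: "0 \<le> s" and \<epsilon>: "\<bar>\<epsilon>\<bar> \<le> 1/2"
  consider "j \<in> before i" | "i \<in> before j" using ij by (fastforce simp: before_def)
  then show "s / 2 \<le> \<bar>k i - k j + s * (l i - l j + \<epsilon>)\<bar>"
  proof cases
    case 1
    have "s * (1/2) \<le> s * (l i - l j + \<epsilon>)" using gap[OF 1] \<epsilon> s by (intro mult_left_mono) auto
    then show ?thesis using gap[OF 1] by linarith
  next
    case 2
    have "s * (l i - l j + \<epsilon>) \<le> s * (- 1/2)" using gap[OF 2] \<epsilon> s by (intro mult_left_mono) auto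
    then show ?thesis using gap[OF 2] by linarith
  qed
qed

text \<open>
  The bound depends on the distance alone and is uniform near collisions. From \<open>x\<close> the bodies are
  spread along a direction \<open>e\<close> according to the order of their \<open>e\<close>-components, from \<open>y\<close> along an
  orthogonal direction \<open>f\<close> according to their \<open>f\<close>-components; this is where the dimension enters. Doing
  both at once, with velocity \<open>v\<close>, leads from \<open>x\<close> to \<open>x + \<rho> v\<close>. For \<open>\<rho> = 4 r\<close> the same point is reached
  from \<open>y\<close> with the velocity \<open>v + (x - y) / \<rho>\<close>, whose \<open>f\<close>-components are perturbed so little that the
  bodies still separate.
\<close>

theorem action_potential_modulus:
  fixes m :: "'n::{finite,linorder} \<Rightarrow> real"
  assumes dim: "DIM('a::euclidean_space) \<ge> 2" and m_pos: "\<And>i. m i > 0" and h: "h \<ge> 0"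
  obtains C where "C \<ge> 0"
    "\<And>(x :: ('a, 'n) config) y r. 0 < r \<Longrightarrow> norm (x - y) \<le> r \<Longrightarrow>
       action_potential m h x y \<le> ereal (C * (sqrt r + r * sqrt r))"
proof -
  obtain e f :: 'a where ef: "e \<in> Basis" "f \<in> Basis" "e \<noteq> f"
  proof -
    have "Basis \<noteq> {e :: 'a}" for e
    proof
      assume "Basis = {e}"
      then have "DIM('a) = card {e}" by (rule arg_cong)
      then show False using dim by simp
    qed
    moreover obtain e :: 'a where "e \<in> Basis" using nonempty_Basis by blast
    ultimately obtain f where "f \<in> Basis" "f \<noteq> e" by blast
    then show thesis using that \<open>e \<in> Basis\<close> by blast
  qed
  obtain B0 where B0: "B0 > 0" "\<And>v :: ('a, 'n) config. mass_norm m v \<le> B0 * norm v"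
    by (rule mass_norm_upper[where m = m, OF m_pos]) blast
  define N where "N = real CARD('n)"
  define B where "B = B0 * (2 * N * N + 1)"
  define C0 where "C0 = 2/3 * B\<^sup>2 + 6 * mass_sum m + h"
  have C0: "C0 \<ge> 0" using mass_sum_nonneg[where m = m, OF m_pos] h by (simp add: C0_def)
  have main: "action_potential m h x y \<le> ereal (2 * C0 * (sqrt (4 * r) + 4 * r * sqrt (4 * r)))"
    if r: "0 < r" "norm (x - y) \<le> r" for x y :: "('a, 'n) config" and r
  proof -
    obtain p :: "'n \<Rightarrow> real" where p: "\<And>i. 0 \<le> p i \<and> p i \<le> N"
      "\<And>i j s \<epsilon>. i \<noteq> j \<Longrightarrow> 0 \<le> s \<Longrightarrow> \<bar>\<epsilon>\<bar> \<le> 1/2 \<Longrightarrow> s / 2 \<le> \<bar>x $ i \<bullet> e - x $ j \<bullet> e + s * (p i - p j + \<epsilon>)\<bar>"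
      unfolding N_def by (rule sorted_weights[of "\<lambda>i. x $ i \<bullet> e"]) blast
    obtain q :: "'n \<Rightarrow> real" where q: "\<And>i. 0 \<le> q i \<and> q i \<le> N"
      "\<And>i j s \<epsilon>. i \<noteq> j \<Longrightarrow> 0 \<le> s \<Longrightarrow> \<bar>\<epsilon>\<bar> \<le> 1/2 \<Longrightarrow> s / 2 \<le> \<bar>y $ i \<bullet> f - y $ j \<bullet> f + s * (q i - q j + \<epsilon>)\<bar>"
      unfolding N_def by (rule sorted_weights[of "\<lambda>i. y $ i \<bullet> f"]) blast
    define v :: "('a, 'n) config" where "v = (\<chi> i. p i *\<^sub>R e + q i *\<^sub>R f)"
    define \<rho> where "\<rho> = 4 * r"
    define w where "w = v + (x - y) /\<^sub>R \<rho>"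
    have \<rho>: "\<rho> > 0" using r by (simp add: \<rho>_def)
    have inn: "e \<bullet> e = 1" "f \<bullet> f = 1" "e \<bullet> f = 0" "f \<bullet> e = 0" using ef by (auto simp: inner_Basis)
    have nv: "norm v \<le> 2 * N * N"
    proof -
      have "norm v \<le> (\<Sum>i\<in>UNIV. norm (v $ i))" unfolding norm_vec_def by (rule L2_set_le_sum) simp
      also have "\<dots> \<le> (\<Sum>i\<in>(UNIV :: 'n set). 2 * N)"
      proof (rule sum_mono)
        fix i :: 'n
        have "norm (v $ i) \<le> norm (p i *\<^sub>R e) + norm (q i *\<^sub>R f)"
          by (simp add: v_def norm_triangle_ineq del: norm_scaleR)
        also have "\<dots> \<le> 2 * N" using p(1)[of i] q(1)[of i] ef by simp
        finally show "norm (v $ i) \<le> 2 * N" .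
      qed
      finally show ?thesis by (simp add: N_def)
    qed
    have small: "norm ((x - y) /\<^sub>R \<rho>) \<le> 1/4"
    proof -
      have "norm ((x - y) /\<^sub>R \<rho>) = norm (x - y) / \<rho>"
        using \<rho> by (simp only: norm_scaleR) (simp add: divide_inverse mult.commute)
      also have "\<dots> \<le> 1/4" using r by (simp add: \<rho>_def)
      finally show ?thesis .
    qed
    have nw: "norm w \<le> 2 * N * N + 1"
      using norm_triangle_ineq[of v "(x - y) /\<^sub>R \<rho>"] small nv unfolding w_def by linarith
    have Bv: "mass_norm m v \<le> B" "mass_norm m w \<le> B"
      using order_trans[OF B0(2)[of v]] order_trans[OF B0(2)[of w]] nv nw B0(1) unfolding B_def by auto
    have sepx: "s / 2 \<le> norm ((x + s *\<^sub>R v) $ i - (x + s *\<^sub>R v) $ j)" if "i < j" "0 < s" for i j s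
    proof -
      have "s / 2 \<le> \<bar>x $ i \<bullet> e - x $ j \<bullet> e + s * (p i - p j + 0)\<bar>" using p(2)[of i j s 0] that by simp
      also have "\<dots> = \<bar>((x + s *\<^sub>R v) $ i - (x + s *\<^sub>R v) $ j) \<bullet> e\<bar>"
        by (simp add: v_def inner_add_left inner_diff_left inn algebra_simps)
      also have "\<dots> \<le> norm ((x + s *\<^sub>R v) $ i - (x + s *\<^sub>R v) $ j)" by (rule Basis_le_norm[OF ef(1)])
      finally show ?thesis .
    qed
    have sepy: "s / 2 \<le> norm ((y + s *\<^sub>R w) $ i - (y + s *\<^sub>R w) $ j)" if "i < j" "0 < s" for i j s
    proof -
      define d where "d = (x - y) /\<^sub>R \<rho>"
      have wd: "w = v + d" by (simp add: w_def d_def)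
      have "\<bar>d $ i \<bullet> f\<bar> \<le> 1/4" for i
        using Basis_le_norm[OF ef(2), of "d $ i"] Finite_Cartesian_Product.norm_nth_le[of d i] small unfolding d_def by linarith
      from this[of i] this[of j] have "\<bar>d $ i \<bullet> f - d $ j \<bullet> f\<bar> \<le> 1/2" by linarith
      from q(2)[OF _ _ this, of i j s] that
      have "s / 2 \<le> \<bar>y $ i \<bullet> f - y $ j \<bullet> f + s * (q i - q j + (d $ i \<bullet> f - d $ j \<bullet> f))\<bar>" by simp
      also have "\<dots> = \<bar>((y + s *\<^sub>R w) $ i - (y + s *\<^sub>R w) $ j) \<bullet> f\<bar>"
        by (simp add: v_def wd inner_add_left inner_diff_left inn algebra_simps)
      also have "\<dots> \<le> norm ((y + s *\<^sub>R w) $ i - (y + s *\<^sub>R w) $ j)" by (rule Basis_le_norm[OF ef(2)])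
      finally show ?thesis .
    qed
    \<comment> \<open>The two rays meet, and the way back to \<open>y\<close> is the reversed second ray.\<close>
    have meet: "y + \<rho> *\<^sub>R w = x + \<rho> *\<^sub>R v" using \<rho> by (simp add: w_def algebra_simps)
    have "action_potential m h x y \<le> action_potential m h x (x + \<rho> *\<^sub>R v) + action_potential m h (x + \<rho> *\<^sub>R v) y"
      by (rule action_potential_triangle)
    also have "action_potential m h (x + \<rho> *\<^sub>R v) y = action_potential m h y (y + \<rho> *\<^sub>R w)"
      unfolding meet by (rule action_potential_sym)
    also have "action_potential m h x (x + \<rho> *\<^sub>R v) + action_potential m h y (y + \<rho> *\<^sub>R w)
        \<le> ereal (C0 * (sqrt \<rho> + \<rho> * sqrt \<rho>)) + ereal (C0 * (sqrt \<rho> + \<rho> * sqrt \<rho>))"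
      unfolding C0_def
      by (intro add_mono action_potential_ray[where m = m, OF m_pos sepx Bv(1) \<rho> h] action_potential_ray[where m = m, OF m_pos sepy Bv(2) \<rho> h])
    finally show ?thesis by (simp add: \<rho>_def mult.assoc)
  qed
  show thesis
  proof (rule that[of "16 * C0"])
    show "0 \<le> 16 * C0" using C0 by simp
    fix x y :: "('a, 'n) config" and r :: real assume r: "0 < r" "norm (x - y) \<le> r"
    have "sqrt (4 * r) = 2 * sqrt r" by (simp add: real_sqrt_mult)
    then have "2 * C0 * (sqrt (4 * r) + 4 * r * sqrt (4 * r)) = 16 * C0 * (sqrt r + r * sqrt r) - 12 * C0 * sqrt r"
      by (simp add: algebra_simps)
    also have "\<dots> \<le> 16 * C0 * (sqrt r + r * sqrt r)" using C0 r by simp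
    finally show "action_potential m h x y \<le> ereal (16 * C0 * (sqrt r + r * sqrt r))"
      using main[OF r] by (meson ereal_less_eq(3) order_trans)
  qed
qed

section \<open>Lower semicontinuity of the action\<close>

lemma kinetic_borel_measurable [measurable]: "kinetic m \<in> borel_measurable borel"
  unfolding kinetic_def
  by (intro borel_measurable_continuous_onI continuous_intros continuous_on_mass_norm)

lemma kinetic_tendsto:
  assumes "(f \<longlongrightarrow> v) F"
  shows "((\<lambda>t. kinetic m (f t)) \<longlongrightarrow> kinetic m v) F"
proof -
  have "continuous_on UNIV (kinetic m)"
    unfolding kinetic_def by (intro continuous_intros continuous_on_mass_norm)
  from continuous_on_tendsto_compose[OF this assms] show ?thesis by simp
qed

text \<open>
  By Jensen's inequality the kinetic energy of a difference quotient is at most the mean of the energy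
  over an interval of length \<open>\<delta>\<close>; exchanging the integrals, every instant is counted with total
  weight at most \<open>1\<close>.
\<close>

lemma difference_quotient_energy_le:
  fixes \<gamma> :: "real \<Rightarrow> ('a::euclidean_space, 'n::{finite,linorder}) config"
  assumes m_pos: "\<And>i. m i > 0" and \<gamma>: "primitive_on 0 T \<gamma> g" and \<delta>: "0 < \<delta>"
  shows "(\<integral>\<^sup>+t\<in>{0..T-\<delta>}. ennreal (kinetic m ((\<gamma> (t + \<delta>) - \<gamma> t) /\<^sub>R \<delta>)) \<partial>lborel)
    \<le> (\<integral>\<^sup>+t\<in>{0..T}. ennreal (kinetic m (g t)) \<partial>lborel)"
proof -
  have gm[measurable]: "g \<in> borel_measurable borel"
    using primitive_onD(1)[OF \<gamma>] by (simp add: borel_measurable_integrable)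
  define k where "k s = ennreal (kinetic m (g s)) * indicator {0..T} s" for s
  have km[measurable]: "k \<in> borel_measurable borel" unfolding k_def by measurable
  define f where "f t s = ennreal (1 / \<delta>) * (if t \<le> s \<and> s \<le> t + \<delta> then k s else 0)" for t s :: real
  have "(\<lambda>(t, s). f t s) \<in> borel_measurable (borel \<Otimes>\<^sub>M borel)" unfolding f_def by measurable
  then have fm: "(\<lambda>(t, s). f t s) \<in> borel_measurable (lborel \<Otimes>\<^sub>M lborel)" by simp
  have "(\<integral>\<^sup>+t\<in>{0..T-\<delta>}. ennreal (kinetic m ((\<gamma> (t + \<delta>) - \<gamma> t) /\<^sub>R \<delta>)) \<partial>lborel) \<le> (\<integral>\<^sup>+t. (\<integral>\<^sup>+s. f t s \<partial>lborel) \<partial>lborel)"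
  proof (rule nn_integral_mono)
    fix t
    show "ennreal (kinetic m ((\<gamma> (t + \<delta>) - \<gamma> t) /\<^sub>R \<delta>)) * indicator {0..T-\<delta>} t \<le> (\<integral>\<^sup>+s. f t s \<partial>lborel)"
    proof (cases "t \<in> {0..T-\<delta>}")
      case True
      then have t: "0 \<le> t" "t + \<delta> \<le> T" by auto
      have "ennreal (kinetic m ((\<gamma> (t + \<delta>) - \<gamma> t) /\<^sub>R \<delta>)) = ennreal (1 / \<delta>) * ennreal (\<delta> * kinetic m ((\<gamma> (t + \<delta>) - \<gamma> t) /\<^sub>R \<delta>))"
        using \<delta> by (simp add: ennreal_mult[symmetric] kinetic_nonneg[OF m_pos])
      also have "\<dots> \<le> ennreal (1 / \<delta>) * (\<integral>\<^sup>+s\<in>{t..t+\<delta>}. ennreal (kinetic m (g s)) \<partial>lborel)"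
        using kinetic_jensen[where m = m, OF m_pos \<gamma>, of t "t + \<delta>"] t \<delta> by (intro mult_left_mono) auto
      also have "\<dots> = (\<integral>\<^sup>+s. ennreal (1 / \<delta>) * (ennreal (kinetic m (g s)) * indicator {t..t+\<delta>} s) \<partial>lborel)"
        by (rule nn_integral_cmult[symmetric]) measurable
      also have "\<dots> = (\<integral>\<^sup>+s. f t s \<partial>lborel)"
        by (intro nn_integral_cong) (use t in \<open>auto simp: f_def k_def indicator_def\<close>)
      finally show ?thesis using True by simp
    qed simp
  qed
  also have "\<dots> = (\<integral>\<^sup>+s. (\<integral>\<^sup>+t. f t s \<partial>lborel) \<partial>lborel)"
    using lborel_pair.Fubini'[OF fm] by simp
  also have "\<dots> = (\<integral>\<^sup>+s. k s \<partial>lborel)"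
  proof (rule nn_integral_cong)
    fix s
    have "(\<integral>\<^sup>+t. f t s \<partial>lborel) = (\<integral>\<^sup>+t. (ennreal (1 / \<delta>) * k s) * indicator {s-\<delta>..s} t \<partial>lborel)"
      by (intro nn_integral_cong) (auto simp: f_def indicator_def)
    also have "\<dots> = ennreal (1 / \<delta>) * k s * ennreal \<delta>" using \<delta> by (simp add: nn_integral_cmult_indicator)
    also have "\<dots> = (ennreal (1 / \<delta>) * ennreal \<delta>) * k s" by (simp add: mult_ac)
    also have "ennreal (1 / \<delta>) * ennreal \<delta> = 1" using \<delta> by (simp add: ennreal_mult[symmetric])
    finally show "(\<integral>\<^sup>+t. f t s \<partial>lborel) = k s" by simp
  qed
  finally show ?thesis by (simp add: k_def)
qed

text \<open>
  Tonelli's theorem for pointwise convergence. Velocities need not converge, but for fixed \<open>\<delta>\<close> the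
  difference quotients do, and their energy is at most that of the velocity. Fatou's lemma is applied
  once for \<open>n \<rightarrow> \<infinity>\<close> at fixed \<open>\<delta>\<close>, and once more for \<open>\<delta> \<rightarrow> 0\<close> along the limit curve.
\<close>

theorem action_lower_semicontinuous:
  fixes G :: "nat \<Rightarrow> real \<Rightarrow> ('a::euclidean_space, 'n::{finite,linorder}) config"
  assumes m_pos: "\<And>i. m i > 0" and T: "T > 0"
    and G: "\<And>n. abs_continuous_on 0 T (G n)" "\<And>n. continuous_on UNIV (G n)"
    and \<gamma>: "abs_continuous_on 0 T \<gamma>" "continuous_on UNIV \<gamma>"
    and lim: "\<And>t. (\<lambda>n. G n t) \<longlonglongrightarrow> \<gamma> t"
    and le: "\<And>n. action_Lh m h 0 T (G n) \<le> ereal (\<alpha> n)" and \<alpha>: "\<alpha> \<longlonglongrightarrow> \<alpha>'"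
  shows "action_Lh m h 0 T \<gamma> \<le> ereal \<alpha>'"
proof -
  have "\<exists>g. primitive_on 0 T (G n) g" for n using G(1) abs_continuous_on_iff_primitive[of 0 T] T by auto
  then obtain gn where gn: "\<And>n. primitive_on 0 T (G n) (gn n)" by metis
  obtain g where g: "primitive_on 0 T \<gamma> g" using \<gamma>(1) abs_continuous_on_iff_primitive[of 0 T] T by auto
  have \<alpha>0: "0 \<le> \<alpha> n" for n using order_trans[OF action_nonneg le[of n]] by simp
  have \<alpha>'0: "0 \<le> \<alpha>'" by (rule LIMSEQ_le_const[OF \<alpha>]) (use \<alpha>0 in auto)
  have leI: "(\<integral>\<^sup>+t\<in>{0..T}. lagrangian_plus m h (G n t) (gn n t) \<partial>lborel) \<le> ennreal (\<alpha> n)" for n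
    using le[of n] unfolding action_eq_lborel[OF gn] less_eq_ennreal.rep_eq enn2ereal_ennreal[OF \<alpha>0] .
  have G_m[measurable]: "G n \<in> borel_measurable borel" for n by (rule borel_measurable_continuous_onI[OF G(2)])
  have \<gamma>_m[measurable]: "\<gamma> \<in> borel_measurable borel" by (rule borel_measurable_continuous_onI[OF \<gamma>(2)])
  have pot[measurable]: "newton_potential m \<in> borel_measurable borel" by (rule newton_potential_borel_measurable)
  have gn_m[measurable]: "gn n \<in> borel_measurable borel" for n
    using primitive_onD(1)[OF gn] by (simp add: borel_measurable_integrable)
  define K where "K \<delta> c t = ennreal (kinetic m ((c (t + \<delta>) - c t) /\<^sub>R \<delta>)) * indicator {0..T-\<delta>} t"
    for \<delta> t and c :: "real \<Rightarrow> ('a, 'n) config"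
  define V where "V c t = (newton_potential m (c t) + ennreal h) * indicator {0..T} t"
    for t and c :: "real \<Rightarrow> ('a, 'n) config"
  have Km[measurable]: "K \<delta> c \<in> borel_measurable borel" "V c \<in> borel_measurable borel" if [measurable]: "c \<in> borel_measurable borel" for \<delta> c
    unfolding K_def V_def by measurable
  \<comment> \<open>Fatou's lemma along the sequence, at a fixed step \<open>\<delta>\<close>.\<close>
  have step1: "(\<integral>\<^sup>+t. K \<delta> \<gamma> t + V \<gamma> t \<partial>lborel) \<le> ennreal \<alpha>'" if \<delta>: "\<delta> > 0" for \<delta>
  proof -
    have conv: "(\<lambda>n. K \<delta> (G n) t + V (G n) t) \<longlonglongrightarrow> K \<delta> \<gamma> t + V \<gamma> t" for t
    proof (intro tendsto_add)
      have "(\<lambda>n. ennreal (kinetic m ((G n (t + \<delta>) - G n t) /\<^sub>R \<delta>))) \<longlonglongrightarrow> ennreal (kinetic m ((\<gamma> (t + \<delta>) - \<gamma> t) /\<^sub>R \<delta>))"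
        by (intro tendsto_ennrealI kinetic_tendsto tendsto_scaleR tendsto_const tendsto_diff lim)
      then show "(\<lambda>n. K \<delta> (G n) t) \<longlonglongrightarrow> K \<delta> \<gamma> t" by (auto simp: K_def indicator_def)
      have "(\<lambda>n. newton_potential m (G n t) + ennreal h) \<longlonglongrightarrow> newton_potential m (\<gamma> t) + ennreal h"
        by (intro tendsto_add tendsto_const newton_potential_tendsto lim)
      then show "(\<lambda>n. V (G n) t) \<longlonglongrightarrow> V \<gamma> t" by (auto simp: V_def indicator_def)
    qed
    have "(\<integral>\<^sup>+t. K \<delta> \<gamma> t + V \<gamma> t \<partial>lborel) = (\<integral>\<^sup>+t. liminf (\<lambda>n. K \<delta> (G n) t + V (G n) t) \<partial>lborel)"
      by (intro nn_integral_cong) (simp add: lim_imp_Liminf[OF _ conv])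
    also have "\<dots> \<le> liminf (\<lambda>n. \<integral>\<^sup>+t. K \<delta> (G n) t + V (G n) t \<partial>lborel)"
      by (rule nn_integral_liminf) measurable
    also have "\<dots> \<le> liminf (\<lambda>n. ennreal (\<alpha> n))"
    proof (intro Liminf_mono always_eventually allI)
      fix n
      have "(\<integral>\<^sup>+t. K \<delta> (G n) t + V (G n) t \<partial>lborel) = (\<integral>\<^sup>+t. K \<delta> (G n) t \<partial>lborel) + (\<integral>\<^sup>+t. V (G n) t \<partial>lborel)"
        by (intro nn_integral_add) measurable
      also have "(\<integral>\<^sup>+t. K \<delta> (G n) t \<partial>lborel) \<le> (\<integral>\<^sup>+t\<in>{0..T}. ennreal (kinetic m (gn n t)) \<partial>lborel)"
        unfolding K_def by (rule difference_quotient_energy_le[where m = m, OF m_pos gn \<delta>])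
      also have "(\<integral>\<^sup>+t\<in>{0..T}. ennreal (kinetic m (gn n t)) \<partial>lborel) + (\<integral>\<^sup>+t. V (G n) t \<partial>lborel)
          = (\<integral>\<^sup>+t. ennreal (kinetic m (gn n t)) * indicator {0..T} t + V (G n) t \<partial>lborel)"
        by (intro nn_integral_add[symmetric]) measurable
      also have "\<dots> = (\<integral>\<^sup>+t\<in>{0..T}. lagrangian_plus m h (G n t) (gn n t) \<partial>lborel)"
        by (intro nn_integral_cong) (auto simp: V_def lagrangian_def kinetic_def indicator_def add_ac)
      also note leI
      finally show "(\<integral>\<^sup>+t. K \<delta> (G n) t + V (G n) t \<partial>lborel) \<le> ennreal (\<alpha> n)" by simp
    qed
    also have "\<dots> = ennreal \<alpha>'" by (intro lim_imp_Liminf tendsto_ennrealI \<alpha>) simp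
    finally show ?thesis .
  qed
  \<comment> \<open>Fatou's lemma for steps tending to zero, along the limit curve.\<close>
  define \<delta> where "\<delta> n = T / (real n + 2)" for n :: nat
  have \<delta>: "\<delta> n > 0" for n using T by (simp add: \<delta>_def)
  have \<delta>0: "\<delta> \<longlonglongrightarrow> 0"
  proof -
    have "(\<lambda>n. T * (1 / real (n + 2))) \<longlonglongrightarrow> T * 0"
      by (intro tendsto_mult tendsto_const LIMSEQ_ignore_initial_segment[OF lim_1_over_n])
    then show ?thesis by (simp add: \<delta>_def[abs_def] add.commute)
  qed
  have "(\<integral>\<^sup>+t\<in>{0..T}. lagrangian_plus m h (\<gamma> t) (g t) \<partial>lborel) = (\<integral>\<^sup>+t. liminf (\<lambda>n. K (\<delta> n) \<gamma> t + V \<gamma> t) \<partial>lborel)"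
  proof (rule nn_integral_cong_AE)
    show "AE t in lborel. lagrangian_plus m h (\<gamma> t) (g t) * indicator {0..T} t = liminf (\<lambda>n. K (\<delta> n) \<gamma> t + V \<gamma> t)"
      using primitive_on_AE_derivative[OF g] AE_lborel_singleton[of 0] AE_lborel_singleton[of T]
    proof eventually_elim
      case (elim t)
      show ?case
      proof (cases "0 < t \<and> t < T")
        case True
        then have "(\<gamma> has_vector_derivative g t) (at t)" using elim(1) by simp
        then have "((\<lambda>s. (\<gamma> s - \<gamma> t - (s - t) *\<^sub>R g t) /\<^sub>R norm (s - t)) \<longlongrightarrow> 0) (at t)"
          unfolding has_vector_derivative_def has_derivative_at_within by simp
        moreover have "filterlim (\<lambda>n. t + \<delta> n) (at t) sequentially"
        proof -
          have "(\<lambda>n. t + \<delta> n) \<longlonglongrightarrow> t" using tendsto_add[OF tendsto_const \<delta>0, of t] by simp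
          moreover have "t + \<delta> n \<noteq> t" for n using \<delta>[of n] by simp
          ultimately show ?thesis unfolding filterlim_at by simp
        qed
        ultimately have "(\<lambda>n. (\<gamma> (t + \<delta> n) - \<gamma> t - (t + \<delta> n - t) *\<^sub>R g t) /\<^sub>R norm (t + \<delta> n - t)) \<longlonglongrightarrow> 0"
          by (rule filterlim_compose)
        moreover have "(\<gamma> (t + \<delta> n) - \<gamma> t - (t + \<delta> n - t) *\<^sub>R g t) /\<^sub>R norm (t + \<delta> n - t)
            = (\<gamma> (t + \<delta> n) - \<gamma> t) /\<^sub>R \<delta> n - g t" for n
          using \<delta>[of n] by (simp add: scaleR_diff_right scaleR_add_right)
        ultimately have "(\<lambda>n. (\<gamma> (t + \<delta> n) - \<gamma> t) /\<^sub>R \<delta> n - g t) \<longlonglongrightarrow> 0" by simp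
        then have "(\<lambda>n. (\<gamma> (t + \<delta> n) - \<gamma> t) /\<^sub>R \<delta> n) \<longlonglongrightarrow> g t" by (simp only: LIM_zero_iff)
        then have q: "(\<lambda>n. ennreal (kinetic m ((\<gamma> (t + \<delta> n) - \<gamma> t) /\<^sub>R \<delta> n))) \<longlonglongrightarrow> ennreal (kinetic m (g t))"
          by (intro tendsto_ennrealI kinetic_tendsto)
        have "eventually (\<lambda>n. \<delta> n < T - t) sequentially" using \<delta>0 True by (intro order_tendstoD(2)) auto
        then have "eventually (\<lambda>n. ennreal (kinetic m ((\<gamma> (t + \<delta> n) - \<gamma> t) /\<^sub>R \<delta> n)) = K (\<delta> n) \<gamma> t) sequentially"
          by eventually_elim (use True in \<open>auto simp: K_def indicator_def\<close>)
        from tendsto_cong[THEN iffD1, OF this q]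
        have "(\<lambda>n. K (\<delta> n) \<gamma> t + V \<gamma> t) \<longlonglongrightarrow> ennreal (kinetic m (g t)) + V \<gamma> t"
          by (intro tendsto_add tendsto_const)
        from lim_imp_Liminf[OF _ this] show ?thesis
          using True by (simp add: V_def lagrangian_def kinetic_def add_ac)
      next
        case False
        then have t: "t \<notin> {0..T}" using elim by auto
        then have "K (\<delta> n) \<gamma> t + V \<gamma> t = 0" for n using \<delta>[of n] by (auto simp: K_def V_def indicator_def)
        then show ?thesis using t by (simp add: Liminf_const)
      qed
    qed
  qed
  also have "\<dots> \<le> liminf (\<lambda>n. \<integral>\<^sup>+t. K (\<delta> n) \<gamma> t + V \<gamma> t \<partial>lborel)"
    by (rule nn_integral_liminf) measurable
  also have "\<dots> \<le> liminf (\<lambda>n :: nat. ennreal \<alpha>')"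
    by (intro Liminf_mono always_eventually allI step1 \<delta>)
  also have "\<dots> = ennreal \<alpha>'" by (simp add: Liminf_const)
  finally show ?thesis unfolding action_eq_lborel[OF g] less_eq_ennreal.rep_eq enn2ereal_ennreal[OF \<alpha>'0] .
qed

section \<open>Compactness of families of curves\<close>

text \<open>
  A criterion without derivatives (it characterizes the Sobolev class \<open>H\<^sup>1\<close>), which therefore passes to
  pointwise limits.
\<close>

lemma abs_continuous_on_if_energy_bounded:
  assumes M: "\<And>P. packing a b P \<Longrightarrow> (\<Sum>(c, d)\<in>P. (norm (f d - f c))\<^sup>2 / (d - c)) \<le> M"
  shows "abs_continuous_on a b f"
  unfolding abs_continuous_on_iff
proof (intro allI impI)
  fix \<epsilon> :: real assume e: "\<epsilon> > 0"
  have M0: "M \<ge> 0" using M[OF packing_empty] by simp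
  \<comment> \<open>The weight in the arithmetic-geometric mean inequality
      \<open>\<Delta> \<le> l / 2 * (\<Delta>\<^sup>2 / (d - c)) + (d - c) / (2 * l)\<close> for an increment of norm \<open>\<Delta>\<close>.\<close>
  define l where "l = \<epsilon> / (M + 1)"
  have l: "l > 0" "l * M < \<epsilon>" using e M0 by (auto simp: l_def field_simps)
  have "total_increment f P < \<epsilon>" if P: "packing a b P" "total_length P < \<epsilon> * l" for P
  proof -
    have "total_increment f P \<le> (\<Sum>z\<in>P. l / 2 * (case z of (c, d) \<Rightarrow> (norm (f d - f c))\<^sup>2 / (d - c)) + 1 / (2 * l) * (case z of (c, d) \<Rightarrow> d - c))"
    proof (rule sum_mono, clarify)
      fix c d assume "(c, d) \<in> P"
      then have cd: "c < d" using packingD(2)[OF P(1)] by auto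
      have "0 \<le> (l * norm (f d - f c) - (d - c))\<^sup>2 / (2 * l * (d - c))" using l cd by simp
      also have "\<dots> = l / 2 * ((norm (f d - f c))\<^sup>2 / (d - c)) + 1 / (2 * l) * (d - c) - norm (f d - f c)"
      proof -
        have "(l * x - y)\<^sup>2 / (2 * l * y) = l / 2 * (x\<^sup>2 / y) + 1 / (2 * l) * y - x" if "y > 0" for x y
          using l(1) that by (simp add: power2_eq_square field_simps)
        from this[of "d - c" "norm (f d - f c)"] cd show ?thesis by simp
      qed
      finally show "norm (f d - f c) \<le> l / 2 * ((norm (f d - f c))\<^sup>2 / (d - c)) + 1 / (2 * l) * (d - c)" by simp
    qed
    also have "\<dots> = l / 2 * (\<Sum>(c, d)\<in>P. (norm (f d - f c))\<^sup>2 / (d - c)) + 1 / (2 * l) * total_length P"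
      by (simp only: sum.distrib sum_distrib_left)
    also have "\<dots> < l / 2 * M + 1 / (2 * l) * (\<epsilon> * l)"
      using l P M[OF P(1)] by (intro add_le_less_mono mult_left_mono mult_strict_left_mono) auto
    also have "\<dots> < \<epsilon>" using l by (simp add: field_simps)
    finally show ?thesis .
  qed
  then show "\<exists>\<delta>>0. \<forall>P. packing a b P \<and> total_length P < \<delta> \<longrightarrow> total_increment f P < \<epsilon>"
    using e l by (intro exI[of _ "\<epsilon> * l"]) auto
qed

text \<open>
  Arzela--Ascoli on the whole line. Both hypotheses concern only large \<open>n\<close>, with a bound and a threshold
  that may depend on the point; dividing by the bound reduces the extraction at rational points to the
  uniformly bounded case.
\<close>

lemma pointwise_convergent_subsequence:
  fixes f :: "nat \<Rightarrow> real \<Rightarrow> 'b::euclidean_space"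
  assumes bnd: "\<And>t. \<exists>M N. \<forall>n\<ge>N. norm (f n t) \<le> M"
    and equi: "\<And>t e. e > 0 \<Longrightarrow> \<exists>d>0. \<exists>N. \<forall>n\<ge>N. \<forall>s. \<bar>s - t\<bar> < d \<longrightarrow> norm (f n s - f n t) < e"
  obtains r g where "strict_mono (r :: nat \<Rightarrow> nat)" "\<And>t. (\<lambda>n. f (r n) t) \<longlonglongrightarrow> g t"
proof -
  have "\<exists>M>0. \<forall>n. norm (f n t) \<le> M" for t
  proof -
    obtain M N where MN: "\<And>n. n \<ge> N \<Longrightarrow> norm (f n t) \<le> M" using bnd by blast
    have "norm (f n t) \<le> max M (\<Sum>i<N. norm (f i t)) + 1" for n
    proof (cases "n < N")
      case True
      then have "norm (f n t) \<le> (\<Sum>i<N. norm (f i t))" by (intro member_le_sum) auto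
      then show ?thesis by linarith
    next
      case False
      then show ?thesis using MN[of n] by simp
    qed
    moreover have "max M (\<Sum>i<N. norm (f i t)) + 1 > 0"
      using sum_nonneg[of "{..<N}" "\<lambda>i. norm (f i t)"] by auto
    ultimately show ?thesis by blast
  qed
  then obtain M where M: "\<And>t. M t > 0" "\<And>t n. norm (f n t) \<le> M t" by metis
  obtain r where r: "strict_mono (r :: nat \<Rightarrow> nat)"
    "\<And>q. q \<in> \<rat> \<Longrightarrow> \<exists>l. (\<lambda>n. f (r n) q /\<^sub>R M q) \<longlonglongrightarrow> l"
  proof (rule function_convergent_subsequence[of "\<rat> :: real set" "\<lambda>n q. f n q /\<^sub>R M q" 1])
    show "countable (\<rat> :: real set)" by (rule countable_rat)
    show "norm (f n q /\<^sub>R M q) \<le> 1" for n q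
      using M(1)[of q] M(2)[of n q] by (simp add: field_simps)
  qed blast
  have convq: "convergent (\<lambda>n. f (r n) q)" if q: "q \<in> \<rat>" for q
  proof -
    obtain l where "(\<lambda>n. f (r n) q /\<^sub>R M q) \<longlonglongrightarrow> l" using r(2)[OF q] by blast
    then have "(\<lambda>n. M q *\<^sub>R (f (r n) q /\<^sub>R M q)) \<longlonglongrightarrow> M q *\<^sub>R l" by (intro tendsto_scaleR tendsto_const)
    then show ?thesis using M(1)[of q] by (auto simp: convergent_def)
  qed
  have "convergent (\<lambda>n. f (r n) t)" for t
  proof (rule Cauchy_convergent, rule metric_CauchyI)
    fix e :: real assume "e > 0"
    then have e3: "e / 3 > 0" by simp
    obtain d N where d: "d > 0" "\<And>n s. n \<ge> N \<Longrightarrow> \<bar>s - t\<bar> < d \<Longrightarrow> norm (f n s - f n t) < e / 3"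
      using equi[OF e3] by blast
    obtain q where q: "q \<in> \<rat>" "t < q" "q < t + d" using Rats_dense_in_real[of t "t + d"] d by auto
    obtain N' where N': "\<And>i j. i \<ge> N' \<Longrightarrow> j \<ge> N' \<Longrightarrow> dist (f (r i) q) (f (r j) q) < e / 3"
      using metric_CauchyD[OF convergent_Cauchy[OF convq[OF q(1)]] e3] by blast
    have "dist (f (r i) t) (f (r j) t) < e" if "i \<ge> max N N'" "j \<ge> max N N'" for i j
    proof -
      have "dist (f (r k) q) (f (r k) t) < e / 3" if "k \<ge> N" for k
        using d(2)[of "r k" q] q order_trans[OF that seq_suble[OF r(1)]] by (simp add: dist_norm)
      from this[of i] this[of j] have "dist (f (r i) q) (f (r i) t) < e / 3" "dist (f (r j) q) (f (r j) t) < e / 3"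
        using that by auto
      moreover have "dist (f (r i) q) (f (r j) q) < e / 3" using N' that by simp
      moreover have "dist (f (r i) t) (f (r j) t) \<le> dist (f (r i) q) (f (r i) t) + dist (f (r i) q) (f (r j) q) + dist (f (r j) q) (f (r j) t)"
        by metric
      ultimately show ?thesis by linarith
    qed
    then show "\<exists>M. \<forall>i\<ge>M. \<forall>j\<ge>M. dist (f (r i) t) (f (r j) t) < e" by blast
  qed
  then obtain g where "\<And>t. (\<lambda>n. f (r n) t) \<longlonglongrightarrow> g t" unfolding convergent_def by metis
  with that r(1) show thesis by blast
qed

section \<open>Nearly minimizing curves\<close>

lemma action_subinterval_le:
  assumes F: "measurable_lagrangian F" and \<gamma>: "abs_continuous_on a b \<gamma>" and st: "a \<le> s" "s \<le> t" "t \<le> b"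
  shows "action F s t \<gamma> \<le> action F a b \<gamma>"
proof -
  have "action F s t \<gamma> \<le> action F a s \<gamma> + action F s t \<gamma>"
    using add_mono[OF action_nonneg[of F a s \<gamma>] order_refl[of "action F s t \<gamma>"]] by simp
  also have "\<dots> = action F a t \<gamma>"
    using action_combine[OF F abs_continuous_on_subinterval[OF \<gamma> order_refl st(3)] st(1,2)] by simp
  also have "\<dots> \<le> action F a t \<gamma> + action F t b \<gamma>"
    using add_mono[OF order_refl[of "action F a t \<gamma>"] action_nonneg[of F t b \<gamma>]] by simp
  also have "\<dots> = action F a b \<gamma>"
    using action_combine[OF F \<gamma>, of t] st by simp
  finally show ?thesis .
qed

lemma action_profile:
  assumes F: "measurable_lagrangian F" and \<gamma>: "abs_continuous_on a b \<gamma>" and A: "action F a b \<gamma> \<le> ereal A"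
  obtains \<Phi> where "\<And>s t. a \<le> s \<Longrightarrow> s \<le> t \<Longrightarrow> t \<le> b \<Longrightarrow> action F s t \<gamma> = ereal (\<Phi> t - \<Phi> s)"
proof
  define \<Phi> where "\<Phi> t = real_of_ereal (action F a t \<gamma>)" for t
  have fin: "action F s t \<gamma> = ereal (real_of_ereal (action F s t \<gamma>))" if "a \<le> s" "s \<le> t" "t \<le> b" for s t
  proof -
    have "action F s t \<gamma> \<le> ereal A" using action_subinterval_le[OF F \<gamma> that] A by (rule order_trans)
    then show ?thesis using action_nonneg[of F s t \<gamma>] by (cases "action F s t \<gamma>") auto
  qed
  fix s t assume st: "a \<le> s" "s \<le> t" "t \<le> b"
  have "action F a t \<gamma> = action F a s \<gamma> + action F s t \<gamma>"
    using action_combine[OF F abs_continuous_on_subinterval[OF \<gamma> order_refl st(3)] st(1,2)] .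
  then have "ereal (\<Phi> t) = ereal (\<Phi> s) + action F s t \<gamma>"
    using fin[of a t] fin[of a s] st by (simp add: \<Phi>_def)
  then show "action F s t \<gamma> = ereal (\<Phi> t - \<Phi> s)" by (cases "action F s t \<gamma>") auto
qed

text \<open>
  Let \<open>d\<close> be the distance between the endpoints. The modulus bounds the action by a multiple of
  \<open>(d + 1) powr (3/2)\<close>, while the action is at least a multiple of \<open>d\<^sup>2 / b\<close>. Hence \<open>d\<close>, and with it the action,
  is bounded in terms of \<open>T\<close>.
\<close>

lemma near_minimizer_bounded:
  fixes m :: "'n::{finite,linorder} \<Rightarrow> real"
  assumes dim: "DIM('a::euclidean_space) \<ge> 2" and m_pos: "\<And>i. m i > 0" and h: "h \<ge> 0" and T: "T > 0"
  obtains D M where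
    "\<And>b (\<gamma> :: real \<Rightarrow> ('a, 'n) config). 0 < b \<Longrightarrow> b \<le> T \<Longrightarrow> abs_continuous_on 0 b \<gamma> \<Longrightarrow>
       action_Lh m h 0 b \<gamma> \<le> action_potential m h (\<gamma> 0) (\<gamma> b) + 1 \<Longrightarrow>
       norm (\<gamma> b - \<gamma> 0) \<le> D \<and> action_Lh m h 0 b \<gamma> \<le> ereal M"
proof -
  obtain C where C: "C \<ge> 0" "\<And>(x :: ('a, 'n) config) y r. 0 < r \<Longrightarrow> norm (x - y) \<le> r \<Longrightarrow>
       action_potential m h x y \<le> ereal (C * (sqrt r + r * sqrt r))"
    by (rule action_potential_modulus[where m = m, OF dim m_pos h]) blast
  obtain \<kappa> where \<kappa>: "\<kappa> > 0" "\<And>(\<gamma> :: real \<Rightarrow> ('a, 'n) config) a b h A. abs_continuous_on a b \<gamma> \<Longrightarrow> a < b \<Longrightarrow>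
       action_Lh m h a b \<gamma> \<le> ereal A \<Longrightarrow> \<kappa> * (norm (\<gamma> b - \<gamma> a))\<^sup>2 \<le> (b - a) * A"
    by (rule displacement_le_action[where m = m, OF m_pos]) blast
  \<comment> \<open>With \<open>s = sqrt (d + 1)\<close> the action is at most \<open>(2 * C + 1) * s ^ 3\<close>, and \<open>d \<ge> s\<^sup>2 / 2\<close> once \<open>s \<ge> 2\<close>, so
      \<open>\<kappa> * s ^ 4 / 4 \<le> T * (2 * C + 1) * s ^ 3\<close>; this fails for \<open>s > S\<close>.\<close>
  define S where "S = max 2 (4 * T * (2 * C + 1) / \<kappa>)"
  have S: "S \<ge> 2" "4 * T * (2 * C + 1) / \<kappa> \<le> S" by (auto simp: S_def)
  show thesis
  proof (rule that[of "S\<^sup>2" "(2 * C + 1) * S ^ 3"])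
    fix b and \<gamma> :: "real \<Rightarrow> ('a, 'n) config"
    assume b: "0 < b" "b \<le> T" and \<gamma>: "abs_continuous_on 0 b \<gamma>"
      and near: "action_Lh m h 0 b \<gamma> \<le> action_potential m h (\<gamma> 0) (\<gamma> b) + 1"
    define d where "d = norm (\<gamma> b - \<gamma> 0)"
    define s where "s = sqrt (d + 1)"
    have d: "d \<ge> 0" by (simp add: d_def)
    have s: "s \<ge> 1" "s\<^sup>2 = d + 1" using d by (simp_all add: s_def)
    have "action_potential m h (\<gamma> 0) (\<gamma> b) \<le> ereal (C * (s + s\<^sup>2 * s))"
      using C(2)[of "d + 1" "\<gamma> 0" "\<gamma> b"] d by (simp add: s(2)) (simp add: s_def d_def norm_minus_commute)
    then have "action_Lh m h 0 b \<gamma> \<le> ereal (C * (s + s\<^sup>2 * s)) + 1"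
      using near by (meson add_right_mono order_trans)
    also have "\<dots> = ereal (C * (s + s\<^sup>2 * s) + 1)" by (simp add: one_ereal_def)
    also have "\<dots> \<le> ereal ((2 * C + 1) * s ^ 3)"
    proof -
      have s3: "s \<le> s ^ 3" "1 \<le> s ^ 3" using s(1) self_le_power[of s 3] by auto
      have "C * (s + s\<^sup>2 * s) \<le> C * (2 * s ^ 3)"
        using s3 by (intro mult_left_mono C(1)) (simp add: power2_eq_square power3_eq_cube)
      then show ?thesis using s3 by (simp add: algebra_simps)
    qed
    finally have A: "action_Lh m h 0 b \<gamma> \<le> ereal ((2 * C + 1) * s ^ 3)" .
    have "s \<le> S"
    proof (rule ccontr)
      assume "\<not> s \<le> S"
      then have sS: "s > S" by simp
      have "2 \<le> s * s" using sS S(1) mult_mono[of 2 s 1 s] s(1) by auto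
      then have "s\<^sup>2 / 2 \<le> d" using s(2) by (simp add: power2_eq_square)
      then have "(s\<^sup>2 / 2)\<^sup>2 \<le> d\<^sup>2" by (intro power_mono) auto
      then have "\<kappa> * (s\<^sup>2 / 2)\<^sup>2 \<le> \<kappa> * d\<^sup>2" using \<kappa>(1) by simp
      also have "\<dots> \<le> b * ((2 * C + 1) * s ^ 3)" using \<kappa>(2)[OF \<gamma> b(1) A] by (simp add: d_def)
      also have "\<dots> \<le> T * ((2 * C + 1) * s ^ 3)" using b C(1) s(1) by (intro mult_right_mono) auto
      finally have "(\<kappa> * s) * s ^ 3 \<le> (4 * T * (2 * C + 1)) * s ^ 3"
        by (simp add: power2_eq_square power3_eq_cube field_simps)
      then have "\<kappa> * s \<le> 4 * T * (2 * C + 1)" using s(1) by (simp add: mult_le_cancel_right)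
      then have "s \<le> 4 * T * (2 * C + 1) / \<kappa>" using \<kappa>(1) by (simp add: field_simps)
      then show False using S(2) sS by simp
    qed
    moreover have "d \<le> s\<^sup>2" using s(2) by simp
    moreover have "s\<^sup>2 \<le> S\<^sup>2" "s ^ 3 \<le> S ^ 3" using \<open>s \<le> S\<close> s(1) by (auto intro: power_mono)
    moreover have "(2 * C + 1) * s ^ 3 \<le> (2 * C + 1) * S ^ 3"
      using \<open>s ^ 3 \<le> S ^ 3\<close> C(1) by (intro mult_left_mono) auto
    ultimately show "norm (\<gamma> b - \<gamma> 0) \<le> S\<^sup>2 \<and> action_Lh m h 0 b \<gamma> \<le> ereal ((2 * C + 1) * S ^ 3)"
      using A unfolding d_def by (meson ereal_less_eq(3) order_trans)
  qed
qed

text \<open>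
  An initial arc of a nearly minimizing curve is nearly minimizing, with the same error. The first
  estimate is the one from which calibration results, the second gives compactness.
\<close>

lemma near_minimizer_initial_segment:
  fixes \<gamma> :: "real \<Rightarrow> ('a::euclidean_space, 'n::{finite,linorder}) config"
  assumes \<gamma>: "abs_continuous_on 0 b \<gamma>" and t: "0 \<le> t" "t < b"
    and P: "\<And>x y :: ('a, 'n) config. action_potential m h x y = ereal (P x y)"
    and near: "action_Lh m h 0 b \<gamma> \<le> ereal (P (\<gamma> 0) (\<gamma> b) + e)"
  shows "action_Lh m h 0 t \<gamma> \<le> ereal (P (\<gamma> 0) (\<gamma> b) - P (\<gamma> t) (\<gamma> b) + e)"
    and "action_Lh m h 0 t \<gamma> \<le> ereal (P (\<gamma> 0) (\<gamma> t) + e)"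
proof -
  have "action_Lh m h 0 t \<gamma> + ereal (P (\<gamma> t) (\<gamma> b)) \<le> action_Lh m h 0 t \<gamma> + action_Lh m h t b \<gamma>"
    using action_potential_le[OF abs_continuous_on_subinterval[OF \<gamma> t(1) order_refl] t(2), of m h]
    by (intro add_left_mono) (simp add: P)
  also have "\<dots> = action_Lh m h 0 b \<gamma>"
    using action_combine[OF measurable_lagrangian_plus \<gamma>, of t] t by simp
  also note near
  finally have *: "action_Lh m h 0 t \<gamma> + ereal (P (\<gamma> t) (\<gamma> b)) \<le> ereal (P (\<gamma> 0) (\<gamma> b) + e)" .
  then show 1: "action_Lh m h 0 t \<gamma> \<le> ereal (P (\<gamma> 0) (\<gamma> b) - P (\<gamma> t) (\<gamma> b) + e)"
    by (cases "action_Lh m h 0 t \<gamma>") auto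
  have "P (\<gamma> 0) (\<gamma> b) \<le> P (\<gamma> 0) (\<gamma> t) + P (\<gamma> t) (\<gamma> b)"
    using action_potential_triangle[of m h "\<gamma> 0" "\<gamma> b" "\<gamma> t"] by (simp add: P)
  then show "action_Lh m h 0 t \<gamma> \<le> ereal (P (\<gamma> 0) (\<gamma> t) + e)"
    by (intro order_trans[OF 1]) simp
qed

section \<open>Calibrated rays and the Lax-Oleinik semigroup\<close>

text \<open>
  The ray is a limit of curves \<open>c n\<close> from \<open>x\<close> to \<open>p n\<close> whose action exceeds the infimum by at most
  \<open>\<epsilon> n\<close>. Their durations tend to infinity, because a nearly minimizing curve of bounded duration has
  bounded displacement. On every \<open>[0, T]\<close> their actions are bounded, which gives a subsequence converging at
  all times. For the limit \<open>\<gamma>\<close> semicontinuity bounds the action on \<open>[0, t]\<close> by the limit of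
  \<open>P x (p n) - P (c n t) (p n)\<close>. Replacing \<open>c n t\<close> by \<open>\<gamma> t\<close> costs at most the modulus of continuity at a
  distance that tends to zero, and the remaining difference converges to \<open>u x - u (\<gamma> t)\<close>.
\<close>

theorem calibrated_ray_exists:
  fixes m :: "'n::{finite,linorder} \<Rightarrow> real" and p :: "nat \<Rightarrow> ('a::euclidean_space, 'n) config"
  assumes dim: "DIM('a) \<ge> 2" and m_pos: "\<And>i. m i > 0" and h: "h \<ge> 0"
    and P: "\<And>x y :: ('a, 'n) config. action_potential m h x y = ereal (P x y)"
    and p: "filterlim (\<lambda>n. norm (p n)) at_top sequentially"
    and u: "\<And>x. (\<lambda>n. P x (p n) - P 0 (p n)) \<longlonglongrightarrow> u x"
  obtains \<gamma> :: "real \<Rightarrow> ('a, 'n) config" where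
    "\<And>T. 0 < T \<Longrightarrow> abs_continuous_on 0 T \<gamma>" "\<gamma> 0 = x"
    "\<And>t. 0 < t \<Longrightarrow> action_Lh m h 0 t \<gamma> \<le> ereal (u x - u (\<gamma> t))"
proof -
  note meas = measurable_lagrangian_plus[of m h]
  obtain C where C: "C \<ge> 0" "\<And>(x :: ('a, 'n) config) y r. 0 < r \<Longrightarrow> norm (x - y) \<le> r \<Longrightarrow>
       action_potential m h x y \<le> ereal (C * (sqrt r + r * sqrt r))"
    by (rule action_potential_modulus[where m = m, OF dim m_pos h]) blast
  obtain \<kappa> where \<kappa>: "\<kappa> > 0" "\<And>(\<gamma> :: real \<Rightarrow> ('a, 'n) config) a b h A. abs_continuous_on a b \<gamma> \<Longrightarrow> a < b \<Longrightarrow>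
       action_Lh m h a b \<gamma> \<le> ereal A \<Longrightarrow> \<kappa> * (norm (\<gamma> b - \<gamma> a))\<^sup>2 \<le> (b - a) * A"
    by (rule displacement_le_action[where m = m, OF m_pos]) blast
  define \<epsilon> where "\<epsilon> n = 1 / (real n + 1)" for n :: nat
  have \<epsilon>: "0 < \<epsilon> n" "\<epsilon> n \<le> 1" for n by (auto simp: \<epsilon>_def)
  have \<epsilon>0: "\<epsilon> \<longlonglongrightarrow> 0" unfolding \<epsilon>_def[abs_def] using LIMSEQ_inverse_real_of_nat by (simp add: inverse_eq_divide add.commute)
  have "\<exists>b c. 0 < b \<and> abs_continuous_on 0 b c \<and> c 0 = x \<and> c b = p n \<and> action_Lh m h 0 b c \<le> ereal (P x (p n) + \<epsilon> n)" for n
  proof -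
    have "action_potential m h x (p n) < ereal (P x (p n) + \<epsilon> n)" using \<epsilon>(1) by (simp add: P)
    then show ?thesis by (rule action_potential_approx) (blast intro: less_imp_le)
  qed
  then obtain b c where bc: "\<And>n. 0 < b n" "\<And>n. abs_continuous_on 0 (b n) (c n)" "\<And>n. c n 0 = x" "\<And>n. c n (b n) = p n"
    "\<And>n. action_Lh m h 0 (b n) (c n) \<le> ereal (P x (p n) + \<epsilon> n)" by metis
  have long: "eventually (\<lambda>n. T < b n) sequentially" if T: "T > 0" for T
  proof -
    obtain D M where D: "\<And>b (\<gamma> :: real \<Rightarrow> ('a, 'n) config). 0 < b \<Longrightarrow> b \<le> T \<Longrightarrow> abs_continuous_on 0 b \<gamma> \<Longrightarrow>
       action_Lh m h 0 b \<gamma> \<le> action_potential m h (\<gamma> 0) (\<gamma> b) + 1 \<Longrightarrow>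
       norm (\<gamma> b - \<gamma> 0) \<le> D \<and> action_Lh m h 0 b \<gamma> \<le> ereal M"
      by (rule near_minimizer_bounded[where m = m, OF dim m_pos h T]) blast
    have "eventually (\<lambda>n. norm (p n) > D + norm x) sequentially"
      using p by (simp add: filterlim_at_top_dense)
    then show ?thesis
    proof eventually_elim
      case (elim n)
      show ?case
      proof (rule ccontr)
        assume "\<not> T < b n"
        have "action_Lh m h 0 (b n) (c n) \<le> action_potential m h (c n 0) (c n (b n)) + 1"
          using \<epsilon>(2)[of n] by (intro order_trans[OF bc(5)[of n]]) (simp add: P bc one_ereal_def)
        then have "norm (p n - x) \<le> D" using D[of "b n" "c n"] bc \<open>\<not> T < b n\<close> by auto
        then show False using elim norm_triangle_ineq2[of "p n" x] by linarith
      qed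
    qed
  qed
  \<comment> \<open>Extending the curves by constants makes them continuous on the line; on \<open>[0, T]\<close> this changes
      nothing as soon as \<open>T < b n\<close>.\<close>
  define G where "G n t = c n (max 0 (min (b n) t))" for n t
  have G_eq: "G n t = c n t" if "0 \<le> t" "t \<le> b n" for n t using that by (simp add: G_def)
  have G_neg: "G n t = x" if "t \<le> 0" for n t using that bc(1)[of n] bc(3) by (simp add: G_def)
  have G_max: "G n (max 0 t) = G n t" for n t
    unfolding G_def by (rule arg_cong[where f = "c n"]) (use bc(1)[of n] in auto)
  have G_cont: "continuous_on UNIV (G n)" for n
    unfolding G_def
    by (rule continuous_on_compose2[OF abs_continuous_on_imp_continuous_on[OF bc(2)]])
       (use bc(1)[of n] in \<open>auto intro!: continuous_intros\<close>)
  have G_ac: "abs_continuous_on 0 T (G n)" if "T < b n" for n T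
    using abs_continuous_on_cong[OF abs_continuous_on_subinterval[OF bc(2)[of n], of 0 T], of "G n"] that G_eq by auto
  have G_action: "action_Lh m h 0 T (G n) = action_Lh m h 0 T (c n)" if "0 \<le> T" "T < b n" for n T
    by (rule action_cong) (use that G_eq abs_continuous_on_subinterval[OF bc(2)[of n], of 0 T] in auto)
  have energy: "\<exists>M N. 0 \<le> M \<and> (\<forall>n\<ge>N. T < b n \<and> action_Lh m h 0 T (G n) \<le> ereal M)" if T: "T > 0" for T
  proof -
    obtain D M where D: "\<And>b (\<gamma> :: real \<Rightarrow> ('a, 'n) config). 0 < b \<Longrightarrow> b \<le> T \<Longrightarrow> abs_continuous_on 0 b \<gamma> \<Longrightarrow>
       action_Lh m h 0 b \<gamma> \<le> action_potential m h (\<gamma> 0) (\<gamma> b) + 1 \<Longrightarrow>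
       norm (\<gamma> b - \<gamma> 0) \<le> D \<and> action_Lh m h 0 b \<gamma> \<le> ereal M"
      by (rule near_minimizer_bounded[where m = m, OF dim m_pos h T]) blast
    obtain N where N: "\<And>n. n \<ge> N \<Longrightarrow> T < b n" using long[OF T] by (auto simp: eventually_sequentially)
    have "action_Lh m h 0 T (G n) \<le> ereal M" if n: "n \<ge> N" for n
    proof -
      have "action_Lh m h 0 T (c n) \<le> ereal (P (c n 0) (c n T) + \<epsilon> n)"
        by (rule near_minimizer_initial_segment(2)[OF bc(2) _ N[OF n] P]) (use T bc in auto)
      also have "\<dots> \<le> action_potential m h (c n 0) (c n T) + 1" using \<epsilon>(2)[of n] by (simp add: P one_ereal_def)
      finally have "action_Lh m h 0 T (c n) \<le> ereal M"
        using D[OF T order_refl abs_continuous_on_subinterval[OF bc(2)[of n] order_refl]] N[OF n] by auto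
      then show ?thesis using G_action[of T n] T N[OF n] by simp
    qed
    moreover from this[OF order_refl] have "0 \<le> M" using order_trans[OF action_nonneg] by fastforce
    ultimately show ?thesis using N by blast
  qed
  have displacement: "\<exists>M N. 0 \<le> M \<and> (\<forall>n\<ge>N. \<forall>s t. \<bar>s\<bar> \<le> T \<and> \<bar>t\<bar> \<le> T \<longrightarrow> \<kappa> * (norm (G n t - G n s))\<^sup>2 \<le> \<bar>t - s\<bar> * M)"
    if T: "T > 0" for T
  proof -
    obtain M N where MN: "0 \<le> M" "\<And>n. n \<ge> N \<Longrightarrow> T < b n \<and> action_Lh m h 0 T (G n) \<le> ereal M"
      using energy[OF T] by blast
    have mono: "\<kappa> * (norm (G n t - G n s))\<^sup>2 \<le> (t - s) * M" if n: "n \<ge> N" and st: "0 \<le> s" "s \<le> t" "t \<le> T" for n s t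
    proof (cases "s = t")
      case False
      then have "s < t" using st by simp
      have ac: "abs_continuous_on 0 T (G n)" using G_ac MN(2)[OF n] by blast
      have "action_Lh m h s t (G n) \<le> ereal M"
        using action_subinterval_le[OF meas ac st] MN(2)[OF n] by (blast intro: order_trans)
      from \<kappa>(2)[OF abs_continuous_on_subinterval[OF ac st(1,3)] \<open>s < t\<close> this] show ?thesis .
    qed simp
    have "\<kappa> * (norm (G n t - G n s))\<^sup>2 \<le> \<bar>t - s\<bar> * M" if n: "n \<ge> N" and st: "\<bar>s\<bar> \<le> T" "\<bar>t\<bar> \<le> T" for n s t
    proof -
      define s' t' where "s' = max 0 s" and "t' = max 0 t"
      have bnds: "0 \<le> s'" "0 \<le> t'" "s' \<le> T" "t' \<le> T" "\<bar>t' - s'\<bar> \<le> \<bar>t - s\<bar>" using st T by (auto simp: s'_def t'_def)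
      have "\<kappa> * (norm (G n t' - G n s'))\<^sup>2 \<le> \<bar>t' - s'\<bar> * M"
      proof (cases "s' \<le> t'")
        case True
        then show ?thesis using mono[OF n bnds(1) True bnds(4)] by simp
      next
        case False
        then have "t' \<le> s'" by simp
        then show ?thesis using mono[OF n bnds(2) _ bnds(3)] by (simp add: norm_minus_commute)
      qed
      also have "\<dots> \<le> \<bar>t - s\<bar> * M" by (rule mult_right_mono[OF bnds(5) MN(1)])
      finally show ?thesis by (simp add: s'_def t'_def G_max)
    qed
    then show ?thesis using MN(1) by blast
  qed
  have bnd: "\<exists>M N. \<forall>n\<ge>N. norm (G n t) \<le> M" for t
  proof -
    define T where "T = \<bar>t\<bar> + 1"
    have T: "T > 0" by (simp add: T_def)
    obtain M N where MN: "0 \<le> M" "\<And>n s t. n \<ge> N \<Longrightarrow> \<bar>s\<bar> \<le> T \<Longrightarrow> \<bar>t\<bar> \<le> T \<Longrightarrow> \<kappa> * (norm (G n t - G n s))\<^sup>2 \<le> \<bar>t - s\<bar> * M"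
      using displacement[OF T] by blast
    have "norm (G n t) \<le> norm x + sqrt (\<bar>t\<bar> * M / \<kappa>)" if "n \<ge> N" for n
    proof -
      have "\<kappa> * (norm (G n t - x))\<^sup>2 \<le> \<bar>t\<bar> * M"
        using MN(2)[OF that, of 0 t] G_neg[of 0 n] by (simp add: T_def)
      then have "(norm (G n t - x))\<^sup>2 \<le> \<bar>t\<bar> * M / \<kappa>" using \<kappa>(1) by (simp add: field_simps)
      then have "norm (G n t - x) \<le> sqrt (\<bar>t\<bar> * M / \<kappa>)" by (rule real_le_rsqrt)
      then show ?thesis using norm_triangle_ineq2[of "G n t" x] by linarith
    qed
    then show ?thesis by blast
  qed
  have equi: "\<exists>d>0. \<exists>N. \<forall>n\<ge>N. \<forall>s. \<bar>s - t\<bar> < d \<longrightarrow> norm (G n s - G n t) < e" if e: "e > 0" for t e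
  proof -
    define T where "T = \<bar>t\<bar> + 1"
    have T: "T > 0" by (simp add: T_def)
    obtain M N where MN: "0 \<le> M" "\<And>n s t. n \<ge> N \<Longrightarrow> \<bar>s\<bar> \<le> T \<Longrightarrow> \<bar>t\<bar> \<le> T \<Longrightarrow> \<kappa> * (norm (G n t - G n s))\<^sup>2 \<le> \<bar>t - s\<bar> * M"
      using displacement[OF T] by blast
    define d where "d = min 1 (e\<^sup>2 * \<kappa> / (M + 1))"
    have d: "d > 0" using e \<kappa>(1) MN(1) by (simp add: d_def)
    have "norm (G n s - G n t) < e" if n: "n \<ge> N" and s: "\<bar>s - t\<bar> < d" for n s
    proof -
      have "\<bar>s\<bar> \<le> T" "\<bar>t\<bar> \<le> T" using s by (auto simp: T_def d_def)
      from MN(2)[OF n this(2) this(1)] have "\<kappa> * (norm (G n s - G n t))\<^sup>2 \<le> \<bar>s - t\<bar> * M" .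
      also have "\<dots> \<le> \<bar>s - t\<bar> * (M + 1)" using MN(1) by (intro mult_left_mono) auto
      also have "\<dots> < e\<^sup>2 * \<kappa> / (M + 1) * (M + 1)" using s MN(1) by (intro mult_strict_right_mono) (auto simp: d_def)
      also have "\<dots> = \<kappa> * e\<^sup>2" using MN(1) by simp
      finally have "(norm (G n s - G n t))\<^sup>2 < e\<^sup>2" using \<kappa>(1) by simp
      then show ?thesis using e by (simp add: power2_less_imp_less)
    qed
    then show ?thesis using d by blast
  qed
  obtain r \<gamma> where r: "strict_mono (r :: nat \<Rightarrow> nat)" and lim: "\<And>t. (\<lambda>n. G (r n) t) \<longlonglongrightarrow> \<gamma> t"
    by (rule pointwise_convergent_subsequence[of G, OF bnd equi]) (assumption, rule that)
  have r_ge: "n \<le> r n" for n by (rule seq_suble[OF r])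
  have \<gamma>0: "\<gamma> 0 = x"
    using LIMSEQ_unique[OF lim[of 0]] G_neg[of 0] by simp
  have \<gamma>_cont: "continuous_on UNIV \<gamma>"
    unfolding continuous_on_iff
  proof (intro ballI allI impI)
    fix t e :: real assume "e > 0"
    then have e2: "e / 2 > 0" by simp
    obtain d N where d: "d > 0" "\<And>n s. n \<ge> N \<Longrightarrow> \<bar>s - t\<bar> < d \<Longrightarrow> norm (G n s - G n t) < e / 2"
      using equi[OF e2, of t] by blast
    have "dist (\<gamma> s) (\<gamma> t) < e" if s: "dist s t < d" for s
    proof -
      have "norm (\<gamma> s - \<gamma> t) \<le> e / 2"
      proof (rule LIMSEQ_le_const2[OF tendsto_norm[OF tendsto_diff[OF lim lim]]])
        show "\<exists>N. \<forall>n\<ge>N. norm (G (r n) s - G (r n) t) \<le> e / 2"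
        proof (intro exI[of _ N] allI impI)
          fix n assume "N \<le> n"
          then have "N \<le> r n" using r_ge by (rule order_trans)
          from d(2)[OF this, of s] s show "norm (G (r n) s - G (r n) t) \<le> e / 2" by (simp add: dist_real_def)
        qed
      qed
      then show ?thesis using \<open>e > 0\<close> by (simp add: dist_norm)
    qed
    then show "\<exists>d>0. \<forall>x'\<in>UNIV. dist x' t < d \<longrightarrow> dist (\<gamma> x') (\<gamma> t) < e" using d(1) by blast
  qed
  have \<gamma>_ac: "abs_continuous_on 0 T \<gamma>" if T: "T > 0" for T
  proof -
    obtain M N where MN: "0 \<le> M" "\<And>n. n \<ge> N \<Longrightarrow> T < b n \<and> action_Lh m h 0 T (G n) \<le> ereal M"
      using energy[OF T] by blast
    show ?thesis
    proof (rule abs_continuous_on_if_energy_bounded)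
      fix Q assume Q: "packing 0 T Q"
      have Gn: "(\<Sum>(s, t)\<in>Q. (norm (G n t - G n s))\<^sup>2 / (t - s)) \<le> M / \<kappa>" if n: "n \<ge> N" for n
      proof -
        have ac: "abs_continuous_on 0 T (G n)" using G_ac MN(2)[OF n] by blast
        obtain \<Phi> where \<Phi>: "\<And>s t. 0 \<le> s \<Longrightarrow> s \<le> t \<Longrightarrow> t \<le> T \<Longrightarrow> action_Lh m h s t (G n) = ereal (\<Phi> t - \<Phi> s)"
          using action_profile[OF meas ac] MN(2)[OF n] by blast
        have "(\<Sum>(s, t)\<in>Q. (norm (G n t - G n s))\<^sup>2 / (t - s)) \<le> (\<Sum>z\<in>Q. (case z of (s, t) \<Rightarrow> \<Phi> t - \<Phi> s) / \<kappa>)"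
        proof (rule sum_mono, clarify)
          fix s t assume "(s, t) \<in> Q"
          then have st: "0 \<le> s" "s < t" "t \<le> T" using packingD(2)[OF Q] by auto
          have "action_Lh m h s t (G n) \<le> ereal (\<Phi> t - \<Phi> s)" using \<Phi> st by simp
          from \<kappa>(2)[OF abs_continuous_on_subinterval[OF ac st(1,3)] st(2) this]
          have "\<kappa> * (norm (G n t - G n s))\<^sup>2 \<le> (t - s) * (\<Phi> t - \<Phi> s)" .
          then show "(norm (G n t - G n s))\<^sup>2 / (t - s) \<le> (\<Phi> t - \<Phi> s) / \<kappa>"
            using st \<kappa>(1) by (simp add: field_simps)
        qed
        also have "\<dots> = (\<Sum>(s, t)\<in>Q. \<Phi> t - \<Phi> s) / \<kappa>" by (simp add: sum_divide_distrib)
        also have "\<dots> \<le> (\<Phi> T - \<Phi> 0) / \<kappa>"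
        proof (rule divide_right_mono[OF packing_telescope[OF Q]])
          fix s t assume st: "0 \<le> s" "s \<le> t" "t \<le> T"
          show "\<Phi> s \<le> \<Phi> t" using action_nonneg[of "lagrangian_plus m h" s t "G n"] \<Phi>[OF st] by simp
        qed (use T \<kappa>(1) in auto)
        also have "\<dots> \<le> M / \<kappa>" using MN(2)[OF n] \<Phi>[of 0 T] T \<kappa>(1) by (intro divide_right_mono) auto
        finally show ?thesis .
      qed
      show "(\<Sum>(s, t)\<in>Q. (norm (\<gamma> t - \<gamma> s))\<^sup>2 / (t - s)) \<le> M / \<kappa>"
      proof (rule LIMSEQ_le_const2)
        show "(\<lambda>n. \<Sum>(s, t)\<in>Q. (norm (G (r n) t - G (r n) s))\<^sup>2 / (t - s)) \<longlonglongrightarrow> (\<Sum>(s, t)\<in>Q. (norm (\<gamma> t - \<gamma> s))\<^sup>2 / (t - s))"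
        proof (rule tendsto_sum, clarify)
          fix s t assume "(s, t) \<in> Q"
          then have "t - s \<noteq> 0" using packingD(2)[OF Q] by fastforce
          then show "(\<lambda>n. (norm (G (r n) t - G (r n) s))\<^sup>2 / (t - s)) \<longlonglongrightarrow> (norm (\<gamma> t - \<gamma> s))\<^sup>2 / (t - s)"
            by (intro tendsto_divide tendsto_power tendsto_norm tendsto_diff lim tendsto_const)
        qed
        show "\<exists>N. \<forall>n\<ge>N. (\<Sum>(s, t)\<in>Q. (norm (G (r n) t - G (r n) s))\<^sup>2 / (t - s)) \<le> M / \<kappa>"
          using Gn r_ge order_trans by blast
      qed
    qed
  qed
  have calib: "action_Lh m h 0 t \<gamma> \<le> ereal (u x - u (\<gamma> t))" if t: "t > 0" for t
  proof -
    obtain N where N: "\<And>n. n \<ge> N \<Longrightarrow> t < b n" using long[OF t] by (auto simp: eventually_sequentially)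
    define k where "k n = r (n + N)" for n
    have k: "t < b (k n)" for n using N[of "k n"] r_ge[of "n + N"] by (simp add: k_def)
    have lim_k: "(\<lambda>n. f (k n)) \<longlonglongrightarrow> l" if "(\<lambda>n. f (r n)) \<longlonglongrightarrow> l" for f :: "nat \<Rightarrow> 'c::topological_space" and l
      using LIMSEQ_ignore_initial_segment[OF that, of N] by (simp add: k_def)
    have sub: "(\<lambda>n. f (k n)) \<longlonglongrightarrow> l" if "f \<longlonglongrightarrow> l" for f :: "nat \<Rightarrow> real" and l
      by (rule lim_k) (use LIMSEQ_subseq_LIMSEQ[OF that r] in \<open>simp add: o_def\<close>)
    \<comment> \<open>The modulus applies to positive radii; \<open>\<epsilon> n\<close> makes \<open>\<rho> n\<close> one.\<close>
    define \<rho> where "\<rho> n = norm (\<gamma> t - G (k n) t) + \<epsilon> n" for n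
    have \<rho>: "\<rho> n > 0" for n using \<epsilon>(1)[of n] by (simp add: \<rho>_def add_nonneg_pos)
    define \<alpha> where "\<alpha> n = (P x (p (k n)) - P 0 (p (k n))) - (P (\<gamma> t) (p (k n)) - P 0 (p (k n)))
        + \<epsilon> (k n) + C * (sqrt (\<rho> n) + \<rho> n * sqrt (\<rho> n))" for n
    have le: "action_Lh m h 0 t (G (k n)) \<le> ereal (\<alpha> n)" for n
    proof -
      have "action_Lh m h 0 t (c (k n)) \<le> ereal (P (c (k n) 0) (c (k n) (b (k n))) - P (c (k n) t) (c (k n) (b (k n))) + \<epsilon> (k n))"
        by (rule near_minimizer_initial_segment(1)[OF bc(2) _ k P]) (use t bc in auto)
      then have 1: "action_Lh m h 0 t (G (k n)) \<le> ereal (P x (p (k n)) - P (G (k n) t) (p (k n)) + \<epsilon> (k n))"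
        using G_action[of t "k n"] G_eq[of t "k n"] t k[of n] bc by simp
      have "P (\<gamma> t) (p (k n)) \<le> P (\<gamma> t) (G (k n) t) + P (G (k n) t) (p (k n))"
        using action_potential_triangle[of m h "\<gamma> t" "p (k n)" "G (k n) t"] by (simp add: P)
      moreover have "P (\<gamma> t) (G (k n) t) \<le> C * (sqrt (\<rho> n) + \<rho> n * sqrt (\<rho> n))"
        using C(2)[OF \<rho>[of n], of "\<gamma> t" "G (k n) t"] \<epsilon>(1)[of n] by (simp add: P \<rho>_def less_imp_le)
      ultimately show ?thesis by (intro order_trans[OF 1]) (simp add: \<alpha>_def)
    qed
    have \<rho>_lim: "\<rho> \<longlonglongrightarrow> 0"
    proof -
      have "(\<lambda>n. norm (\<gamma> t - G (k n) t) + \<epsilon> n) \<longlonglongrightarrow> norm (\<gamma> t - \<gamma> t) + 0"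
        by (intro tendsto_add tendsto_norm tendsto_diff tendsto_const \<epsilon>0 lim_k lim)
      then show ?thesis by (simp add: \<rho>_def[abs_def])
    qed
    have "\<alpha> \<longlonglongrightarrow> (u x - u (\<gamma> t)) + 0 + C * (sqrt 0 + 0 * sqrt 0)"
      unfolding \<alpha>_def[abs_def]
      by (intro tendsto_add tendsto_diff tendsto_mult tendsto_real_sqrt tendsto_const \<rho>_lim
          sub[OF \<epsilon>0] sub[OF u[of x]] sub[OF u[of "\<gamma> t"]])
    then have \<alpha>_lim: "\<alpha> \<longlonglongrightarrow> u x - u (\<gamma> t)" by simp
    show ?thesis
      by (rule action_lower_semicontinuous[where m = m, OF m_pos t G_ac[OF k] G_cont \<gamma>_ac[OF t] \<gamma>_cont lim_k[OF lim] le \<alpha>_lim])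
  qed
  show thesis by (rule that[OF \<gamma>_ac \<gamma>0 calib])
qed

text \<open>
  The constant contributes \<open>h\<close> times the elapsed time; this translates calibration by \<open>L + h\<close> into the
  statement about the semigroup, which is built from \<open>L\<close>.
\<close>

lemma action_Lh_eq_action_L:
  assumes \<gamma>: "abs_continuous_on a b \<gamma>" and ab: "a \<le> b" and h: "h \<ge> 0"
  shows "action_Lh m h a b \<gamma> = action_L m a b \<gamma> + ereal (h * (b - a))"
proof -
  obtain g where g: "primitive_on a b \<gamma> g" using \<gamma> ab abs_continuous_on_iff_primitive[of a b \<gamma>] by auto
  have "measurable_lagrangian (lagrangian m)" using measurable_lagrangian_plus[of m 0] by (simp add: lagrangian_plus_zero)
  note meas = borel_measurable_lagrangian_curve[OF this g]
  have "(\<integral>\<^sup>+t\<in>{a..b}. lagrangian_plus m h (\<gamma> t) (g t) \<partial>lborel)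
      = (\<integral>\<^sup>+t. lagrangian m (\<gamma> t) (g t) * indicator {a..b} t + ennreal h * indicator {a..b} t \<partial>lborel)"
    by (intro nn_integral_cong) (simp add: distrib_right)
  also have "\<dots> = (\<integral>\<^sup>+t\<in>{a..b}. lagrangian m (\<gamma> t) (g t) \<partial>lborel) + ennreal (h * (b - a))"
    using ab h by (subst nn_integral_add[OF meas]) (auto simp: nn_integral_cmult_indicator ennreal_mult)
  finally show ?thesis
    using ab h by (simp add: action_eq_lborel[OF g] plus_ennreal.rep_eq enn2ereal_ennreal)
qed

theorem theorem3p2:
  fixes m :: "'n::{finite,linorder} \<Rightarrow> real"
    and h :: real
    and u :: "('a::euclidean_space, 'n) config \<Rightarrow> real"
  assumes "DIM('a) \<ge> 2"
    and "CARD('n) \<ge> 2"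
    and "\<And>i. m i > 0"
    and "h > 0"
    and "u \<in> horofunctions m h"
  shows "(\<forall>x. \<exists>\<gamma> :: real \<Rightarrow> ('a, 'n) config.
            (\<forall>a b. 0 \<le> a \<and> a \<le> b \<longrightarrow> abs_continuous_on a b \<gamma>) \<and> \<gamma> 0 = x \<and>
            (\<forall>t>0. ereal (u x - u (\<gamma> t)) = action_Lh m h 0 t \<gamma>))
       \<and> (\<forall>t>0. \<forall>x. lax_oleinik m t u x = ereal (u x - h * t))"
proof -
  have h0: "h \<ge> 0" using assms(4) by simp
  obtain C where C: "C \<ge> 0" "\<And>(x :: ('a, 'n) config) y r. 0 < r \<Longrightarrow> norm (x - y) \<le> r \<Longrightarrow>
       action_potential m h x y \<le> ereal (C * (sqrt r + r * sqrt r))"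
    by (rule action_potential_modulus[where m = m, OF assms(1,3) h0]) blast
  define P where "P x y = real_of_ereal (action_potential m h x y)" for x y :: "('a, 'n) config"
  have P: "action_potential m h x y = ereal (P x y)" for x y
  proof -
    have "norm (x - y) \<le> norm (x - y) + 1" "0 < norm (x - y) + 1"
      by (simp_all add: add_nonneg_pos)
    from C(2)[OF this(2,1)] show ?thesis
      using action_potential_nonneg[of m h x y] by (cases "action_potential m h x y") (auto simp: P_def)
  qed
  obtain p :: "nat \<Rightarrow> ('a, 'n) config" where p: "filterlim (\<lambda>n. mass_norm m (p n)) at_top sequentially"
    and ulim: "\<And>x. (\<lambda>n. action_potential m h x (p n) - action_potential m h 0 (p n)) \<longlonglongrightarrow> ereal (u x)"
    using assms(5) unfolding horofunctions_def by blast
  have u: "(\<lambda>n. P x (p n) - P 0 (p n)) \<longlonglongrightarrow> u x" for x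
    using ulim[of x] by (simp add: P)
  have pnorm: "filterlim (\<lambda>n. norm (p n)) at_top sequentially"
  proof -
    obtain B where B: "B > 0" "\<And>v :: ('a, 'n) config. mass_norm m v \<le> B * norm v"
      by (rule mass_norm_upper[where m = m, OF assms(3)]) blast
    have "filterlim (\<lambda>n. B * norm (p n)) at_top sequentially"
      by (rule filterlim_at_top_mono[OF p]) (use B(2) in simp)
    then have "filterlim (\<lambda>n. inverse B * (B * norm (p n))) at_top sequentially"
      by (rule filterlim_tendsto_pos_mult_at_top[OF tendsto_const, rotated]) (use B(1) in simp)
    then show ?thesis using B(1) by (simp add: mult.assoc[symmetric])
  qed
  \<comment> \<open>The triangle inequality for \<open>P\<close>, in the limit.\<close>
  have dominated: "u x - u y \<le> P x y" for x y
  proof (rule LIMSEQ_le_const2)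
    show "(\<lambda>n. (P x (p n) - P 0 (p n)) - (P y (p n) - P 0 (p n))) \<longlonglongrightarrow> u x - u y"
      by (intro tendsto_diff u)
    have "P x (p n) \<le> P x y + P y (p n)" for n
      using action_potential_triangle[of m h x "p n" y] by (simp add: P)
    then show "\<exists>N. \<forall>n\<ge>N. (P x (p n) - P 0 (p n)) - (P y (p n) - P 0 (p n)) \<le> P x y"
      by (simp add: algebra_simps)
  qed
  have ray: "\<exists>\<gamma> :: real \<Rightarrow> ('a, 'n) config.
      (\<forall>a b. 0 \<le> a \<and> a \<le> b \<longrightarrow> abs_continuous_on a b \<gamma>) \<and> \<gamma> 0 = x \<and>
      (\<forall>t>0. ereal (u x - u (\<gamma> t)) = action_Lh m h 0 t \<gamma>)" for x
  proof -
    obtain \<gamma> :: "real \<Rightarrow> ('a, 'n) config" where \<gamma>: "\<And>T. 0 < T \<Longrightarrow> abs_continuous_on 0 T \<gamma>" "\<gamma> 0 = x"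
      "\<And>t. 0 < t \<Longrightarrow> action_Lh m h 0 t \<gamma> \<le> ereal (u x - u (\<gamma> t))"
      using calibrated_ray_exists[where m = m and P = P and p = p and u = u and x = x, OF assms(1,3) h0 P pnorm u] by blast
    have "ereal (u x - u (\<gamma> t)) \<le> action_Lh m h 0 t \<gamma>" if "t > 0" for t
    proof -
      have "ereal (u x - u (\<gamma> t)) \<le> action_potential m h (\<gamma> 0) (\<gamma> t)"
        using dominated[of x "\<gamma> t"] by (simp add: P \<gamma>(2))
      also have "\<dots> \<le> action_Lh m h 0 t \<gamma>" by (rule action_potential_le[OF \<gamma>(1)[OF that] that])
      finally show ?thesis .
    qed
    then have "\<forall>t>0. ereal (u x - u (\<gamma> t)) = action_Lh m h 0 t \<gamma>" using \<gamma>(3) by (auto intro: antisym)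
    moreover have "abs_continuous_on a b \<gamma>" if "0 \<le> a" "a \<le> b" for a b
      by (rule abs_continuous_on_subinterval[OF \<gamma>(1)[of "b + 1"]]) (use that in auto)
    ultimately show ?thesis using \<gamma>(2) by blast
  qed
  have "lax_oleinik m t u x = ereal (u x - h * t)" if t: "t > 0" for t x
  proof (rule antisym)
    obtain \<gamma> :: "real \<Rightarrow> ('a, 'n) config" where \<gamma>: "\<And>a b. 0 \<le> a \<Longrightarrow> a \<le> b \<Longrightarrow> abs_continuous_on a b \<gamma>" "\<gamma> 0 = x"
      "ereal (u x - u (\<gamma> t)) = action_Lh m h 0 t \<gamma>" using ray[of x] t by blast
    have ac: "abs_continuous_on 0 t \<gamma>" using \<gamma>(1) t by simp
    \<comment> \<open>The calibrated ray run backwards leads from \<open>\<gamma> t\<close> to \<open>x\<close> and attains the infimum.\<close>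
    have rev: "abs_continuous_on 0 t (\<lambda>s. \<gamma> (t + - 1 * s))"
      "action_Lh m 0 0 t (\<lambda>s. \<gamma> (t + - 1 * s)) = action_Lh m 0 0 t \<gamma>"
      by (rule action_affine[OF measurable_lagrangian_plus lagrangian_plus_even ac]; use t in auto)+
    have "fixed_time_potential m (\<gamma> t) x t \<le> action_L m 0 t (\<lambda>s. \<gamma> (t + - 1 * s))"
      unfolding fixed_time_potential_def
      by (rule INF_lower2[of "(0, t, \<lambda>s. \<gamma> (t + - 1 * s))"])
         (use rev(1) t \<gamma>(2) in \<open>auto simp: curves_time_def curves_def\<close>)
    also have "\<dots> = action_L m 0 t \<gamma>" using rev(2) by (simp add: lagrangian_plus_zero)
    also have "\<dots> = ereal (u x - u (\<gamma> t) - h * t)"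
      using action_Lh_eq_action_L[OF ac _ h0, of m] \<gamma>(3) t by (cases "action_L m 0 t \<gamma>") auto
    finally have "ereal (u (\<gamma> t)) + fixed_time_potential m (\<gamma> t) x t \<le> ereal (u (\<gamma> t)) + ereal (u x - u (\<gamma> t) - h * t)"
      by (rule add_left_mono)
    then show "lax_oleinik m t u x \<le> ereal (u x - h * t)"
      unfolding lax_oleinik_def by (intro INF_lower2[of "\<gamma> t"]) auto
  next
    \<comment> \<open>Curves from \<open>y\<close> to \<open>x\<close> are compared with \<open>P x y\<close> through the symmetry of the potential.\<close>
    have "ereal (u x - h * t) \<le> ereal (u y) + fixed_time_potential m y x t" for y
    proof -
      have "ereal (u x - u y - h * t) \<le> fixed_time_potential m y x t"
        unfolding fixed_time_potential_def
      proof (rule INF_greatest, clarify)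
        fix a b \<gamma> assume "(a, b, \<gamma>) \<in> curves_time y x t"
        then have \<gamma>: "a < b" "abs_continuous_on a b \<gamma>" "\<gamma> a = y" "\<gamma> b = x" "b - a = t"
          by (auto simp: curves_time_def curves_def)
        have "ereal (u x - u y) \<le> action_potential m h (\<gamma> a) (\<gamma> b)"
          using dominated[of x y] action_potential_sym[of m h x y] by (simp add: P \<gamma>)
        also have "\<dots> \<le> action_Lh m h a b \<gamma>" by (rule action_potential_le[OF \<gamma>(2,1)])
        also have "\<dots> = action_L m a b \<gamma> + ereal (h * t)"
          using action_Lh_eq_action_L[OF \<gamma>(2) _ h0, of m] \<gamma> by simp
        finally show "ereal (u x - u y - h * t) \<le> action_L m a b \<gamma>"
          by (cases "action_L m a b \<gamma>") auto
      qed
      then have "ereal (u y) + ereal (u x - u y - h * t) \<le> ereal (u y) + fixed_time_potential m y x t"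
        by (rule add_left_mono)
      then show ?thesis by simp
    qed
    then show "ereal (u x - h * t) \<le> lax_oleinik m t u x"
      unfolding lax_oleinik_def by (intro INF_greatest) auto
  qed
  then show ?thesis using ray by blast
qed

end
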